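(* With respect to the basis $b_1,\dots,b_6=e_1,e_2,e_3,e_4,e_5,e'_6$ of $\mathrm{Jac}(F_4)[4]$, the matrix $(\langle b_i,b_j\rangle)_{i,j}$ of the Weil pairing (with values in $\mathbb{Z}/4\mathbb{Z}$) is $$\begin{pmatrix}0&1&3&0&3&1\\3&0&3&0&1&1\\1&1&0&2&3&0\\0&0&2&0&0&1\\1&3&1&0&0&1\\3&3&0&3&3&0\end{pmatrix}.$$
   Context: Fix $\overline{\mathbb{Q}}\subset\mathbb{C}$; $\zeta_n=\exp(2\pi i/n)$, $2^{1/4}$ the positive real fourth root of $2$. $F_4\subset\mathbb{P}^2$ is the Fermat quartic $X^4+Y^4=Z^4$ over $\mathbb{Q}$; $[D]$ is a linear equivalence class in $\mathrm{Jac}(F_4)(\overline{\mathbb{Q}})=\mathrm{Pic}^0(F_4\otimes\overline{\mathbb{Q}})$. Points: $A_i=[0:\zeta_4^i:1]$, $B_i=[\zeta_4^i:0:1]$, $C_i=[\zeta_8\zeta_4^i:1:0]$, $P_1=[2^{1/4}\zeta_4:\zeta_8:1]$, $P_2=[\zeta_8:2^{1/4}\zeta_4:1]$, $P_3=[2^{-1/4}:2^{-1/4}:1]$; $e_1=[A_1-B_0]$, $e_2=[A_2-B_0]$, $e_3=[B_1-B_0]$, $e_4=[B_2-B_0]$, $e_5=[C_1-B_0]$, $e'_6=[P_1+P_2+P_3-3B_0]$ (a $\mathbb{Z}/4\mathbb{Z}$-basis of $\mathrm{Jac}(F_4)[4]$). The Weil pairing $\langle,\rangle\colon\mathrm{Jac}(F_4)[4]\times\mathrm{Jac}(F_4)[4]\to\mu_4\cong\mathbb{Z}/4\mathbb{Z}$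 (identification via $\zeta_4\mapsto1$) is normalized as follows: for degree-$0$ divisors $D,E$ with $4[D]=4[E]=0$ and rational functions $f_D,f_E$ with $\mathrm{div} f_D=4D$, $\mathrm{div} f_E=4E$, $\langle[D],[E]\rangle=\prod_{P}(-1)^{4(\mathrm{ord}_PD)(\mathrm{ord}_PE)}\,\big(f_E^{\mathrm{ord}_PD}/f_D^{\mathrm{ord}_PE}\big)(P)$, the product over all $P\in F_4(\overline{\mathbb{Q}})$. *)

theory Defs
  imports
    Complex_Main
    "HOL-Algebra.Algebra"
    "HOL-Algebra.Algebraic_Closure_Type"
    "HOL-Algebra.Free_Abelian_Groups"
    "HOL-Library.Numeral_Type"
    "Jordan_Normal_Form.Matrix"
begin

section \<open>Algebraic numbers form a field\<close>

abbreviation complex_ring :: "complex ring" where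
  "complex_ring \<equiv> ring_of_type_algebra"

lemma complex_ring_simps:
  "carrier complex_ring = UNIV" "x \<otimes>\<^bsub>complex_ring\<^esub> y = x * y" "x \<oplus>\<^bsub>complex_ring\<^esub> y = x + y"
  "\<one>\<^bsub>complex_ring\<^esub> = 1" "\<zero>\<^bsub>complex_ring\<^esub> = 0"
  by (simp_all add: ring_of_type_algebra_def)

lemma field_complex_ring: "Ring.field complex_ring"
  by (rule field_from_type_algebra)

interpretation CR: domain complex_ring
  by (rule field.axioms(1)[OF field_complex_ring])

lemma complex_ring_pow: "x [^]\<^bsub>complex_ring\<^esub> (n::nat) = x ^ n"
  by (induction n) (simp_all add: complex_ring_simps CR.nat_pow_Suc)

lemma complex_ring_a_inv: "\<ominus>\<^bsub>complex_ring\<^esub> x = - x"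
proof -
  have "\<ominus>\<^bsub>complex_ring\<^esub> x + x = 0"
    using CR.l_neg[of x] by (simp add: complex_ring_simps)
  thus ?thesis by (simp add: eq_neg_iff_add_eq_0)
qed

lemma complex_ring_m_inv: "x \<noteq> 0 \<Longrightarrow> inv\<^bsub>complex_ring\<^esub> x = inverse x"
proof -
  assume "x \<noteq> 0"
  hence "inv\<^bsub>complex_ring\<^esub> x * x = 1"
    using CR.Units_l_inv[of x] field.field_Units[OF field_complex_ring] by (simp add: complex_ring_simps)
  thus ?thesis by (metis inverse_unique mult.commute)
qed

lemma subfield_Rats: "subfield (\<rat> :: complex set) complex_ring"
proof (rule field.subfieldI'[OF field_complex_ring CR.subringI])
  fix k :: complex assume "k \<in> \<rat> - {\<zero>\<^bsub>complex_ring\<^esub>}"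
  thus "inv\<^bsub>complex_ring\<^esub> k \<in> \<rat>"
    by (simp add: complex_ring_simps complex_ring_m_inv)
qed (simp_all add: complex_ring_simps complex_ring_a_inv)

lemma eval_conv_poly: "CR.eval p x = poly (Poly (rev p)) x"
proof (induction p)
  case (Cons a p)
  show ?case
    using Cons.IH by (simp add: complex_ring_simps complex_ring_pow Poly_append poly_monom algebra_simps)
qed (simp add: complex_ring_simps)

lemma algebraic_iff_algebraic_over:
  "algebraic x \<longleftrightarrow> (CR.algebraic over \<rat>) (x :: complex)"
proof
  assume "algebraic x"
  then obtain p where p: "\<And>i. Polynomial.coeff p i \<in> \<rat>" "p \<noteq> 0" "poly p x = 0"
    unfolding algebraic_altdef by blast
  let ?q = "rev (coeffs p)"
  have "?q \<noteq> []" using p(2) by simp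
  moreover have "set (coeffs p) \<subseteq> \<rat>"
  proof -
    have "range (Polynomial.coeff p) \<subseteq> \<rat>" using p(1) by auto
    thus ?thesis by (simp add: range_coeff)
  qed
  moreover have "hd ?q \<noteq> 0"
    using p(2) by (simp add: hd_rev last_coeffs_eq_coeff_degree)
  ultimately have "?q \<in> carrier (\<rat> [X]\<^bsub>complex_ring\<^esub>)"
    by (subst univ_poly_carrier[symmetric]) (simp add: polynomial_def complex_ring_simps)
  moreover have "CR.eval ?q x = \<zero>\<^bsub>complex_ring\<^esub>"
    using p(3) by (simp add: eval_conv_poly complex_ring_simps)
  ultimately show "(CR.algebraic over \<rat>) x"
    using \<open>?q \<noteq> []\<close> CR.algebraicI by blast
next
  assume "(CR.algebraic over \<rat>) x"
  then obtain p where p: "p \<in> carrier (\<rat> [X]\<^bsub>complex_ring\<^esub>)" "p \<noteq> []" "CR.eval p x = \<zero>\<^bsub>complex_ring\<^esub>"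
    using CR.algebraicE[OF subfieldE(1)[OF subfield_Rats], of x] by (auto simp: complex_ring_simps)
  have rat: "set p \<subseteq> \<rat>" and nz: "hd p \<noteq> 0"
    using p(1,2) unfolding univ_poly_carrier[symmetric] polynomial_def
    by (simp_all add: complex_ring_simps)
  show "algebraic x"
  proof (rule algebraicI')
    show "poly (Poly (rev p)) x = 0"
      using p(3) by (simp add: eval_conv_poly complex_ring_simps)
    show "Polynomial.coeff (Poly (rev p)) i \<in> \<rat>" for i
      using rat by (auto simp: coeff_Poly_eq nth_default_def rev_nth subset_iff)
    have "Polynomial.coeff (Poly (rev p)) (length p - 1) = hd p"
      using p(2) by (simp add: coeff_Poly_eq nth_default_def rev_nth hd_conv_nth)
    thus "Poly (rev p) \<noteq> 0" using nz by (metis Polynomial.coeff_0)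
  qed
qed

lemma subfield_algebraic: "subfield {x::complex. algebraic x} complex_ring"
  using field.subfield_of_algebraics[OF field_complex_ring subfield_Rats]
  by (simp add: complex_ring_simps algebraic_iff_algebraic_over)

lemma algebraic_add: "algebraic x \<Longrightarrow> algebraic y \<Longrightarrow> algebraic (x + y :: complex)"
  using subringE(7)[OF subfieldE(1)[OF subfield_algebraic]] by (auto simp: complex_ring_simps)

lemma algebraic_mult: "algebraic x \<Longrightarrow> algebraic y \<Longrightarrow> algebraic (x * y :: complex)"
  using subringE(6)[OF subfieldE(1)[OF subfield_algebraic]] by (auto simp: complex_ring_simps)

typedef qbar = "{z::complex. algebraic z}"
  morphisms complex_of_qbar qbar_of_complex
  by (rule exI[of _ 0]) simp

setup_lifting type_definition_qbar

instantiation qbar :: field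
begin

lift_definition zero_qbar :: qbar is 0 by simp
lift_definition one_qbar :: qbar is 1 by (simp add: rat_imp_algebraic)
lift_definition plus_qbar :: "qbar \<Rightarrow> qbar \<Rightarrow> qbar" is "(+)" by (rule algebraic_add)
lift_definition uminus_qbar :: "qbar \<Rightarrow> qbar" is uminus by simp
lift_definition minus_qbar :: "qbar \<Rightarrow> qbar \<Rightarrow> qbar" is "(-)"
  using algebraic_add by (metis add_uminus_conv_diff algebraic_minus_iff)
lift_definition times_qbar :: "qbar \<Rightarrow> qbar \<Rightarrow> qbar" is "(*)" by (rule algebraic_mult)
lift_definition inverse_qbar :: "qbar \<Rightarrow> qbar" is inverse by (rule algebraic_inverse)
lift_definition divide_qbar :: "qbar \<Rightarrow> qbar \<Rightarrow> qbar" is "(/)"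
  by (simp add: divide_inverse algebraic_mult algebraic_inverse)

instance
  by standard (transfer; simp add: algebra_simps divide_inverse)+

end

instance qbar :: field_char_0
proof
  have "complex_of_qbar (of_nat n) = of_nat n" for n
    by (induction n) (simp_all add: zero_qbar.rep_eq one_qbar.rep_eq plus_qbar.rep_eq)
  thus "inj (of_nat :: nat \<Rightarrow> qbar)"
    by (metis injI of_nat_eq_iff)
qed

lift_definition zeta :: "nat \<Rightarrow> qbar" is "\<lambda>n. exp (2 * of_real pi * \<i> / of_nat n)"
proof -
  fix n :: nat
  show "algebraic (exp (2 * of_real pi * \<i> / of_nat n))"
  proof (cases "n = 0")
    case False
    show ?thesis
    proof (rule algebraic_root)
      show "poly (Polynomial.monom 1 n) (exp (2 * of_real pi * \<i> / of_nat n)) = 1"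
        using False by (simp add: poly_monom exp_of_nat_mult[symmetric])
    qed (use False in \<open>auto simp: degree_monom_eq rat_imp_algebraic\<close>)
  qed (simp add: rat_imp_algebraic)
qed

lift_definition fourth_root_2 :: qbar is "of_real (root 4 2)"
  by (intro algebraic_of_real algebraic_nth_root_real rat_imp_algebraic) simp


section \<open>The Fermat quartic and its function field\<close>

text \<open>A point of the projective plane is the set of its homogeneous coordinate vectors.\<close>

type_synonym point = "(qbar \<times> qbar \<times> qbar) set"

definition proj_point :: "qbar \<Rightarrow> qbar \<Rightarrow> qbar \<Rightarrow> point" where
  "proj_point a b c = {(t * a, t * b, t * c) | t. t \<noteq> 0}"

definition fermat :: "point set" where
  "fermat = {proj_point a b c | a b c. (a, b, c) \<noteq> (0, 0, 0) \<and> a ^ 4 + b ^ 4 = c ^ 4}"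

text \<open>
  The value at \<open>(x, y, z)\<close> of the ternary form of degree \<open>d\<close> in which \<open>x\<^sup>i y\<^sup>j z\<^sup>d\<^sup>-\<^sup>i\<^sup>-\<^sup>j\<close> has
  coefficient \<open>g i j\<close>.
\<close>

definition form :: "nat \<Rightarrow> (nat \<Rightarrow> nat \<Rightarrow> 'a) \<Rightarrow> 'a \<Rightarrow> 'a \<Rightarrow> 'a \<Rightarrow> 'a :: comm_ring_1" where
  "form d g x y z = (\<Sum>i\<le>d. \<Sum>j\<le>d - i. g i j * x ^ i * y ^ j * z ^ (d - i - j))"

text \<open>
  With \<open>x = X/Z\<close> and \<open>y = Y/Z\<close>, the function field of the curve is the extension of the rational
  function field in \<open>x\<close> by a root \<open>y\<close> of \<open>T\<^sup>4 = 1 - x\<^sup>4\<close>. As \<open>T\<^sup>4 + x\<^sup>4 - 1\<close> is irreducible over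
  that field (Eisenstein at \<open>x - 1\<close>), the choice of the root inside the algebraic closure is
  immaterial.
\<close>

type_synonym ambient = "qbar poly fract alg_closure"

definition const :: "qbar \<Rightarrow> ambient" where
  "const c = to_ac (to_fract [:c:])"

definition x_coord :: ambient where
  "x_coord = to_ac (to_fract [:0, 1:])"

definition y_coord :: ambient where
  "y_coord = (SOME y. y ^ 4 = 1 - x_coord ^ 4)"

text \<open>The restriction of the form with coefficients \<open>g\<close>, divided by \<open>Z\<^sup>d\<close>, to the curve.\<close>

definition restr :: "nat \<Rightarrow> (nat \<Rightarrow> nat \<Rightarrow> qbar) \<Rightarrow> ambient" where
  "restr d g = form d (\<lambda>i j. const (g i j)) x_coord y_coord 1"

definition function_field :: "ambient set" where
  "function_field = {restr d g / restr d h | d g h. restr d h \<noteq> 0}"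

text \<open>
  \<open>has_value P f v\<close>: the function \<open>f\<close> is regular at \<open>P\<close> and takes the value \<open>v\<close> there, i.e. it is
  a quotient of two forms of equal degree whose denominator does not vanish at \<open>P\<close>.
\<close>

definition has_value :: "point \<Rightarrow> ambient \<Rightarrow> qbar \<Rightarrow> bool" where
  "has_value P f v \<longleftrightarrow> (\<exists>(a, b, c) \<in> P. \<exists>d g h. form d h a b c \<noteq> 0 \<and>
     f = restr d g / restr d h \<and> v = form d g a b c / form d h a b c)"

definition local_ring :: "point \<Rightarrow> ambient set" where
  "local_ring P = {f. \<exists>v. has_value P f v}"

definition value_at :: "point \<Rightarrow> ambient \<Rightarrow> qbar" where
  "value_at P f = (THE v. has_value P f v)"

definition maximal_ideal :: "point \<Rightarrow> ambient set" where
  "maximal_ideal P = {f \<in> local_ring P. value_at P f = 0}"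

definition uniformizer :: "point \<Rightarrow> ambient \<Rightarrow> bool" where
  "uniformizer P t \<longleftrightarrow> maximal_ideal P = {t * r | r. r \<in> local_ring P}"

text \<open>The order of vanishing; only meaningful for nonzero elements of the function field.\<close>

definition ord_at :: "point \<Rightarrow> ambient \<Rightarrow> int" where
  "ord_at P f = (THE n. \<exists>t u. uniformizer P t \<and> u \<in> local_ring P - maximal_ideal P \<and>
     f = t powi n * u)"


section \<open>Divisors and the Jacobian\<close>

type_synonym divisor = "point \<Rightarrow>\<^sub>0 int"

abbreviation ord_div :: "point \<Rightarrow> divisor \<Rightarrow> int" where
  "ord_div P D \<equiv> Poly_Mapping.lookup D P"

definition degree_div :: "divisor \<Rightarrow> int" where
  "degree_div D = (\<Sum>P\<in>Poly_Mapping.keys D. ord_div P D)"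

definition Div0 :: "divisor monoid" where
  "Div0 = (free_Abelian_group fermat)
     \<lparr>carrier := {D \<in> carrier (free_Abelian_group fermat). degree_div D = 0}\<rparr>"

text \<open>\<open>has_divisor f D\<close>: \<open>f\<close> is a nonzero rational function and \<open>div f = D\<close>.\<close>

definition has_divisor :: "ambient \<Rightarrow> divisor \<Rightarrow> bool" where
  "has_divisor f D \<longleftrightarrow> f \<in> function_field \<and> f \<noteq> 0 \<and>
     D \<in> carrier (free_Abelian_group fermat) \<and> (\<forall>P\<in>fermat. ord_div P D = ord_at P f)"

definition principal :: "divisor set" where
  "principal = {D. \<exists>f. has_divisor f D}"

definition Jac :: "divisor set monoid" where
  "Jac = Div0 Mod principal"

definition jac_class :: "divisor \<Rightarrow> divisor set" where
  "jac_class D = principal #>\<^bsub>Div0\<^esub> D"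

definition Jac_torsion :: "nat \<Rightarrow> divisor set set" where
  "Jac_torsion n = {c \<in> carrier Jac. c [^]\<^bsub>Jac\<^esub> n = \<one>\<^bsub>Jac\<^esub>}"


section \<open>The Weil pairing on the 4-torsion\<close>

text \<open>
  At a point outside the supports of both divisors the local factor is \<open>f\<^sup>0 / g\<^sup>0 = 1\<close>, so the
  product over all points of the curve is the following finite one.
\<close>

definition weil_product :: "divisor \<Rightarrow> divisor \<Rightarrow> ambient \<Rightarrow> ambient \<Rightarrow> qbar" where
  "weil_product D E f\<^sub>D f\<^sub>E = (\<Prod>P \<in> Poly_Mapping.keys D \<union> Poly_Mapping.keys E.
     (-1) powi (4 * ord_div P D * ord_div P E) *
     value_at P (f\<^sub>E powi ord_div P D / f\<^sub>D powi ord_div P E))"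

text \<open>
  The numeral type \<^typ>\<open>4\<close> is the ring of integers modulo 4; the group of fourth roots of
  unity is identified with it by sending \<open>zeta 4\<close> to 1.
\<close>

definition is_log_mu4 :: "qbar \<Rightarrow> 4 \<Rightarrow> bool" where
  "is_log_mu4 z a \<longleftrightarrow> (\<exists>k::nat. a = of_nat k \<and> z = zeta 4 ^ k)"

definition weil_pairing :: "divisor set \<Rightarrow> divisor set \<Rightarrow> 4" where
  "weil_pairing \<alpha> \<beta> = (THE a. \<forall>D E f\<^sub>D f\<^sub>E.
     D \<in> carrier Div0 \<and> E \<in> carrier Div0 \<and> jac_class D = \<alpha> \<and> jac_class E = \<beta> \<and>
     has_divisor f\<^sub>D (frag_cmul 4 D) \<and> has_divisor f\<^sub>E (frag_cmul 4 E) \<longrightarrow>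
     is_log_mu4 (weil_product D E f\<^sub>D f\<^sub>E) a)"


definition weil_matrix :: "divisor set list \<Rightarrow> 4 mat" where
  "weil_matrix bs = Matrix.mat (length bs) (length bs) (\<lambda>(i, j). weil_pairing (bs ! i) (bs ! j))"


section \<open>Points and classes\<close>

definition ptA :: "nat \<Rightarrow> point" where "ptA i = proj_point 0 (zeta 4 ^ i) 1"
definition ptB :: "nat \<Rightarrow> point" where "ptB i = proj_point (zeta 4 ^ i) 0 1"
definition ptC :: "nat \<Rightarrow> point" where "ptC i = proj_point (zeta 8 * zeta 4 ^ i) 1 0"

definition P\<^sub>1 :: point where "P\<^sub>1 = proj_point (fourth_root_2 * zeta 4) (zeta 8) 1"
definition P\<^sub>2 :: point where "P\<^sub>2 = proj_point (zeta 8) (fourth_root_2 * zeta 4) 1"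
definition P\<^sub>3 :: point where "P\<^sub>3 = proj_point (inverse fourth_root_2) (inverse fourth_root_2) 1"

definition e\<^sub>1 where "e\<^sub>1 = jac_class (frag_of (ptA 1) - frag_of (ptB 0))"
definition e\<^sub>2 where "e\<^sub>2 = jac_class (frag_of (ptA 2) - frag_of (ptB 0))"
definition e\<^sub>3 where "e\<^sub>3 = jac_class (frag_of (ptB 1) - frag_of (ptB 0))"
definition e\<^sub>4 where "e\<^sub>4 = jac_class (frag_of (ptB 2) - frag_of (ptB 0))"
definition e\<^sub>5 where "e\<^sub>5 = jac_class (frag_of (ptC 1) - frag_of (ptB 0))"
definition e\<^sub>6' where
  "e\<^sub>6' = jac_class (frag_of P\<^sub>1 + frag_of P\<^sub>2 + frag_of P\<^sub>3 - frag_cmul 3 (frag_of (ptB 0)))"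

definition torsion_basis :: "divisor set list" where
  "torsion_basis = [e\<^sub>1, e\<^sub>2, e\<^sub>3, e\<^sub>4, e\<^sub>5, e\<^sub>6']"

end

theory Submission
  imports Defs "HOL-Library.Groups_Big_Fun"
begin

text \<open>
  Weil reciprocity, \<open>\<Prod>\<^sub>P (f, g)\<^sub>P = 1\<close> for tame symbols, makes the product defining the pairing depend only
  on the two divisor classes. The function field is reached from the rational functions in \<open>x\<close> by two
  quadratic extensions, adjoining \<open>y\<^sup>2\<close> and then \<open>y\<close>. In a quadratic extension, the bimultiplicativity of
  the symbol and the Steinberg relation reduce a symbol of two elements to symbols with one entry in
  the smaller field, and the projection formula moves those down; this leaves reciprocity on the
  projective line. Of the latter only symbols of linear polynomials and constants have to be computed.

  For the six classes, four times the divisor is cut out by the tangent line at a hyperflex, respectively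
  by a cubic having contact of order four with the curve at \<open>P\<^sub>1, P\<^sub>2, P\<^sub>3\<close>, divided by the power of the
  tangent \<open>X = Z\<close> at \<open>B\<^sub>0\<close> of the same degree. The products are then values of these forms.
\<close>

section \<open>Preliminaries\<close>

text \<open>\<open>weil_pairing\<close> is a \<open>THE\<close> over all representatives and all
  functions, so one evaluation per entry settles it only once independence of these choices is
  known; hence the need for reciprocity in full. In a quadratic extension every element is a + b y,
  so up to factors from the base only symbols of y + c and y + c' remain; their difference lies in
  the base, which after scaling is what the relation f + g = 1 needs. A single step of degree four
  would leave cubics in y. The intermediate quotient curves are never constructed: their function
  fields are fixed fields of powers of \<open>tau\<close>, and their places are rotation orbits,
  with orders divided by the ramification index. Reciprocity against the constant 2 shows that
  principal divisors have degree zero. This replaces an intersection count: lower bounds for the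
  orders of a function that already sum to zero are equalities, so only contact of order at least
  four has to be checked. Points at infinity need no separate local theory, because x / (zeta_8 y)
  and 1 / y satisfy the same equation as x and y.\<close>

lemma algebraic_root_of_algebraic_poly:
  fixes p :: "complex poly"
  assumes "\<And>i. algebraic (Polynomial.coeff p i)" "p \<noteq> 0" "poly p z = 0"
  shows "algebraic z"
proof -
  define cs where "cs = coeffs p"
  \<comment> \<open>The coefficients generate a finite extension \<open>F\<close> of the rationals
    and the root is finite over \<open>F\<close>, so the tower law makes it finite over the
    rationals.\<close>
  define F where "F = CR.finite_extension \<rat> cs"
  have alg: "(CR.algebraic over \<rat>) c" if "c \<in> set cs" for c
    using that assms(1) unfolding cs_def algebraic_iff_algebraic_over[symmetric]
    by (auto simp: coeffs_def split: if_splits)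
  have sub: "set cs \<subseteq> carrier complex_ring"
    by (simp add: complex_ring_simps)
  have F: "subfield F complex_ring"
    unfolding F_def using alg sub by (intro CR.finite_extension_is_subfield[OF subfield_Rats])
  have "set cs \<subseteq> F"
    unfolding F_def using CR.finite_extension_mem[OF subfieldE(1)[OF subfield_Rats] sub] by auto
  hence "rev cs \<in> carrier (F [X]\<^bsub>complex_ring\<^esub>)"
    using assms(2) by (subst univ_poly_carrier[symmetric])
      (simp add: polynomial_def complex_ring_simps cs_def hd_rev last_coeffs_eq_coeff_degree)
  moreover have "CR.eval (rev cs) z = \<zero>\<^bsub>complex_ring\<^esub>"
    using assms(3) by (simp add: eval_conv_poly complex_ring_simps cs_def)
  ultimately have "(CR.algebraic over F) z"
    using assms(2) by (intro CR.algebraicI[of "rev cs"]) (auto simp: cs_def)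
  hence fd: "CR.finite_dimension F (CR.simple_extension F z)"
    using CR.finite_dimension_simple_extension[OF F] by (simp add: complex_ring_simps)
  have "CR.finite_dimension \<rat> F"
    unfolding F_def using CR.finite_extension_finite_dimension(1)[OF subfield_Rats sub] alg by blast
  hence fd: "CR.finite_dimension \<rat> (CR.simple_extension F z)"
    using CR.telescopic_base_dim(1)[OF subfield_Rats F _ fd] by blast
  have "(CR.algebraic over \<rat>) z"
  proof (rule CR.finite_dimension_imp_algebraic[OF subfield_Rats _ fd])
    show "subring (CR.simple_extension F z) complex_ring"
      by (rule CR.simple_extension_is_subring[OF subfieldE(1)[OF F]]) (simp add: complex_ring_simps)
    show "z \<in> CR.simple_extension F z"
      by (rule CR.simple_extension_mem[OF subfieldE(1)[OF F]]) (simp add: complex_ring_simps)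
  qed
  thus ?thesis by (simp add: algebraic_iff_algebraic_over)
qed

lemma complex_of_qbar_sum: "complex_of_qbar (sum f A) = (\<Sum>i\<in>A. complex_of_qbar (f i))"
  by (induction A rule: infinite_finite_induct) (simp_all add: zero_qbar.rep_eq plus_qbar.rep_eq)

lemma complex_of_qbar_power: "complex_of_qbar (x ^ n) = complex_of_qbar x ^ n"
  by (induction n) (simp_all add: one_qbar.rep_eq times_qbar.rep_eq)

text \<open>Needed twice: to split polynomials in x into linear factors, and to find a point of the
  curve over every value of x.\<close>

instance qbar :: alg_closed_field
proof
  fix p :: "qbar poly"
  assume p: "Polynomial.degree p > 0" "Polynomial.lead_coeff p = 1"
  define q where "q = map_poly complex_of_qbar p"
  have c0: "complex_of_qbar 0 = 0" by (simp add: zero_qbar.rep_eq)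
  have c0': "complex_of_qbar x = 0 \<longleftrightarrow> x = 0" for x
    by (metis c0 complex_of_qbar_inject)
  have cq: "Polynomial.coeff q i = complex_of_qbar (Polynomial.coeff p i)" for i
    unfolding q_def by (rule coeff_map_poly) (rule c0)
  have deg: "Polynomial.degree q = Polynomial.degree p"
    unfolding q_def by (rule degree_map_poly) (simp add: c0')
  obtain z where z: "poly q z = 0"
    using alg_closed_imp_poly_has_root[of q] p(1) deg by auto
  have "algebraic z"
  proof (rule algebraic_root_of_algebraic_poly[OF _ _ z])
    show "algebraic (Polynomial.coeff q i)" for i
      unfolding cq using complex_of_qbar by simp
    show "q \<noteq> 0" using p(1) deg by auto
  qed
  then obtain w where w: "complex_of_qbar w = z"
    using qbar_of_complex_inverse by auto
  have "complex_of_qbar (poly p w) = poly q z"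
    by (simp add: poly_altdef complex_of_qbar_sum times_qbar.rep_eq complex_of_qbar_power cq deg w)
  hence "poly p w = 0" using z c0' by metis
  thus "\<exists>x. poly p x = 0" by blast
qed

lemma poly_map_poly_add:
  fixes h :: "'a::comm_ring_1 \<Rightarrow> 'b::comm_ring_1"
  assumes "h 0 = 0" "\<And>a b. h (a + b) = h a + h b"
  shows "poly (map_poly h (p + q)) x = poly (map_poly h p) x + poly (map_poly h q) x"
  by (induction p q rule: poly_induct2) (simp_all add: map_poly_pCons assms algebra_simps)

lemma poly_map_poly_mult:
  fixes h :: "'a::comm_ring_1 \<Rightarrow> 'b::comm_ring_1"
  assumes "h 0 = 0" "\<And>a b. h (a + b) = h a + h b" "\<And>a b. h (a * b) = h a * h b"
  shows "poly (map_poly h (p * q)) x = poly (map_poly h p) x * poly (map_poly h q) x"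
proof (induction p)
  case (pCons a p)
  have sm: "poly (map_poly h (Polynomial.smult a q)) x = h a * poly (map_poly h q) x"
    by (induction q) (simp_all add: map_poly_pCons assms algebra_simps)
  show ?case
    using pCons.IH
    by (simp add: poly_map_poly_add[of h] assms map_poly_pCons sm algebra_simps)
qed (simp add: assms)

lemma const_hom:
  "const 0 = 0" "const 1 = 1" "const (a + b) = const a + const b" "const (a * b) = const a * const b"
  "const (- a) = - const a" "const (a - b) = const a - const b" "const (a ^ n) = const a ^ n"
  "const (numeral k) = numeral k"
proof -
  show 0: "const 0 = 0" and 1: "const 1 = 1" and add: "const (a + b) = const a + const b" for a b
    by (simp_all add: const_def to_ac_add[symmetric] to_fract_add[symmetric] one_pCons[symmetric] del: to_ac_add to_fract_add)
  show mult: "const (a * b) = const a * const b" for a b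
    by (simp add: const_def to_ac_mult[symmetric] to_fract_mult[symmetric] del: to_ac_mult to_fract_mult)
  show neg: "const (- a) = - const a"
    using add[of a "-a"] 0 by (simp add: eq_neg_iff_add_eq_0 add.commute)
  show diff: "const (a - b) = const a - const b"
    by (metis add diff_add_cancel eq_diff_eq)
  show "const (a ^ n) = const a ^ n"
    by (induction n) (simp_all add: 1 mult)
  have nat: "const (of_nat n) = of_nat n" for n
    by (induction n) (simp_all add: 0 1 add)
  show "const (numeral k) = numeral k"
    using nat[of "numeral k"] by simp
qed

lemma const_eq_0_iff [simp]: "const a = 0 \<longleftrightarrow> a = 0"
  by (simp add: const_def)

lemma const_eq_iff [simp]: "const a = const b \<longleftrightarrow> a = b"
  using const_eq_0_iff[of "a - b"] by (simp add: const_hom del: const_eq_0_iff)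

lemma const_inverse: "const (inverse a) = inverse (const a)"
  by (metis const_eq_0_iff const_hom(2,4) inverse_unique inverse_zero right_inverse)

lemma const_powi: "const (a powi n) = const a powi n"
  by (simp add: power_int_def const_hom const_inverse)

section \<open>Affine charts\<close>

text \<open>Functions are handled as images of polynomials in y over polynomials in x. The
  substituted elements are parameters, because the affine coordinates, those at infinity and the
  rotated ones are all used.\<close>

definition ev1 :: "ambient \<Rightarrow> qbar poly \<Rightarrow> ambient" where
  "ev1 x p = poly (map_poly const p) x"

lemma ev1_simps [simp]:
  "ev1 x 0 = 0" "ev1 x 1 = 1" "ev1 x (pCons a p) = const a + x * ev1 x p"
  "ev1 x (p + q) = ev1 x p + ev1 x q" "ev1 x (p * q) = ev1 x p * ev1 x q"
  by (simp_all add: ev1_def map_poly_pCons const_hom poly_map_poly_add poly_map_poly_mult)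

lemma ev1_uminus [simp]: "ev1 x (- p) = - ev1 x p"
  using ev1_simps(4)[of x p "-p"] by (simp add: eq_neg_iff_add_eq_0 add.commute)

lemma ev1_diff [simp]: "ev1 x (p - q) = ev1 x p - ev1 x q"
  using ev1_simps(4)[of x p "-q"] by simp

lemma ev1_power [simp]: "ev1 x (p ^ n) = ev1 x p ^ n"
  by (induction n) simp_all

definition ev2 :: "ambient \<Rightarrow> ambient \<Rightarrow> qbar poly poly \<Rightarrow> ambient" where
  "ev2 x y p = poly (map_poly (ev1 x) p) y"

lemma ev2_simps [simp]:
  "ev2 x y 0 = 0" "ev2 x y 1 = 1" "ev2 x y (pCons a p) = ev1 x a + y * ev2 x y p"
  "ev2 x y (p + q) = ev2 x y p + ev2 x y q" "ev2 x y (p * q) = ev2 x y p * ev2 x y q"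
  by (simp_all add: ev2_def map_poly_pCons poly_map_poly_add poly_map_poly_mult)

lemma ev2_uminus [simp]: "ev2 x y (- p) = - ev2 x y p"
  using ev2_simps(4)[of x y p "-p"] by (simp add: eq_neg_iff_add_eq_0 add.commute)

lemma ev2_diff [simp]: "ev2 x y (p - q) = ev2 x y p - ev2 x y q"
  using ev2_simps(4)[of x y p "-q"] by simp

lemma ev2_sum: "ev2 x y (sum f A) = (\<Sum>i\<in>A. ev2 x y (f i))"
  by (induction A rule: infinite_finite_induct) simp_all

definition pev :: "qbar \<Rightarrow> qbar \<Rightarrow> qbar poly poly \<Rightarrow> qbar" where
  "pev a b p = poly (poly p [:b:]) a"

lemma pev_simps [simp]:
  "pev a b 0 = 0" "pev a b 1 = 1" "pev a b (pCons c p) = poly c a + b * pev a b p"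
  "pev a b (p + q) = pev a b p + pev a b q" "pev a b (p * q) = pev a b p * pev a b q"
  "pev a b (- p) = - pev a b p" "pev a b (p - q) = pev a b p - pev a b q"
  "pev a b (p ^ n) = pev a b p ^ n" "pev a b (sum f A) = (\<Sum>i\<in>A. pev a b (f i))"
  by (simp_all add: pev_def poly_sum)

text \<open>The equation \<open>y\<^sup>4 + x\<^sup>4 - 1\<close>, as a polynomial in \<open>y\<close> over the polynomials in \<open>x\<close>.\<close>

definition curve_poly :: "qbar poly poly" where
  "curve_poly = [: [:-1,0,0,0,1:], 0, 0, 0, 1 :]"

lemma pev_curve_poly: "pev a b curve_poly = a ^ 4 + b ^ 4 - 1"
  by (simp add: curve_poly_def algebra_simps eval_nat_numeral)

lemma ev2_curve_poly: "ev2 x y curve_poly = x ^ 4 + y ^ 4 - 1"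
  by (simp add: curve_poly_def algebra_simps eval_nat_numeral const_hom)

text \<open>Division by a polynomial monic in y, by Horner induction: multiplying the remainder by y
  pushes only its top coefficient over the edge, where y^4 is replaced by 1 - x^4.\<close>

lemma reduce_mod_curve:
  "\<exists>q a0 a1 a2 a3. p = q * curve_poly + [:a0, a1, a2, a3:]"
proof (induction p)
  case 0
  show ?case by (intro exI[of _ 0]) simp
next
  case (pCons a p)
  then obtain q a0 a1 a2 a3 where p: "p = q * curve_poly + [:a0, a1, a2, a3:]"
    by blast
  have 1: "pCons a p = [:a:] + [:0,1:] * p" by simp
  have 2: "[:0,1:] * [:a0, a1, a2, a3:] = [:a3:] * curve_poly + [: a3 * [:1,0,0,0,-1:], a0, a1, a2 :]"
    by (simp add: curve_poly_def)
  have "pCons a p = ([:0,1:] * q + [:a3:]) * curve_poly +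
      ([:a:] + [: a3 * [:1,0,0,0,-1:], a0, a1, a2 :])"
    unfolding 1 by (subst p) (simp only: distrib_left distrib_right 2 mult.assoc add_ac)
  also have "[:a:] + [: a3 * [:1,0,0,0,-1:], a0, a1, a2 :] = [: a + a3 * [:1,0,0,0,-1:], a0, a1, a2 :]"
    by simp
  finally show ?case by blast
qed

text \<open>Stated for an abstract pair because it is instantiated three times: with the affine
  coordinates, with the coordinates at infinity, and with the affine ones after the
  rotation.\<close>

locale chart =
  fixes x y :: ambient
  assumes curve: "x ^ 4 + y ^ 4 = 1"
    and transcendental: "ev1 x p = 0 \<Longrightarrow> p = 0"
begin

section \<open>Linear independence of 1, y, y^2, y^3 over the rational functions in x\<close>

lemma y_nonzero: "y \<noteq> 0"
proof
  assume "y = 0"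
  hence "ev1 x [:-1,0,0,0,1:] = 0"
    using curve by (simp add: eval_nat_numeral const_hom algebra_simps)
  from transcendental[OF this] show False by simp
qed

lemma x_nonconst: "x \<noteq> const c"
proof
  assume "x = const c"
  hence "ev1 x [:-c,1:] = 0" by (simp add: const_hom)
  from transcendental[OF this] show False by simp
qed

lemma x_nonzero: "x \<noteq> 0"
  using x_nonconst[of 0] by (simp add: const_hom)

definition linear_rel :: "qbar poly \<Rightarrow> qbar poly \<Rightarrow> qbar poly \<Rightarrow> qbar poly \<Rightarrow> bool" where
  "linear_rel a0 a1 a2 a3 \<longleftrightarrow> ev1 x a0 + ev1 x a1 * y + ev1 x a2 * y ^ 2 + ev1 x a3 * y ^ 3 = 0"

text \<open>The coefficients of 1 and of y^2 in p(y) p(-y), reduced with y^4 = 1 - x^4, are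
  \<open>norm_even\<close> and \<open>norm_odd\<close>; multiplying by the conjugate in y^2 gives
  \<open>norm_poly\<close>, the norm down to polynomials in x.\<close>

definition norm_even :: "qbar poly \<Rightarrow> qbar poly \<Rightarrow> qbar poly \<Rightarrow> qbar poly \<Rightarrow> qbar poly" where
  "norm_even a0 a1 a2 a3 = a0^2 + [:1,0,0,0,-1:] * (a2^2 - 2 * a1 * a3)"

definition norm_odd :: "qbar poly \<Rightarrow> qbar poly \<Rightarrow> qbar poly \<Rightarrow> qbar poly \<Rightarrow> qbar poly" where
  "norm_odd a0 a1 a2 a3 = 2 * a0 * a2 - a1^2 - [:1,0,0,0,-1:] * a3^2"

definition norm_poly :: "qbar poly \<Rightarrow> qbar poly \<Rightarrow> qbar poly \<Rightarrow> qbar poly \<Rightarrow> qbar poly" where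
  "norm_poly a0 a1 a2 a3 = norm_even a0 a1 a2 a3 ^ 2 - [:1,0,0,0,-1:] * norm_odd a0 a1 a2 a3 ^ 2"

lemma ev1_w: "ev1 x [:1,0,0,0,-1:] = y ^ 4"
  using curve by (simp add: eval_nat_numeral const_hom algebra_simps eq_diff_eq)

lemma ev1_2: "ev1 x 2 = 2"
  by (metis ev1_simps(2,4) one_add_one)

lemma norm_even_odd:
  "ev1 x (norm_even a0 a1 a2 a3) + ev1 x (norm_odd a0 a1 a2 a3) * y ^ 2 =
    (ev1 x a0 + ev1 x a1 * y + ev1 x a2 * y ^ 2 + ev1 x a3 * y ^ 3) *
    (ev1 x a0 - ev1 x a1 * y + ev1 x a2 * y ^ 2 - ev1 x a3 * y ^ 3)"
  unfolding norm_even_def norm_odd_def ev1_simps(4,5) ev1_power ev1_diff ev1_w ev1_2 by Groebner_Basis.algebra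

lemma norm_poly_eq:
  "ev1 x (norm_poly a0 a1 a2 a3) =
    (ev1 x (norm_even a0 a1 a2 a3) + ev1 x (norm_odd a0 a1 a2 a3) * y ^ 2) *
    (ev1 x (norm_even a0 a1 a2 a3) - ev1 x (norm_odd a0 a1 a2 a3) * y ^ 2)"
  unfolding norm_poly_def ev1_simps(4,5) ev1_power ev1_diff ev1_w by Groebner_Basis.algebra

text \<open>The norm of a vanishing element is a polynomial in x that vanishes, hence is zero; at x
  = 1, where 1 - x^4 vanishes, it reduces to the fourth power of the value of
  \<open>a0\<close>.\<close>

lemma linear_rel_dvd:
  assumes "linear_rel a0 a1 a2 a3"
  shows "[:-1,1:] dvd a0"
proof -
  have "ev1 x (norm_poly a0 a1 a2 a3) = 0"
    unfolding norm_poly_eq norm_even_odd using assms by (simp add: linear_rel_def)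
  hence "norm_poly a0 a1 a2 a3 = 0" by (rule transcendental)
  moreover have "poly (norm_poly a0 a1 a2 a3) 1 = poly a0 1 ^ 4"
    by (simp add: norm_poly_def norm_even_def eval_nat_numeral)
  ultimately have "poly a0 1 = 0" by simp
  thus ?thesis using poly_eq_0_iff_dvd[of a0 1] by simp
qed

text \<open>
  Descent at the ramified place \<open>x = 1\<close>: since \<open>y\<^sup>4\<close> is \<open>x - 1\<close> times a unit there, a relation can be
  divided by \<open>y\<close> once \<open>x - 1\<close> divides its constant coefficient.
\<close>

lemma linear_rel_shift:
  assumes "linear_rel a0 a1 a2 a3" and a0: "a0 = [:-1,1:] * b"
  shows "linear_rel ([:-1,-1,-1,-1:] * a1) ([:-1,-1,-1,-1:] * a2) ([:-1,-1,-1,-1:] * a3) b"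
proof -
  \<comment> \<open>The cofactor -(1 + x + x^2 + x^3) of x - 1 in 1 - x^4.\<close>
  define W where "W = ev1 x [:-1,-1,-1,-1:]"
  have W: "W * ev1 x [:-1,1:] = y ^ 4"
    unfolding W_def ev1_simps(5)[symmetric] ev1_w[symmetric] by simp
  have "y * (W * ev1 x a1 + W * ev1 x a2 * y + W * ev1 x a3 * y ^ 2 + ev1 x b * y ^ 3) =
      W * (ev1 x a0 + ev1 x a1 * y + ev1 x a2 * y ^ 2 + ev1 x a3 * y ^ 3)"
    using W unfolding a0 ev1_simps(5) by Groebner_Basis.algebra
  also have "\<dots> = 0" using assms(1) by (simp add: linear_rel_def)
  finally show ?thesis
    using y_nonzero by (simp only: linear_rel_def ev1_simps(5) W_def[symmetric] mult_eq_0_iff simp_thms)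
qed

text \<open>The cofactor takes the nonzero value -4 at x = 1.\<close>

lemma dvd_cancel_unit:
  assumes "[:-1,1:] dvd [:-1,-1,-1,-1:] * (a :: qbar poly)"
  shows "[:-1,1:] dvd a"
proof -
  have "poly ([:-1,-1,-1,-1:] * a) 1 = 0"
    using assms poly_eq_0_iff_dvd[of "[:-1,-1,-1,-1:] * a" 1] by simp
  thus ?thesis using poly_eq_0_iff_dvd[of a 1] by (simp add: eval_nat_numeral)
qed

text \<open>Three shifts bring the other coefficients in turn to the constant position, so all four
  are divisible by x - 1, and then so is the relation itself.\<close>

lemma linear_rel_all_dvd:
  assumes "linear_rel a0 a1 a2 a3"
  shows "\<exists>b0 b1 b2 b3. a0 = [:-1,1:] * b0 \<and> a1 = [:-1,1:] * b1 \<and> a2 = [:-1,1:] * b2 \<and>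
    a3 = [:-1,1:] * b3 \<and> linear_rel b0 b1 b2 b3"
proof -
  let ?w = "[:-1,-1,-1,-1:] :: qbar poly"
  obtain c0 where c0: "a0 = [:-1,1:] * c0"
    using linear_rel_dvd[OF assms] by (elim dvdE)
  have r1: "linear_rel (?w * a1) (?w * a2) (?w * a3) c0"
    by (rule linear_rel_shift[OF assms c0])
  obtain c1 where c1: "a1 = [:-1,1:] * c1"
    using dvd_cancel_unit[OF linear_rel_dvd[OF r1]] by (elim dvdE)
  have e1: "?w * a1 = [:-1,1:] * (?w * c1)" unfolding c1 by (rule mult.left_commute)
  have r2: "linear_rel (?w * (?w * a2)) (?w * (?w * a3)) (?w * c0) (?w * c1)"
    by (rule linear_rel_shift[OF r1 e1])
  obtain c2 where c2: "a2 = [:-1,1:] * c2"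
    using dvd_cancel_unit[OF dvd_cancel_unit[OF linear_rel_dvd[OF r2]]] by (elim dvdE)
  have e2: "?w * (?w * a2) = [:-1,1:] * (?w * (?w * c2))" unfolding c2 by (simp only: mult.left_commute)
  have r3: "linear_rel (?w * (?w * (?w * a3))) (?w * (?w * c0)) (?w * (?w * c1)) (?w * (?w * c2))"
    by (rule linear_rel_shift[OF r2 e2])
  obtain c3 where c3: "a3 = [:-1,1:] * c3"
    using dvd_cancel_unit[OF dvd_cancel_unit[OF dvd_cancel_unit[OF linear_rel_dvd[OF r3]]]] by (elim dvdE)
  have "ev1 x [:-1,1:] * (ev1 x c0 + ev1 x c1 * y + ev1 x c2 * y ^ 2 + ev1 x c3 * y ^ 3) = 0"
    using assms unfolding linear_rel_def c0 c1 c2 c3 ev1_simps(5) by Groebner_Basis.algebra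
  moreover have "ev1 x [:-1,1:] \<noteq> 0" using transcendental[of "[:-1,1:]"] by auto
  ultimately have "linear_rel c0 c1 c2 c3" by (simp add: linear_rel_def)
  thus ?thesis using c0 c1 c2 c3 by blast
qed

lemma linear_rel_power_dvd:
  "linear_rel a0 a1 a2 a3 \<Longrightarrow>
    [:-1,1:] ^ n dvd a0 \<and> [:-1,1:] ^ n dvd a1 \<and> [:-1,1:] ^ n dvd a2 \<and> [:-1,1:] ^ n dvd a3"
proof (induction n arbitrary: a0 a1 a2 a3)
  case (Suc n)
  then obtain b0 b1 b2 b3 where b: "a0 = [:-1,1:] * b0" "a1 = [:-1,1:] * b1" "a2 = [:-1,1:] * b2"
    "a3 = [:-1,1:] * b3" "linear_rel b0 b1 b2 b3"
    using linear_rel_all_dvd by meson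
  show ?case
    using Suc.IH[OF b(5)] unfolding b(1-4) power_Suc by (intro conjI mult_dvd_mono) auto
qed simp

text \<open>The descent never stops, so each coefficient is divisible by every power of x - 1. This
  is the Eisenstein argument carried out on elements.\<close>

lemma linear_rel_trivial:
  assumes "linear_rel a0 a1 a2 a3"
  shows "a0 = 0" "a1 = 0" "a2 = 0" "a3 = 0"
proof -
  have z: "a = 0" if "\<And>n. [:-1,1:] ^ n dvd a" for a :: "qbar poly"
  proof (rule ccontr)
    assume "a \<noteq> 0"
    hence "Polynomial.degree ([:-1,1:] ^ Suc (Polynomial.degree a) :: qbar poly) \<le> Polynomial.degree a"
      using that by (intro dvd_imp_degree_le)
    thus False by (simp add: degree_linear_power del: power_Suc)
  qed
  show "a0 = 0" "a1 = 0" "a2 = 0" "a3 = 0"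
    using linear_rel_power_dvd[OF assms] by (auto intro: z)
qed

lemma ev2_cubic: "ev2 x y [:a0,a1,a2,a3:] = ev1 x a0 + ev1 x a1 * y + ev1 x a2 * y ^ 2 + ev1 x a3 * y ^ 3"
  by (simp add: algebra_simps eval_nat_numeral)

lemma ev2_reduce:
  obtains a0 a1 a2 a3 where "ev2 x y p = ev2 x y [:a0,a1,a2,a3:]"
    "\<And>a b. a ^ 4 + b ^ 4 = 1 \<Longrightarrow> pev a b p = pev a b [:a0,a1,a2,a3:]"
proof -
  obtain q a0 a1 a2 a3 where p: "p = q * curve_poly + [:a0, a1, a2, a3:]"
    using reduce_mod_curve[of p] by blast
  have "ev2 x y p = ev2 x y [:a0,a1,a2,a3:]"
    by (subst p) (simp only: ev2_simps(4,5) ev2_curve_poly curve, simp)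
  moreover have "pev a b p = pev a b [:a0,a1,a2,a3:]" if "a ^ 4 + b ^ 4 = 1" for a b
    by (subst p) (simp only: pev_simps(4,5) pev_curve_poly that, simp)
  ultimately show thesis by (rule that)
qed

text \<open>The remainder modulo the curve equation is a linear relation between 1, y, y^2, y^3 and
  so vanishes. Consequently the value of a function at a point of the curve does not depend on the
  representing polynomials.\<close>

lemma ev2_eq_0:
  assumes "ev2 x y p = 0"
  shows "\<exists>q. p = q * curve_poly"
proof -
  obtain q a0 a1 a2 a3 where p: "p = q * curve_poly + [:a0, a1, a2, a3:]"
    using reduce_mod_curve[of p] by blast
  have "ev2 x y [:a0, a1, a2, a3:] = 0"
    using assms by (simp only: p ev2_simps(4,5) ev2_curve_poly curve) simp
  hence "linear_rel a0 a1 a2 a3" unfolding linear_rel_def ev2_cubic .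
  note z = linear_rel_trivial[OF this]
  have "p = q * curve_poly" by (subst p) (simp add: z)
  thus ?thesis by blast
qed

lemma ev2_eq_0_pev: "ev2 x y p = 0 \<Longrightarrow> a ^ 4 + b ^ 4 = 1 \<Longrightarrow> pev a b p = 0"
  by (drule ev2_eq_0) (elim exE, simp add: pev_curve_poly)

text \<open>The cofactor is the conjugate under y -> -y times the conjugate in y^2; neither
  vanishes, by linear independence. The norm bounds zeros of functions by roots of polynomials in
  x.\<close>

lemma norm_exists:
  assumes "ev2 x y p \<noteq> 0"
  shows "\<exists>q n. n \<noteq> 0 \<and> ev2 x y p * ev2 x y q = ev1 x n"
proof -
  obtain a0 a1 a2 a3 where a: "ev2 x y p = ev2 x y [:a0,a1,a2,a3:]"
    by (rule ev2_reduce[of p])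
  define A B where "A = norm_even a0 a1 a2 a3" and "B = norm_odd a0 a1 a2 a3"
  define s s' where "s = ev2 x y [:a0,a1,a2,a3:]" and "s' = ev2 x y [:a0,-a1,a2,-a3:]"
  have ss: "s * s' = ev1 x A + ev1 x B * y ^ 2"
    unfolding A_def B_def norm_even_odd s_def s'_def ev2_cubic by simp
  have s0: "s \<noteq> 0" using assms a by (simp add: s_def)
  have s'0: "s' \<noteq> 0"
  proof
    assume "s' = 0"
    hence "linear_rel a0 (-a1) a2 (-a3)" unfolding s'_def ev2_cubic linear_rel_def .
    from linear_rel_trivial[OF this] have "s = 0" by (simp add: s_def)
    thus False using s0 by simp
  qed
  have N: "ev1 x (norm_poly a0 a1 a2 a3) = s * s' * (ev1 x A - ev1 x B * y ^ 2)"
    unfolding norm_poly_eq ss A_def B_def ..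
  have d0: "ev1 x A - ev1 x B * y ^ 2 \<noteq> 0"
  proof
    assume "ev1 x A - ev1 x B * y ^ 2 = 0"
    hence "linear_rel A 0 (-B) 0" unfolding linear_rel_def by simp
    from linear_rel_trivial(1,3)[OF this] have "s * s' = 0" unfolding ss by simp
    thus False using s0 s'0 by simp
  qed
  have "norm_poly a0 a1 a2 a3 \<noteq> 0"
    using N s0 s'0 d0 by auto
  moreover have "ev2 x y p * ev2 x y ([:a0,-a1,a2,-a3:] * [:A, 0, -B:]) = ev1 x (norm_poly a0 a1 a2 a3)"
    unfolding N a s_def s'_def ev2_simps(5) by (simp add: eval_nat_numeral algebra_simps)
  ultimately show ?thesis by blast
qed

end

lemma ev1_smult [simp]: "ev1 x (Polynomial.smult c p) = const c * ev1 x p"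
  by (induction p) (simp_all add: const_hom algebra_simps)

context chart
begin

definition field_of_functions :: "ambient set" where
  "field_of_functions = {ev2 x y p / ev2 x y q | p q. ev2 x y q \<noteq> 0}"

definition val :: "qbar \<Rightarrow> qbar \<Rightarrow> ambient \<Rightarrow> qbar \<Rightarrow> bool" where
  "val a b f v \<longleftrightarrow> (\<exists>p q. pev a b q \<noteq> 0 \<and> f = ev2 x y p / ev2 x y q \<and> v = pev a b p / pev a b q)"

lemma val_poly: "val a b (ev2 x y p) (pev a b p)"
  unfolding val_def by (intro exI[of _ p] exI[of _ 1]) simp

lemma field_of_functions_divide:
  assumes "f \<in> field_of_functions" "g \<in> field_of_functions"
  shows "f / g \<in> field_of_functions"
proof -
  obtain p q where f: "f = ev2 x y p / ev2 x y q" "ev2 x y q \<noteq> 0"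
    using assms(1) by (auto simp: field_of_functions_def)
  obtain p' q' where g: "g = ev2 x y p' / ev2 x y q'" "ev2 x y q' \<noteq> 0"
    using assms(2) by (auto simp: field_of_functions_def)
  show ?thesis
  proof (cases "g = 0")
    case True
    have "f / g = ev2 x y 0 / ev2 x y 1" "ev2 x y 1 \<noteq> 0" using True by simp_all
    thus ?thesis unfolding field_of_functions_def by blast
  next
    case False
    have "f / g = ev2 x y (p * q') / ev2 x y (q * p')"
      unfolding f(1) g(1) by simp
    moreover have "ev2 x y (q * p') \<noteq> 0" using False f(2) unfolding g(1) by auto
    ultimately show ?thesis unfolding field_of_functions_def by blast
  qed
qed

lemma field_of_functions_diff:
  assumes "f \<in> field_of_functions" "g \<in> field_of_functions"
  shows "f - g \<in> field_of_functions"
proof -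
  obtain p q where f: "f = ev2 x y p / ev2 x y q" "ev2 x y q \<noteq> 0"
    using assms(1) by (auto simp: field_of_functions_def)
  obtain p' q' where g: "g = ev2 x y p' / ev2 x y q'" "ev2 x y q' \<noteq> 0"
    using assms(2) by (auto simp: field_of_functions_def)
  have "f - g = ev2 x y (p * q' - p' * q) / ev2 x y (q * q')"
    unfolding f(1) g(1) using f(2) g(2) by (simp add: diff_frac_eq)
  moreover have "ev2 x y (q * q') \<noteq> 0" using f(2) g(2) by simp
  ultimately show ?thesis unfolding field_of_functions_def by blast
qed

lemma field_of_functions_poly: "ev2 x y p \<in> field_of_functions"
proof -
  have "ev2 x y p = ev2 x y p / ev2 x y 1" "ev2 x y 1 \<noteq> 0" by simp_all
  thus ?thesis unfolding field_of_functions_def by blast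
qed

end

section \<open>Local parameters and orders at a point of a chart\<close>

locale chart_point = chart +
  fixes a b :: qbar
  assumes on_curve: "a ^ 4 + b ^ 4 = 1"
begin

lemma ev2_nonzero: "pev a b q \<noteq> 0 \<Longrightarrow> ev2 x y q \<noteq> 0"
  using ev2_eq_0_pev[OF _ on_curve] by blast

lemma val_unique:
  assumes "val a b f v" "val a b f w"
  shows "v = w"
proof -
  obtain p q where 1: "pev a b q \<noteq> 0" "f = ev2 x y p / ev2 x y q" "v = pev a b p / pev a b q"
    using assms(1) by (auto simp: val_def)
  obtain p' q' where 2: "pev a b q' \<noteq> 0" "f = ev2 x y p' / ev2 x y q'" "w = pev a b p' / pev a b q'"
    using assms(2) by (auto simp: val_def)
  have "ev2 x y (p * q' - p' * q) = 0"
    using 1(2) unfolding 2(2) using ev2_nonzero[OF 1(1)] ev2_nonzero[OF 2(1)] by (simp add: frac_eq_eq)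
  from ev2_eq_0_pev[OF this on_curve] show ?thesis
    unfolding 1(3) 2(3) using 1(1) 2(1) by (simp add: frac_eq_eq)
qed

lemma val_mem: "val a b f v \<Longrightarrow> f \<in> field_of_functions"
  unfolding val_def field_of_functions_def using ev2_nonzero by auto

lemma val_const: "val a b (const c) c"
  using val_poly[of a b "[:[:c:]:]"] by simp

lemma val_x: "val a b x a"
  using val_poly[of a b "[:[:0,1:]:]"] by (simp add: const_hom)

lemma val_y: "val a b y b"
  using val_poly[of a b "[:0,1:]"] by simp

lemma val_add:
  assumes "val a b f v" "val a b g w"
  shows "val a b (f + g) (v + w)"
proof -
  obtain p q where 1: "pev a b q \<noteq> 0" "f = ev2 x y p / ev2 x y q" "v = pev a b p / pev a b q"
    using assms(1) by (auto simp: val_def)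
  obtain p' q' where 2: "pev a b q' \<noteq> 0" "g = ev2 x y p' / ev2 x y q'" "w = pev a b p' / pev a b q'"
    using assms(2) by (auto simp: val_def)
  show ?thesis unfolding val_def
    by (intro exI[of _ "p * q' + p' * q"] exI[of _ "q * q'"])
      (use 1(1) 2(1) ev2_nonzero[OF 1(1)] ev2_nonzero[OF 2(1)] in
        \<open>simp add: 1(2,3) 2(2,3) add_frac_eq\<close>)
qed

lemma val_mult:
  assumes "val a b f v" "val a b g w"
  shows "val a b (f * g) (v * w)"
proof -
  obtain p q where 1: "pev a b q \<noteq> 0" "f = ev2 x y p / ev2 x y q" "v = pev a b p / pev a b q"
    using assms(1) by (auto simp: val_def)
  obtain p' q' where 2: "pev a b q' \<noteq> 0" "g = ev2 x y p' / ev2 x y q'" "w = pev a b p' / pev a b q'"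
    using assms(2) by (auto simp: val_def)
  show ?thesis unfolding val_def
    by (intro exI[of _ "p * p'"] exI[of _ "q * q'"]) (use 1 2 in simp)
qed

lemma val_inverse:
  assumes "val a b f v" "v \<noteq> 0"
  shows "val a b (inverse f) (inverse v)"
proof -
  obtain p q where 1: "pev a b q \<noteq> 0" "f = ev2 x y p / ev2 x y q" "v = pev a b p / pev a b q"
    using assms(1) by (auto simp: val_def)
  show ?thesis unfolding val_def
    by (intro exI[of _ q] exI[of _ p]) (use 1 assms(2) in auto)
qed

lemma val_power: "val a b f v \<Longrightarrow> val a b (f ^ n) (v ^ n)"
  by (induction n) (auto intro: val_mult simp: val_const[of 1, unfolded const_hom])

text \<open>Where b = 0 the tangent is vertical and x - a vanishes to order four, so y has to serve
  as the local parameter.\<close>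

definition param :: ambient where
  "param = (if b = 0 then y else x - const a)"

lemma val_x_diff: "val a b (x - const a) 0"
  using val_add[OF val_x val_const[of "-a"]] by (simp add: const_hom)

lemma val_param: "val a b param 0"
proof (cases "b = 0")
  case True
  thus ?thesis using val_y unfolding param_def by simp
next
  case False
  thus ?thesis using val_x_diff by (simp add: param_def)
qed

text \<open>The difference of the curve equations for (x, y) and (a, b). The cofactors take the
  values 4 a^3 and 4 b^3 at the point, so each is a unit unless the corresponding coordinate is
  0.\<close>

lemma quartic_factor:
  "(x - const a) * (x^3 + x^2 * const a + x * const a ^ 2 + const a ^ 3) =
   - ((y - const b) * (y^3 + y^2 * const b + y * const b ^ 2 + const b ^ 3))"
proof -
  have "const a ^ 4 + const b ^ 4 = 1"
    using on_curve by (metis const_hom(2,3,7))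
  thus ?thesis using curve by Groebner_Basis.algebra
qed

lemma val_cofactor:
  assumes "val a b z c"
  shows "val a b (z^3 + z^2 * const c + z * const c ^ 2 + const c ^ 3) (4 * c ^ 3)"
proof -
  have "val a b (z^3 + z^2 * const c + z * const c ^ 2 + const c ^ 3) (c^3 + c^2 * c + c * c^2 + c^3)"
    by (intro val_add val_mult val_power assms val_const)
  also have "c^3 + c^2 * c + c * c^2 + c^3 = 4 * c ^ 3" by Groebner_Basis.algebra
  finally show ?thesis .
qed

lemma val_nonzero: "val a b f v \<Longrightarrow> v \<noteq> 0 \<Longrightarrow> f \<noteq> 0"
  using val_unique[of 0 0 v] val_const[of 0] by (auto simp: const_hom)

text \<open>If b = 0 then a is nonzero, the cofactor of x - a is a unit, and x - a equals y^4 up to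
  a unit.\<close>

lemma x_diff_factor:
  "\<exists>u v. val a b u v \<and> v \<noteq> 0 \<and> x - const a = param ^ (if b = 0 then 4 else 1) * u"
proof (cases "b = 0")
  case True
  hence a: "a \<noteq> 0" using on_curve by auto
  let ?c = "x^3 + x^2 * const a + x * const a ^ 2 + const a ^ 3"
  have c: "val a b ?c (4 * a ^ 3)" by (rule val_cofactor[OF val_x])
  have c0: "?c \<noteq> 0" by (rule val_nonzero[OF c]) (use a in simp)
  have "(x - const a) * ?c = - (y ^ 4)"
    using quartic_factor True by (simp add: const_hom eval_nat_numeral)
  hence "x - const a = y ^ 4 * (const (-1) * inverse ?c)"
    using c0 by (simp add: field_simps const_hom)
  moreover have "val a b (const (-1) * inverse ?c) (-1 * inverse (4 * a ^ 3))"
    by (intro val_mult val_const val_inverse[OF c]) (use a in simp)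
  ultimately show ?thesis
    using a True unfolding param_def by (intro exI[of _ "const (-1) * inverse ?c"]) (force simp: True)
next
  case False
  thus ?thesis
    using val_const[of 1] by (intro exI[of _ 1] exI[of _ 1]) (simp add: param_def const_hom)
qed

lemma y_diff_factor: "\<exists>r v. val a b r v \<and> y - const b = param * r"
proof (cases "b = 0")
  case True
  have "val a b 1 1" using val_const[of 1] by (simp add: const_hom)
  moreover have "y - const b = param * 1" unfolding param_def by (simp add: True const_hom)
  ultimately show ?thesis by blast
next
  case False
  let ?c = "y^3 + y^2 * const b + y * const b ^ 2 + const b ^ 3"
  let ?d = "x^3 + x^2 * const a + x * const a ^ 2 + const a ^ 3"
  have c: "val a b ?c (4 * b ^ 3)" by (rule val_cofactor[OF val_y])
  have c0: "?c \<noteq> 0" by (rule val_nonzero[OF c]) (use False in simp)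
  have "y - const b = (x - const a) * (const (-1) * (?d * inverse ?c))"
    using quartic_factor c0 by (simp add: field_simps const_hom)
  moreover have "val a b (const (-1) * (?d * inverse ?c)) (-1 * ((4 * a ^ 3) * inverse (4 * b ^ 3)))"
    by (intro val_mult val_const val_inverse[OF c] val_cofactor[OF val_x]) (use False in simp)
  ultimately show ?thesis using False unfolding param_def by auto
qed

text \<open>Expanding the numerator first at y = b and then at x = a puts it in the ideal generated
  by x - a and y - b, and both are multiples of \<open>param\<close>. So the maximal ideal is
  principal.\<close>

lemma val_0_factor:
  assumes "val a b f 0"
  shows "\<exists>r v. val a b r v \<and> f = param * r"
proof -
  obtain p q where 1: "pev a b q \<noteq> 0" "f = ev2 x y p / ev2 x y q" "pev a b p = 0"
    using assms by (auto simp: val_def)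
  define s where "s = poly p [:b:]"
  have "poly (p - [:s:]) [:b:] = 0" by (simp add: s_def)
  then obtain p2 where p2: "p - [:s:] = [:-[:b:], 1:] * p2"
    unfolding poly_eq_0_iff_dvd by (elim dvdE)
  have "poly s a = 0" using 1(3) by (simp add: pev_def s_def)
  then obtain s1 where s1: "s = [:-a,1:] * s1"
    unfolding poly_eq_0_iff_dvd by (elim dvdE)
  have "p = [:[:-a,1:] * s1:] + [:-[:b:], 1:] * p2"
    using p2 s1 by (metis diff_add_cancel add.commute)
  hence "ev2 x y p = ev2 x y ([:[:-a,1:] * s1:] + [:-[:b:], 1:] * p2)" by (rule arg_cong)
  also have "\<dots> = (x - const a) * ev2 x y [:s1:] + (y - const b) * ev2 x y p2"
    unfolding ev2_simps(4,5) by (simp add: const_hom algebra_simps)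
  finally have e: "ev2 x y p = (x - const a) * ev2 x y [:s1:] + (y - const b) * ev2 x y p2" .
  obtain u v where u: "val a b u v" "x - const a = param ^ (if b = 0 then 4 else 1) * u"
    using x_diff_factor by blast
  obtain r w where r: "val a b r w" "y - const b = param * r"
    using y_diff_factor by blast
  let ?k = "(if b = 0 then 3 else 0) :: nat"
  have u': "x - const a = param * (param ^ ?k * u)"
    using u(2) by (auto simp: eval_nat_numeral)
  let ?R = "(param ^ ?k * u * ev2 x y [:s1:] + r * ev2 x y p2) * inverse (ev2 x y q)"
  have "f = param * ?R"
    unfolding 1(2) e u' r(2) by (simp add: field_simps)
  moreover have "val a b ?R ((0 ^ ?k * v * pev a b [:s1:] + w * pev a b p2) * inverse (pev a b q))"
    by (intro val_mult val_add val_power val_param u r val_poly val_inverse 1(1))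
  ultimately show ?thesis by blast
qed

lemma poly_factor:
  assumes "n \<noteq> 0"
  shows "\<exists>k u v. val a b u v \<and> v \<noteq> 0 \<and> ev1 x n = param ^ k * u"
proof -
  define m where "m = order a n"
  obtain n' where n': "n = [:-a,1:] ^ m * n'" "\<not> [:-a,1:] dvd n'"
    using order_decomp[OF assms, of a] m_def by blast
  obtain u v where u: "val a b u v" "v \<noteq> 0" "x - const a = param ^ (if b = 0 then 4 else 1) * u"
    using x_diff_factor by blast
  have "ev1 x n = (x - const a) ^ m * ev1 x n'"
    unfolding n'(1) by (simp add: const_hom)
  also have "\<dots> = param ^ ((if b = 0 then 4 else 1) * m) * (u ^ m * ev2 x y [:n':])"
    unfolding u(3) by (simp add: power_mult_distrib power_mult)
  finally have e: "ev1 x n = param ^ ((if b = 0 then 4 else 1) * m) * (u ^ m * ev2 x y [:n':])" .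
  have "poly n' a \<noteq> 0" using n'(2) by (simp add: poly_eq_0_iff_dvd)
  hence "v ^ m * pev a b [:n':] \<noteq> 0" using u(2) by simp
  moreover have "val a b (u ^ m * ev2 x y [:n':]) (v ^ m * pev a b [:n':])"
    by (intro val_mult val_power u val_poly)
  ultimately show ?thesis using e by blast
qed

lemma param_nonzero: "param \<noteq> 0"
  using y_nonzero x_nonconst[of a] by (auto simp: param_def)

lemma val_param_power: "k > 0 \<Longrightarrow> val a b r w \<Longrightarrow> val a b (param ^ k * r) 0"
  using val_mult[OF val_power[OF val_param, of k], of r w] by (simp add: zero_power)

text \<open>Dividing out \<open>param\<close> has to stop: the norm of the numerator is a polynomial
  in x, whose order is known and bounds every exponent. At the largest exponent the cofactor cannot
  vanish, since \<open>val_0_factor\<close> would extract one more \<open>param\<close>.\<close>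

lemma regular_factor:
  assumes "f \<noteq> 0" "val a b f w"
  shows "\<exists>n u v. val a b u v \<and> v \<noteq> 0 \<and> f = param ^ n * u"
proof -
  obtain p q where 1: "pev a b q \<noteq> 0" "f = ev2 x y p / ev2 x y q"
    using assms(2) by (auto simp: val_def)
  have p0: "ev2 x y p \<noteq> 0" using assms(1) 1(2) by auto
  then obtain s n where n: "n \<noteq> 0" "ev2 x y p * ev2 x y s = ev1 x n"
    using norm_exists by blast
  obtain k u v where u: "val a b u v" "v \<noteq> 0" "ev1 x n = param ^ k * u"
    using poly_factor[OF n(1)] by blast
  have bound: "m \<le> k" if m: "f = param ^ m * r" "val a b r w'" for m r w'
  proof (rule ccontr)
    assume "\<not> m \<le> k"
    hence mk: "m = k + (m - k)" "m - k > 0" by auto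
    have "param ^ k * u = ev2 x y q * f * ev2 x y s"
      using 1 ev2_nonzero[OF 1(1)] n(2) u(3) by simp
    also have "\<dots> = param ^ k * (param ^ (m - k) * (r * ev2 x y q * ev2 x y s))"
      unfolding m(1) by (subst mk(1)) (simp add: power_add algebra_simps)
    finally have "u = param ^ (m - k) * (r * ev2 x y q * ev2 x y s)"
      using param_nonzero by simp
    moreover have "val a b (param ^ (m - k) * (r * ev2 x y q * ev2 x y s)) 0"
      by (rule val_param_power[OF mk(2) val_mult[OF val_mult[OF m(2) val_poly] val_poly]])
    ultimately show False using val_unique u(1,2) by blast
  qed
  define S where "S = {m. \<exists>r w'. f = param ^ m * r \<and> val a b r w'}"
  have "0 \<in> S" using assms(2) by (auto simp: S_def)
  moreover have "finite S"
    by (rule finite_subset[of _ "{..k}"]) (auto simp: S_def intro: bound)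
  ultimately have mx: "Max S \<in> S" "\<And>m. m \<in> S \<Longrightarrow> m \<le> Max S"
    by (auto intro: Max_in)
  obtain r w' where r: "f = param ^ Max S * r" "val a b r w'"
    using mx(1) unfolding S_def by blast
  have "w' \<noteq> 0"
  proof
    assume "w' = 0"
    then obtain r' v' where r': "val a b r' v'" "r = param * r'"
      using val_0_factor r(2) by blast
    have "f = param ^ Suc (Max S) * r'" using r(1) r'(2) by simp
    hence "Suc (Max S) \<in> S" using r'(1) unfolding S_def by blast
    from mx(2)[OF this] show False by simp
  qed
  thus ?thesis using r by blast
qed

lemma function_factor:
  assumes "f \<noteq> 0" "f \<in> field_of_functions"
  shows "\<exists>n u v. val a b u v \<and> v \<noteq> 0 \<and> f = param powi n * u"
proof -
  obtain p q where f: "f = ev2 x y p / ev2 x y q" "ev2 x y q \<noteq> 0"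
    using assms(2) by (auto simp: field_of_functions_def)
  have "ev2 x y p \<noteq> 0" using assms(1) f by auto
  from regular_factor[OF this val_poly] obtain n u v
    where p: "val a b u v" "v \<noteq> 0" "ev2 x y p = param ^ n * u" by blast
  from regular_factor[OF f(2) val_poly] obtain n' u' v'
    where q: "val a b u' v'" "v' \<noteq> 0" "ev2 x y q = param ^ n' * u'" by blast
  have "f = param powi (int n - int n') * (u * inverse u')"
    unfolding f(1) p(3) q(3) using param_nonzero by (simp add: power_int_diff field_simps)
  moreover have "val a b (u * inverse u') (v * inverse v')"
    by (intro val_mult p val_inverse q)
  moreover have "v * inverse v' \<noteq> 0" using p q by simp
  ultimately show ?thesis by blast
qed

end

section \<open>Local rings of the Fermat quartic\<close>

lemma form_scale: "form d g (t * a) (t * b) (t * c) = t ^ d * form d g a b c"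
  unfolding form_def sum_distrib_left
proof (intro sum.cong refl)
  fix i j assume ij: "i \<in> {..d}" "j \<in> {..d - i}"
  have "t ^ d = t ^ i * t ^ j * t ^ (d - i - j)"
    unfolding power_add[symmetric] using ij by (intro arg_cong[of _ _ "\<lambda>k. t ^ k"]) auto
  thus "g i j * (t * a) ^ i * (t * b) ^ j * (t * c) ^ (d - i - j) =
      t ^ d * (g i j * a ^ i * b ^ j * c ^ (d - i - j))"
    by (simp add: power_mult_distrib algebra_simps)
qed

text \<open>Turns evaluation on the chart Y = 1 into evaluation on the chart Z = 1, absorbing the
  scalar on the first coordinate into the coefficients.\<close>

lemma form_swap_yz: "form d g (s * a) b c = form d (\<lambda>i j. g i (d - i - j) * s ^ i) a c b"
  unfolding form_def
proof (rule sum.cong[OF refl])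
  fix i assume "i \<in> {..d}"
  show "(\<Sum>j\<le>d - i. g i j * (s * a) ^ i * b ^ j * c ^ (d - i - j)) =
      (\<Sum>j\<le>d - i. g i (d - i - j) * s ^ i * a ^ i * c ^ j * b ^ (d - i - j))"
    by (rule sum.reindex_bij_witness[of _ "\<lambda>j. d - i - j" "\<lambda>j. d - i - j"])
      (auto simp: power_mult_distrib mult_ac simp del: diff_diff_left)
qed

text \<open>Dehomogenization at Z = 1.\<close>

definition form_poly :: "nat \<Rightarrow> (nat \<Rightarrow> nat \<Rightarrow> qbar) \<Rightarrow> qbar poly poly" where
  "form_poly d g = (\<Sum>i\<le>d. \<Sum>j\<le>d - i. Polynomial.monom (Polynomial.monom (g i j) i) j)"

lemma ev1_monom: "ev1 x (Polynomial.monom c i) = const c * x ^ i"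
  by (induction i) (simp_all add: monom_0 monom_Suc const_hom)

lemma ev2_monom: "ev2 x y (Polynomial.monom (Polynomial.monom c i) j) = const c * x ^ i * y ^ j"
  by (induction j) (simp_all add: monom_0 monom_Suc ev1_monom algebra_simps)

lemma pev_monom: "pev a b (Polynomial.monom (Polynomial.monom c i) j) = c * a ^ i * b ^ j"
  by (induction j) (simp_all add: monom_0 monom_Suc poly_monom algebra_simps)

lemma ev2_form_poly: "ev2 x y (form_poly d g) = form d (\<lambda>i j. const (g i j)) x y 1"
  by (simp add: form_poly_def form_def ev2_sum ev2_monom)

lemma pev_form_poly: "pev a b (form_poly d g) = form d g a b 1"
  by (simp add: form_poly_def form_def pev_monom)

lemma coeff_form_poly:
  "Polynomial.coeff (Polynomial.coeff (form_poly d g) m) k = (if k + m \<le> d then g k m else 0)"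
proof -
  have "Polynomial.coeff (Polynomial.coeff (form_poly d g) m) k =
      (\<Sum>i\<le>d. \<Sum>j\<le>d - i. if j = m \<and> i = k then g k m else 0)"
    unfolding form_poly_def coeff_sum
    by (intro sum.cong refl) (auto simp: if_distrib[of "\<lambda>p. Polynomial.coeff p k"])
  also have "\<dots> = (\<Sum>i\<le>d. if i = k then (if m \<le> d - k then g k m else 0) else 0)"
    by (intro sum.cong refl) (auto simp: if_distrib)
  also have "\<dots> = (if k + m \<le> d then g k m else 0)"
    by auto
  finally show ?thesis .
qed

text \<open>Every sufficiently large degree is allowed, so that numerator and denominator of a
  quotient can be homogenized to a common degree.\<close>

lemma poly_eq_form_poly: "\<exists>d0. \<forall>d\<ge>d0. \<exists>g. form_poly d g = p"
proof -
  define d0 where "d0 = Polynomial.degree p + (\<Sum>j\<le>Polynomial.degree p. Polynomial.degree (Polynomial.coeff p j))"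
  have bound: "k + m \<le> d0" if "Polynomial.coeff (Polynomial.coeff p m) k \<noteq> 0" for k m
  proof -
    have m: "m \<le> Polynomial.degree p" using that by (intro le_degree) auto
    have "k \<le> Polynomial.degree (Polynomial.coeff p m)" using that by (rule le_degree)
    also have "\<dots> \<le> (\<Sum>j\<le>Polynomial.degree p. Polynomial.degree (Polynomial.coeff p j))"
      using m by (intro member_le_sum) auto
    finally show ?thesis using m by (simp add: d0_def)
  qed
  have "form_poly d (\<lambda>i j. Polynomial.coeff (Polynomial.coeff p j) i) = p" if "d \<ge> d0" for d
  proof (intro poly_eqI)
    fix m k
    show "Polynomial.coeff (Polynomial.coeff (form_poly d (\<lambda>i j. Polynomial.coeff (Polynomial.coeff p j) i)) m) k =
        Polynomial.coeff (Polynomial.coeff p m) k"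
      unfolding coeff_form_poly using bound[of m k] that
      by (cases "Polynomial.coeff (Polynomial.coeff p m) k = 0") auto
  qed
  thus ?thesis by blast
qed

lemma common_degree:
  obtains d g h where "form_poly d g = p" "form_poly d h = q"
proof -
  obtain d0 d1 where "\<forall>d\<ge>d0. \<exists>g. form_poly d g = p" "\<forall>d\<ge>d1. \<exists>g. form_poly d g = q"
    using poly_eq_form_poly by meson
  hence "\<exists>g. form_poly (max d0 d1) g = p" "\<exists>g. form_poly (max d0 d1) g = q"
    by auto
  thus ?thesis using that by blast
qed

section \<open>The two charts that cover the curve\<close>

lemma y_coord: "y_coord ^ 4 = 1 - x_coord ^ 4"
  unfolding y_coord_def by (rule someI_ex, rule nth_root_exists) simp

lemma ev1_x_coord: "ev1 x_coord p = to_ac (to_fract p)"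
proof (induction p)
  case (pCons c p)
  have "to_ac (to_fract (pCons c p)) = to_ac (to_fract ([:c:] + [:0,1:] * p))" by simp
  also have "\<dots> = const c + x_coord * to_ac (to_fract p)"
    by (simp only: to_fract_add to_fract_mult to_ac_add to_ac_mult const_def x_coord_def)
  finally show ?case by (simp add: pCons.IH)
qed simp

interpretation aff: chart x_coord y_coord
  by standard (simp_all add: y_coord ev1_x_coord)

text \<open>Coordinates on the chart Y = 1. The factor \<open>zeta 8\<close>, with fourth power -1,
  restores the equation x^4 + y^4 = 1; the points at infinity become the points with y = 0 and x a
  fourth root of unity.\<close>

definition x_inf :: ambient where "x_inf = x_coord / (const (zeta 8) * y_coord)"
definition y_inf :: ambient where "y_inf = 1 / y_coord"

lemma zeta_8_4: "zeta 8 ^ 4 = -1"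
proof -
  have "exp (2 * complex_of_real pi * \<i> / 8) ^ 4 = exp (of_real pi * \<i>)"
    by (simp add: exp_of_nat_mult[symmetric] mult_ac)
  also have "\<dots> = -1" by simp
  finally show ?thesis
    by (transfer) simp
qed

lemma zeta_4: "zeta 4 = zeta 8 ^ 2"
proof -
  have "exp (2 * complex_of_real pi * \<i> / 8) ^ 2 = exp (2 * complex_of_real pi * \<i> / 4)"
    by (simp add: exp_of_nat_mult[symmetric] mult_ac)
  thus ?thesis by transfer simp
qed

lemma zeta_4_2: "zeta 4 ^ 2 = -1"
  unfolding zeta_4 power_mult[symmetric] using zeta_8_4 by simp

lemma zeta_8_nonzero [simp]: "zeta 8 \<noteq> 0"
  using zeta_8_4 by auto

lemma zeta_4_nonzero [simp]: "zeta 4 \<noteq> 0"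
  using zeta_4_2 by auto

text \<open>Transcendence: a polynomial over an algebraically closed field splits, so an algebraic
  \<open>x_inf\<close> would be a constant c, and this gives the nontrivial relation c^4 + (1 - c^4)
  x^4 = 0 for \<open>x_coord\<close>.\<close>

interpretation inf: chart x_inf y_inf
proof
  have z: "const (zeta 8) ^ 4 = -1"
    using zeta_8_4 by (metis const_hom(2,5,7))
  have y0: "y_coord ^ 4 \<noteq> 0" using aff.y_nonzero by simp
  have "x_inf ^ 4 + y_inf ^ 4 = (1 - x_coord ^ 4) / y_coord ^ 4"
    unfolding x_inf_def y_inf_def power_divide power_mult_distrib z by (simp add: diff_divide_distrib)
  thus "x_inf ^ 4 + y_inf ^ 4 = 1"
    using y0 by (simp add: y_coord[symmetric])
  show "p = 0" if p: "ev1 x_inf p = 0" for p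
  proof (rule ccontr)
    assume "p \<noteq> 0"
    then obtain A where A: "p = Polynomial.smult (Polynomial.lead_coeff p) (\<Prod>x\<in>#A. [:-x, 1:])"
      using alg_closed_imp_factorization by blast
    have "ev1 x_inf (\<Prod>x\<in>#A. [:-x, 1:]) = (\<Prod>x\<in>#A. x_inf - const x)"
      by (induction A) (simp_all add: const_hom algebra_simps)
    hence "ev1 x_inf p = const (Polynomial.lead_coeff p) * (\<Prod>x\<in>#A. x_inf - const x)"
      by (subst A) simp
    hence "(\<Prod>x\<in>#A. x_inf - const x) = 0" using p \<open>p \<noteq> 0\<close> by simp
    then obtain c where "x_inf = const c" by (auto simp: prod_mset_zero_iff)
    hence "x_coord = const (c * zeta 8) * y_coord"
      using aff.y_nonzero by (simp add: x_inf_def field_simps const_hom)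
    hence "x_coord ^ 4 = (const c ^ 4 * const (zeta 8) ^ 4) * y_coord ^ 4"
      unfolding power_mult_distrib[symmetric] by (simp add: const_hom)
    hence e: "x_coord ^ 4 = const (- (c ^ 4)) * (1 - x_coord ^ 4)"
      unfolding y_coord z by (simp add: const_hom)
    have "ev1 x_coord [:c^4, 0, 0, 0, 1 - c^4:] = 0"
      using e by (simp add: eval_nat_numeral const_hom algebra_simps)
    hence "[:c^4, 0, 0, 0, 1 - c^4:] = 0" by (rule aff.transcendental)
    thus False by (cases "c = 0") auto
  qed
qed

lemma restr_eq: "restr d g = ev2 x_coord y_coord (form_poly d g)"
  by (simp add: restr_def ev2_form_poly)

lemma restr_eq_inf:
  "restr d g = y_coord ^ d * ev2 x_inf y_inf (form_poly d (\<lambda>i j. g i (d - i - j) * zeta 8 ^ i))"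
proof -
  let ?g = "\<lambda>i j. const (g i j)"
  have y: "y_coord \<noteq> 0" by (rule aff.y_nonzero)
  have "restr d g = form d ?g (y_coord * (const (zeta 8) * x_inf)) (y_coord * 1) (y_coord * y_inf)"
    using y by (simp add: restr_def x_inf_def y_inf_def)
  also have "\<dots> = y_coord ^ d * form d ?g (const (zeta 8) * x_inf) 1 y_inf"
    by (rule form_scale)
  also have "form d ?g (const (zeta 8) * x_inf) 1 y_inf =
      form d (\<lambda>i j. ?g i (d - i - j) * const (zeta 8) ^ i) x_inf y_inf 1"
    by (rule form_swap_yz)
  also have "(\<lambda>i j. ?g i (d - i - j) * const (zeta 8) ^ i) = (\<lambda>i j. const (g i (d - i - j) * zeta 8 ^ i))"
    by (simp add: const_hom)
  finally show ?thesis by (simp add: ev2_form_poly)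
qed

lemma form_inf: "form d g (zeta 8 * a) 1 0 = pev a 0 (form_poly d (\<lambda>i j. g i (d - i - j) * zeta 8 ^ i))"
  unfolding form_swap_yz pev_form_poly ..

lemma form_poly_inf_surj:
  "\<exists>g'. form_poly d (\<lambda>i j. g' i (d - i - j) * zeta 8 ^ i) = form_poly d g"
proof (intro exI[of _ "\<lambda>i j. g i (d - i - j) / zeta 8 ^ i"])
  show "form_poly d (\<lambda>i j. g i (d - i - (d - i - j)) / zeta 8 ^ i * zeta 8 ^ i) = form_poly d g"
    unfolding form_poly_def by (intro sum.cong refl) auto
qed

lemma function_field_affine: "function_field = aff.field_of_functions"
proof (intro equalityI subsetI)
  fix f assume "f \<in> function_field"
  thus "f \<in> aff.field_of_functions"
    unfolding function_field_def aff.field_of_functions_def restr_eq by blast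
next
  fix f assume "f \<in> aff.field_of_functions"
  then obtain p q where f: "f = ev2 x_coord y_coord p / ev2 x_coord y_coord q" "ev2 x_coord y_coord q \<noteq> 0"
    unfolding aff.field_of_functions_def by blast
  obtain d g h where "form_poly d g = p" "form_poly d h = q" by (rule common_degree)
  thus "f \<in> function_field"
    using f unfolding function_field_def restr_eq by blast
qed

lemma function_field_inf: "function_field = inf.field_of_functions"
proof (intro equalityI subsetI)
  fix f assume "f \<in> function_field"
  then obtain d g h where "f = restr d g / restr d h" "restr d h \<noteq> 0"
    unfolding function_field_def by blast
  thus "f \<in> inf.field_of_functions"
    unfolding restr_eq_inf inf.field_of_functions_def using aff.y_nonzero by auto
next
  fix f assume "f \<in> inf.field_of_functions"
  then obtain p q where f: "f = ev2 x_inf y_inf p / ev2 x_inf y_inf q" "ev2 x_inf y_inf q \<noteq> 0"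
    unfolding inf.field_of_functions_def by blast
  obtain d g h where gh: "form_poly d g = p" "form_poly d h = q" by (rule common_degree)
  obtain g' h' where gh': "form_poly d (\<lambda>i j. g' i (d - i - j) * zeta 8 ^ i) = form_poly d g"
     "form_poly d (\<lambda>i j. h' i (d - i - j) * zeta 8 ^ i) = form_poly d h"
    using form_poly_inf_surj by meson
  have "f = restr d g' / restr d h'" "restr d h' \<noteq> 0"
    unfolding restr_eq_inf gh' gh using f aff.y_nonzero by simp_all
  thus "f \<in> function_field"
    unfolding function_field_def by blast
qed

lemma has_value_rep:
  "has_value (proj_point a b c) f v \<longleftrightarrow>
    (\<exists>d g h. form d h a b c \<noteq> 0 \<and> f = restr d g / restr d h \<and> v = form d g a b c / form d h a b c)"
    (is "?L \<longleftrightarrow> ?R")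
proof
  assume ?L
  then obtain t d g h where t: "t \<noteq> 0" "form d h (t * a) (t * b) (t * c) \<noteq> 0"
    "f = restr d g / restr d h" "v = form d g (t * a) (t * b) (t * c) / form d h (t * a) (t * b) (t * c)"
    unfolding has_value_def proj_point_def by auto
  thus ?R unfolding form_scale by auto
next
  assume ?R
  moreover have "(a, b, c) \<in> proj_point a b c"
    unfolding proj_point_def by (auto intro: exI[of _ 1])
  ultimately show ?L unfolding has_value_def by blast
qed

lemma has_value_affine: "has_value (proj_point a b 1) f v \<longleftrightarrow> aff.val a b f v"
proof
  assume "has_value (proj_point a b 1) f v"
  thus "aff.val a b f v"
    unfolding has_value_rep aff.val_def restr_eq pev_form_poly[symmetric] by blast
next
  assume "aff.val a b f v"
  then obtain p q where f: "pev a b q \<noteq> 0" "f = ev2 x_coord y_coord p / ev2 x_coord y_coord q"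
     "v = pev a b p / pev a b q"
    unfolding aff.val_def by blast
  obtain d g h where "form_poly d g = p" "form_poly d h = q" by (rule common_degree)
  thus "has_value (proj_point a b 1) f v"
    using f unfolding has_value_rep restr_eq pev_form_poly[symmetric] by blast
qed

lemma has_value_inf: "has_value (proj_point (zeta 8 * a) 1 0) f v \<longleftrightarrow> inf.val a 0 f v"
proof
  assume "has_value (proj_point (zeta 8 * a) 1 0) f v"
  then obtain d g h where "form d h (zeta 8 * a) 1 0 \<noteq> 0" "f = restr d g / restr d h"
    "v = form d g (zeta 8 * a) 1 0 / form d h (zeta 8 * a) 1 0"
    unfolding has_value_rep by blast
  thus "inf.val a 0 f v"
    unfolding inf.val_def restr_eq_inf form_inf using aff.y_nonzero by auto
next
  assume "inf.val a 0 f v"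
  then obtain p q where f: "pev a 0 q \<noteq> 0" "f = ev2 x_inf y_inf p / ev2 x_inf y_inf q"
     "v = pev a 0 p / pev a 0 q"
    unfolding inf.val_def by blast
  obtain d g h where gh: "form_poly d g = p" "form_poly d h = q" by (rule common_degree)
  obtain g' h' where gh': "form_poly d (\<lambda>i j. g' i (d - i - j) * zeta 8 ^ i) = form_poly d g"
     "form_poly d (\<lambda>i j. h' i (d - i - j) * zeta 8 ^ i) = form_poly d h"
    using form_poly_inf_surj by meson
  have "form d h' (zeta 8 * a) 1 0 \<noteq> 0" "f = restr d g' / restr d h'"
    "v = form d g' (zeta 8 * a) 1 0 / form d h' (zeta 8 * a) 1 0"
    unfolding restr_eq_inf form_inf gh' gh using f aff.y_nonzero by simp_all
  thus "has_value (proj_point (zeta 8 * a) 1 0) f v"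
    unfolding has_value_rep by blast
qed

lemma proj_point_scale:
  assumes "t \<noteq> 0"
  shows "proj_point (t * a) (t * b) (t * c) = proj_point a b c"
proof (intro equalityI subsetI)
  fix p assume "p \<in> proj_point (t * a) (t * b) (t * c)"
  then obtain s where "s \<noteq> 0" "p = ((s * t) * a, (s * t) * b, (s * t) * c)"
    unfolding proj_point_def by (auto simp: mult.assoc)
  thus "p \<in> proj_point a b c"
    using assms unfolding proj_point_def by (intro CollectI exI[of _ "s * t"]) simp
next
  fix p assume "p \<in> proj_point a b c"
  then obtain s where "s \<noteq> 0" "p = ((s / t) * (t * a), (s / t) * (t * b), (s / t) * (t * c))"
    using assms unfolding proj_point_def by auto
  thus "p \<in> proj_point (t * a) (t * b) (t * c)"
    using assms unfolding proj_point_def by (intro CollectI exI[of _ "s / t"]) simp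
qed

lemma proj_point_eq:
  assumes "proj_point a b c = proj_point a' b' c'"
  shows "\<exists>t. t \<noteq> 0 \<and> a = t * a' \<and> b = t * b' \<and> c = t * c'"
proof -
  have "(a, b, c) \<in> proj_point a b c"
    unfolding proj_point_def by (auto intro: exI[of _ 1])
  thus ?thesis unfolding assms unfolding proj_point_def by auto
qed

lemma proj_point_affine_eq: "proj_point a b 1 = proj_point a' b' 1 \<longleftrightarrow> a = a' \<and> b = b'"
  using proj_point_eq[of a b 1 a' b' 1] by auto

lemma proj_point_affine_neq_inf: "proj_point a b 1 \<noteq> proj_point c d 0"
  using proj_point_eq[of a b 1 c d 0] by auto

lemma fermat_affine: "a ^ 4 + b ^ 4 = 1 \<Longrightarrow> proj_point a b 1 \<in> fermat"
  unfolding fermat_def by (intro CollectI exI[of _ a] exI[of _ b] exI[of _ 1]) simp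

lemma fermat_inf: "a ^ 4 = 1 \<Longrightarrow> proj_point (zeta 8 * a) 1 0 \<in> fermat"
  unfolding fermat_def using zeta_8_4
  by (intro CollectI exI[of _ "zeta 8 * a"] exI[of _ 1] exI[of _ 0]) (simp add: power_mult_distrib)

lemma fermat_cases:
  assumes "P \<in> fermat"
  obtains (affine) a b where "a ^ 4 + b ^ 4 = 1" "P = proj_point a b 1"
    | (infinite) a where "a ^ 4 = 1" "P = proj_point (zeta 8 * a) 1 0"
proof -
  obtain a b c where P: "P = proj_point a b c" "(a, b, c) \<noteq> (0, 0, 0)" "a ^ 4 + b ^ 4 = c ^ 4"
    using assms unfolding fermat_def by blast
  show thesis
  proof (cases "c = 0")
    case False
    have "P = proj_point (a / c) (b / c) 1"
      unfolding P(1) using proj_point_scale[of c "a / c" "b / c" 1] False by simp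
    moreover have "(a / c) ^ 4 + (b / c) ^ 4 = 1"
      using P(3) False by (simp add: power_divide add_divide_distrib[symmetric])
    ultimately show ?thesis by (rule affine[rotated])
  next
    case True
    have b: "b \<noteq> 0" using P(2,3) True by auto
    have "P = proj_point (zeta 8 * (a / (zeta 8 * b))) 1 0"
      unfolding P(1) using proj_point_scale[of b "a / b" 1 0] True b by simp
    moreover have "a ^ 4 = - (b ^ 4)" using P(3) True by (simp add: eq_neg_iff_add_eq_0)
    hence "(a / (zeta 8 * b)) ^ 4 = 1"
      using b by (simp add: power_divide power_mult_distrib zeta_8_4)
    ultimately show ?thesis by (rule infinite[rotated])
  qed
qed

text \<open>Lets the local theory at every point be imported from \<open>chart_point\<close>,
  without distinguishing finite points from points at infinity.\<close>

lemma point_chart: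
  assumes "P \<in> fermat"
  obtains x y a b where "chart_point x y a b" "\<And>f v. has_value P f v \<longleftrightarrow> chart.val x y a b f v"
    "function_field = chart.field_of_functions x y"
  using assms
proof (cases rule: fermat_cases)
  case (affine a b)
  have "chart_point x_coord y_coord a b"
    using affine by unfold_locales
  thus ?thesis
    using that has_value_affine function_field_affine affine(2) by blast
next
  case (infinite a)
  have "chart_point x_inf y_inf a 0"
    using infinite by unfold_locales simp
  thus ?thesis
    using that has_value_inf function_field_inf infinite(2) by blast
qed

lemma function_field_divide: "f \<in> function_field \<Longrightarrow> g \<in> function_field \<Longrightarrow> f / g \<in> function_field"
  unfolding function_field_affine by (rule aff.field_of_functions_divide)

lemma function_field_diff: "f \<in> function_field \<Longrightarrow> g \<in> function_field \<Longrightarrow> f - g \<in> function_field"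
  unfolding function_field_affine by (rule aff.field_of_functions_diff)

lemma function_field_poly: "ev2 x_coord y_coord p \<in> function_field"
  unfolding function_field_affine by (rule aff.field_of_functions_poly)

lemma function_field_const: "const c \<in> function_field"
  using function_field_poly[of "[:[:c:]:]"] by simp

lemma function_field_0: "0 \<in> function_field" and function_field_1: "1 \<in> function_field"
  using function_field_const[of 0] function_field_const[of 1] by (simp_all add: const_hom)

lemma function_field_uminus: "f \<in> function_field \<Longrightarrow> - f \<in> function_field"
  using function_field_diff[OF function_field_0] by fastforce

lemma function_field_add: "f \<in> function_field \<Longrightarrow> g \<in> function_field \<Longrightarrow> f + g \<in> function_field"
  using function_field_diff[of f "-g"] function_field_uminus[of g] by simp

lemma function_field_inverse: "f \<in> function_field \<Longrightarrow> inverse f \<in> function_field"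
  using function_field_divide[OF function_field_1] by (simp add: divide_inverse)

lemma function_field_mult: "f \<in> function_field \<Longrightarrow> g \<in> function_field \<Longrightarrow> f * g \<in> function_field"
  using function_field_divide[of f "inverse g"] function_field_inverse[of g] by (simp add: divide_inverse)

lemma function_field_power: "f \<in> function_field \<Longrightarrow> f ^ n \<in> function_field"
  by (induction n) (auto intro: function_field_mult function_field_1)

lemma function_field_powi: "f \<in> function_field \<Longrightarrow> f powi n \<in> function_field"
  by (auto simp: power_int_def intro: function_field_power function_field_inverse)

lemma function_field_x: "x_coord \<in> function_field"
  using function_field_poly[of "[:[:0,1:]:]"] by (simp add: const_hom)

lemma function_field_y: "y_coord \<in> function_field"
  using function_field_poly[of "[:0,1:]"] by simp

lemmas function_field_intros = function_field_divide function_field_diff function_field_const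
  function_field_0 function_field_1 function_field_uminus function_field_add function_field_inverse
  function_field_mult function_field_power function_field_powi function_field_x function_field_y

section \<open>Values, uniformizers and orders at a point of the curve\<close>

context
  fixes P :: point
  assumes P: "P \<in> fermat"
begin

lemma has_value_unique: "has_value P f v \<Longrightarrow> has_value P f w \<Longrightarrow> v = w"
  using point_chart[OF P] chart_point.val_unique by metis

lemma has_value_mem: "has_value P f v \<Longrightarrow> f \<in> function_field"
  using point_chart[OF P] chart_point.val_mem by metis

lemma has_value_const: "has_value P (const c) c"
  using point_chart[OF P] chart_point.val_const by metis

lemma has_value_add: "has_value P f v \<Longrightarrow> has_value P g w \<Longrightarrow> has_value P (f + g) (v + w)"
  using point_chart[OF P] chart_point.val_add by metis

lemma has_value_mult: "has_value P f v \<Longrightarrow> has_value P g w \<Longrightarrow> has_value P (f * g) (v * w)"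
  using point_chart[OF P] chart_point.val_mult by metis

lemma has_value_inverse: "has_value P f v \<Longrightarrow> v \<noteq> 0 \<Longrightarrow> has_value P (inverse f) (inverse v)"
  using point_chart[OF P] chart_point.val_inverse by metis

lemma has_value_1: "has_value P 1 1"
  using has_value_const[of 1] by (simp add: const_hom)

lemma has_value_0: "has_value P 0 0"
  using has_value_const[of 0] by (simp add: const_hom)

lemma not_has_value_1_0 [simp]: "\<not> has_value P 1 0"
  using has_value_unique[OF has_value_1, of 0] by auto

lemma has_value_uminus: "has_value P f v \<Longrightarrow> has_value P (- f) (- v)"
  using has_value_mult[OF has_value_const[of "-1"]] by (fastforce simp: const_hom)

lemma has_value_diff: "has_value P f v \<Longrightarrow> has_value P g w \<Longrightarrow> has_value P (f - g) (v - w)"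
  using has_value_add[OF _ has_value_uminus] by fastforce

lemma has_value_divide: "has_value P f v \<Longrightarrow> has_value P g w \<Longrightarrow> w \<noteq> 0 \<Longrightarrow> has_value P (f / g) (v / w)"
  unfolding divide_inverse by (intro has_value_mult has_value_inverse)

lemma has_value_power: "has_value P f v \<Longrightarrow> has_value P (f ^ n) (v ^ n)"
  by (induction n) (auto intro: has_value_mult has_value_1)

lemma has_value_powi: "has_value P f v \<Longrightarrow> v \<noteq> 0 \<Longrightarrow> has_value P (f powi n) (v powi n)"
  by (auto simp: power_int_def intro: has_value_power has_value_inverse)

lemma has_value_nonzero: "has_value P f v \<Longrightarrow> v \<noteq> 0 \<Longrightarrow> f \<noteq> 0"
  using has_value_unique[of 0 v 0] has_value_0 by auto

lemma value_at_eq: "has_value P f v \<Longrightarrow> value_at P f = v"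
  unfolding value_at_def using has_value_unique by blast

lemma param_exists:
  "\<exists>t. t \<noteq> 0 \<and> has_value P t 0 \<and>
    (\<forall>f\<in>function_field. f \<noteq> 0 \<longrightarrow> (\<exists>n u v. has_value P u v \<and> v \<noteq> 0 \<and> f = t powi n * u))"
proof -
  obtain x y a b where *: "chart_point x y a b" "\<And>f v. has_value P f v \<longleftrightarrow> chart.val x y a b f v"
    "function_field = chart.field_of_functions x y"
    using point_chart[OF P] by metis
  interpret C: chart_point x y a b by (rule *)
  show ?thesis
    unfolding *(2,3) using C.param_nonzero C.val_param C.function_factor by blast
qed

lemma maximal_ideal_eq: "maximal_ideal P = {f. has_value P f 0}"
  unfolding maximal_ideal_def local_ring_def using value_at_eq by auto

lemma local_ring_diff: "u \<in> local_ring P - maximal_ideal P \<longleftrightarrow> (\<exists>v. has_value P u v \<and> v \<noteq> 0)"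
  unfolding maximal_ideal_eq using has_value_unique by (auto simp: local_ring_def)

text \<open>Positive powers of t take the value 0; a regular negative power would then give the
  product 1 the value 0.\<close>

lemma powi_unit:
  assumes "has_value P t 0" "t \<noteq> 0" "has_value P (t powi n) w"
  shows "n \<ge> 0" "w \<noteq> 0 \<Longrightarrow> n = 0"
proof -
  have pos: "has_value P (t powi m) 0" if "m > 0" for m
    using has_value_power[OF assms(1), of "nat m"] that by (simp add: power_int_def zero_power)
  show n: "n \<ge> 0"
  proof (rule ccontr)
    assume "\<not> n \<ge> 0"
    hence "has_value P (t powi n * t powi (-n)) (w * 0)"
      by (intro has_value_mult assms(3) pos) simp
    moreover have "t powi n * t powi (-n) = 1"
      using assms(2) by (simp add: power_int_add[symmetric])
    ultimately show False by simp
  qed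
  show "n = 0" if "w \<noteq> 0"
    using pos[of n] has_value_unique[OF assms(3)] that n by force
qed

text \<open>A generator t of the maximal ideal is compared with the parameter s of the chart: s = t
  r with r regular and t = s^n u with u a unit force n = 1, so t inherits the factorizations known
  for s.\<close>

lemma uniformizer_factor:
  assumes "uniformizer P t"
  shows "t \<noteq> 0" "has_value P t 0"
    "f \<in> function_field \<Longrightarrow> f \<noteq> 0 \<Longrightarrow> \<exists>n u v. has_value P u v \<and> v \<noteq> 0 \<and> f = t powi n * u"
proof -
  obtain s where s: "s \<noteq> 0" "has_value P s 0"
    "\<And>f. f\<in>function_field \<Longrightarrow> f \<noteq> 0 \<Longrightarrow> \<exists>n u v. has_value P u v \<and> v \<noteq> 0 \<and> f = s powi n * u"
    using param_exists by blast
  have mi: "{f. has_value P f 0} = {t * r |r. \<exists>v. has_value P r v}"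
    using assms unfolding uniformizer_def maximal_ideal_eq local_ring_def by simp
  have "has_value P (t * 1) 0"
    using mi has_value_1 by blast
  thus t: "has_value P t 0" by simp
  obtain r w where r: "s = t * r" "has_value P r w"
  proof -
    have "s \<in> {t * r |r. \<exists>v. has_value P r v}"
      unfolding mi[symmetric] using s(2) by simp
    thus thesis using that by blast
  qed
  show t0: "t \<noteq> 0" using r(1) s(1) by auto
  obtain n u v where u: "has_value P u v" "v \<noteq> 0" "t = s powi n * u"
    using s(3)[OF has_value_mem[OF t] t0] by blast
  have u0: "u \<noteq> 0" by (rule has_value_nonzero[OF u(1,2)])
  have "s powi 1 = s powi n * (u * r)" using r(1) u(3) by (metis mult.assoc power_int_1_right)
  hence "s powi (1 - n) = u * r"
    using s(1) by (simp add: power_int_diff field_simps)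
  hence e1: "has_value P (s powi (1 - n)) (v * w)"
    using has_value_mult[OF u(1) r(2)] by simp
  from powi_unit(1)[OF s(2,1) e1] have "n \<le> 1" by simp
  have "s powi n = t * inverse u" using u(3) u0 by simp
  hence e2: "has_value P (s powi n) (0 * inverse v)"
    using has_value_mult[OF t has_value_inverse[OF u(1,2)]] by simp
  from powi_unit(1)[OF s(2,1) e2] have "n \<ge> 0" .
  moreover have "n \<noteq> 0" using e2 has_value_unique[OF has_value_1] by auto
  ultimately have n: "n = 1" using \<open>n \<le> 1\<close> by simp
  hence su: "s = t * inverse u" using u(3) u0 by simp
  fix f assume "f \<in> function_field" "f \<noteq> 0"
  then obtain m g z where g: "has_value P g z" "z \<noteq> 0" "f = s powi m * g"
    using s(3) by blast
  have "f = t powi m * (inverse u powi m * g)"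
    unfolding g(3) by (subst su) (simp add: power_int_mult_distrib)
  moreover have "has_value P (inverse u powi m * g) (inverse v powi m * z)"
    using u g by (intro has_value_mult has_value_powi has_value_inverse) auto
  moreover have "inverse v powi m * z \<noteq> 0" using u g by simp
  ultimately show "\<exists>n u v. has_value P u v \<and> v \<noteq> 0 \<and> f = t powi n * u" by blast
qed

lemma uniformizerI:
  assumes "t \<noteq> 0" "has_value P t 0"
    "\<And>f. f \<in> function_field \<Longrightarrow> f \<noteq> 0 \<Longrightarrow> \<exists>n u v. has_value P u v \<and> v \<noteq> 0 \<and> f = t powi n * u"
  shows "uniformizer P t"
  unfolding uniformizer_def maximal_ideal_eq
proof (intro equalityI subsetI)
  fix f assume "f \<in> {f. has_value P f 0}"
  hence f: "has_value P f 0" by simp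
  show "f \<in> {t * r |r. r \<in> local_ring P}"
  proof (cases "f = 0")
    case True
    hence "f = t * 0" by simp
    thus ?thesis using has_value_0 unfolding local_ring_def by blast
  next
    case False
    then obtain n u v where u: "has_value P u v" "v \<noteq> 0" "f = t powi n * u"
      using assms(3)[OF has_value_mem[OF f]] by blast
    have u0: "u \<noteq> 0" by (rule has_value_nonzero[OF u(1,2)])
    have "has_value P (f * inverse u) (0 * inverse v)"
      by (intro has_value_mult f has_value_inverse u)
    moreover have "f * inverse u = t powi n" using u(3) u0 by simp
    ultimately have e: "has_value P (t powi n) 0" by simp
    from powi_unit(1)[OF assms(2,1) e] have "n \<ge> 0" .
    moreover have "n \<noteq> 0" using e by (cases "n = 0") auto
    ultimately have "n = 1 + int (nat (n - 1))" by simp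
    then obtain k where "n = 1 + int k" by blast
    hence "f = t * (t ^ k * u)" using u(3) assms(1) by (simp add: power_int_add)
    moreover have "has_value P (t ^ k * u) (0 ^ k * v)"
      by (intro has_value_mult has_value_power assms u)
    ultimately show ?thesis unfolding local_ring_def by blast
  qed
next
  fix f assume "f \<in> {t * r |r. r \<in> local_ring P}"
  then obtain r v where "f = t * r" "has_value P r v" unfolding local_ring_def by blast
  thus "f \<in> {f. has_value P f 0}" using has_value_mult[OF assms(2)] by fastforce
qed

lemma uniformizer_exists: "\<exists>t. uniformizer P t"
  using param_exists uniformizerI by blast

text \<open>The defining \<open>THE\<close> ranges over all uniformizers, so independence of the
  choice is needed: s = t^k g and t = s^l g' with units g, g' and positive k, l give k l = 1, and s
  and t differ by a unit.\<close>

lemma ord_at_eqI: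
  assumes t: "uniformizer P t" and u: "has_value P u v" "v \<noteq> 0" and f: "f = t powi n * u"
  shows "ord_at P f = n"
  unfolding ord_at_def
proof (rule the_equality)
  show "\<exists>t u. uniformizer P t \<and> u \<in> local_ring P - maximal_ideal P \<and> f = t powi n * u"
    using assms unfolding local_ring_diff by blast
next
  fix m assume "\<exists>t u. uniformizer P t \<and> u \<in> local_ring P - maximal_ideal P \<and> f = t powi m * u"
  then obtain s w z where s: "uniformizer P s" "has_value P w z" "z \<noteq> 0" "f = s powi m * w"
    unfolding local_ring_diff by blast
  note T = uniformizer_factor[OF t] and S = uniformizer_factor[OF s(1)]
  obtain k g y where g: "has_value P g y" "y \<noteq> 0" "s = t powi k * g"
    using T(3)[OF has_value_mem[OF S(2)] S(1)] by blast
  obtain l g' y' where g': "has_value P g' y'" "y' \<noteq> 0" "t = s powi l * g'"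
    using S(3)[OF has_value_mem[OF T(2)] T(1)] by blast
  have g0: "g \<noteq> 0" "g' \<noteq> 0" "w \<noteq> 0" "u \<noteq> 0"
    using has_value_nonzero g g' s u by blast+
  have "t powi k = s * inverse g" using g(3) g0 by simp
  hence "has_value P (t powi k) (0 * inverse y)"
    using has_value_mult[OF S(2) has_value_inverse[OF g(1,2)]] by simp
  hence k: "k \<ge> 0" "k \<noteq> 0"
    using powi_unit(1)[OF T(2,1)] by (blast, cases "k = 0", auto)
  have "s powi l = t * inverse g'" using g'(3) g0 by simp
  hence "has_value P (s powi l) (0 * inverse y')"
    using has_value_mult[OF T(2) has_value_inverse[OF g'(1,2)]] by simp
  hence l: "l \<ge> 0" "l \<noteq> 0"
    using powi_unit(1)[OF S(2,1)] by (blast, cases "l = 0", auto)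
  have "t powi (k * l) * (g powi l * g') = s powi l * g'"
    by (simp add: g(3) power_int_mult power_int_mult_distrib)
  also have "\<dots> = t" using g'(3) by simp
  finally have "t powi (k * l) * (g powi l * g') = t" .
  hence "t powi (k * l - 1) = inverse (g powi l * g')"
    using T(1) g0 by (simp add: power_int_diff field_simps)
  hence "has_value P (t powi (k * l - 1)) (inverse (y powi l * y'))"
    using has_value_inverse[OF has_value_mult[OF has_value_powi[OF g(1,2)] g'(1)]] g(2) g'(2) by simp
  from powi_unit(2)[OF T(2,1) this] have "k * l = 1" using g(2) g'(2) by simp
  hence k1: "k = 1" using k l by (simp add: zmult_eq_1_iff)
  have "t powi n * u = t powi m * (g powi m * w)"
    using f s(4) g(3) unfolding k1 by (metis mult.assoc power_int_1_right power_int_mult_distrib)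
  hence "t powi (n - m) = g powi m * w * inverse u"
    using T(1) g0 by (simp add: power_int_diff field_simps)
  hence "has_value P (t powi (n - m)) (y powi m * z * inverse v)"
    using has_value_mult[OF has_value_mult[OF has_value_powi[OF g(1,2)] s(2)] has_value_inverse[OF u]] by simp
  from powi_unit(2)[OF T(2,1) this] show "m = n" using g(2) s(3) u(2) by simp
qed

lemma ord_at_factor:
  assumes "uniformizer P t" "f \<in> function_field" "f \<noteq> 0"
  shows "\<exists>u v. has_value P u v \<and> v \<noteq> 0 \<and> f = t powi ord_at P f * u"
  using uniformizer_factor(3)[OF assms] ord_at_eqI[OF assms(1)] by metis

lemma ord_at_mult:
  assumes "f \<in> function_field" "f \<noteq> 0" "g \<in> function_field" "g \<noteq> 0"
  shows "ord_at P (f * g) = ord_at P f + ord_at P g"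
proof -
  obtain t where t: "uniformizer P t" using uniformizer_exists by blast
  obtain u v where u: "has_value P u v" "v \<noteq> 0" "f = t powi ord_at P f * u"
    using ord_at_factor[OF t assms(1,2)] by blast
  obtain u' v' where u': "has_value P u' v'" "v' \<noteq> 0" "g = t powi ord_at P g * u'"
    using ord_at_factor[OF t assms(3,4)] by blast
  have "f * g = t powi (ord_at P f + ord_at P g) * (u * u')"
    using uniformizer_factor(1)[OF t] by (subst u(3), subst u'(3)) (simp add: power_int_add algebra_simps)
  from ord_at_eqI[OF t has_value_mult[OF u(1) u'(1)] _ this] show ?thesis using u(2) u'(2) by simp
qed

lemma ord_at_unit: "has_value P f v \<Longrightarrow> v \<noteq> 0 \<Longrightarrow> ord_at P f = 0"
  using uniformizer_exists ord_at_eqI[where n = 0] by fastforce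

lemma ord_at_inverse:
  assumes "f \<in> function_field" "f \<noteq> 0"
  shows "ord_at P (inverse f) = - ord_at P f"
  using ord_at_mult[OF assms function_field_inverse[OF assms(1)]] ord_at_unit[OF has_value_1] assms(2)
  by simp

lemma ord_at_divide:
  assumes "f \<in> function_field" "f \<noteq> 0" "g \<in> function_field" "g \<noteq> 0"
  shows "ord_at P (f / g) = ord_at P f - ord_at P g"
  unfolding divide_inverse
  using assms by (simp add: ord_at_mult ord_at_inverse function_field_inverse)

lemma ord_at_power:
  assumes "f \<in> function_field" "f \<noteq> 0"
  shows "ord_at P (f ^ n) = int n * ord_at P f"
  by (induction n) (use assms ord_at_unit[OF has_value_1] in
      \<open>simp_all add: ord_at_mult function_field_power algebra_simps\<close>)

lemma ord_at_powi:
  assumes "f \<in> function_field" "f \<noteq> 0"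
  shows "ord_at P (f powi n) = n * ord_at P f"
  using assms by (simp add: power_int_def ord_at_power ord_at_inverse function_field_power function_field_inverse)

lemma ord_at_nonneg:
  assumes "has_value P f v" "f \<noteq> 0"
  shows "ord_at P f \<ge> 0" and "v = 0 \<Longrightarrow> ord_at P f > 0"
proof -
  obtain t where t: "uniformizer P t" using uniformizer_exists by blast
  note T = uniformizer_factor[OF t]
  obtain u w where u: "has_value P u w" "w \<noteq> 0" "f = t powi ord_at P f * u"
    using ord_at_factor[OF t has_value_mem[OF assms(1)] assms(2)] by blast
  have "t powi ord_at P f = f * inverse u"
    using has_value_nonzero[OF u(1,2)] by (subst (2) u(3)) simp
  hence e: "has_value P (t powi ord_at P f) (v * inverse w)"
    using has_value_mult[OF assms(1) has_value_inverse[OF u(1,2)]] by simp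
  show n: "ord_at P f \<ge> 0" by (rule powi_unit(1)[OF T(2,1) e])
  show "ord_at P f > 0" if "v = 0"
  proof (rule ccontr)
    assume "\<not> ord_at P f > 0"
    hence "ord_at P f = 0" using n by simp
    thus False using e that by simp
  qed
qed

lemma has_value_of_ord:
  assumes "f \<in> function_field" "f \<noteq> 0" "ord_at P f \<ge> 0"
  shows "\<exists>v. has_value P f v"
proof -
  obtain t where t: "uniformizer P t" using uniformizer_exists by blast
  obtain u w where u: "has_value P u w" "w \<noteq> 0" "f = t powi ord_at P f * u"
    using ord_at_factor[OF t assms(1,2)] by blast
  have "f = t ^ nat (ord_at P f) * u" using assms(3) u(3) by (simp add: power_int_def)
  thus ?thesis
    using has_value_mult[OF has_value_power[OF uniformizer_factor(2)[OF t]] u(1)] by metis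
qed

lemma unit_of_ord_0:
  assumes "f \<in> function_field" "f \<noteq> 0" "ord_at P f = 0"
  shows "has_value P f (value_at P f)" "value_at P f \<noteq> 0"
proof -
  obtain v where v: "has_value P f v" using has_value_of_ord assms by force
  show "has_value P f (value_at P f)" "value_at P f \<noteq> 0"
    using v value_at_eq[OF v] ord_at_nonneg(2)[OF v] assms by auto
qed

lemma ord_at_const: "c \<noteq> 0 \<Longrightarrow> ord_at P (const c) = 0"
  by (rule ord_at_unit[OF has_value_const])

end

section \<open>The automorphism of order four\<close>

lemma uniformizer_affine:
  assumes "a ^ 4 + b ^ 4 = 1"
  shows "uniformizer (proj_point a b 1) (if b = 0 then y_coord else x_coord - const a)"
proof -
  interpret C: chart_point x_coord y_coord a b
    using assms by unfold_locales
  have "uniformizer (proj_point a b 1) C.param"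
    by (rule uniformizerI[OF fermat_affine[OF assms] C.param_nonzero])
      (unfold has_value_affine function_field_affine, rule C.val_param, rule C.function_factor)
  thus ?thesis by (simp add: C.param_def)
qed

lemma has_value_x: "a ^ 4 + b ^ 4 = 1 \<Longrightarrow> has_value (proj_point a b 1) x_coord a"
  and has_value_y: "a ^ 4 + b ^ 4 = 1 \<Longrightarrow> has_value (proj_point a b 1) y_coord b"
  unfolding has_value_affine using aff.val_poly[of a b "[:[:0,1:]:]"] aff.val_poly[of a b "[:0,1:]"]
  by (simp_all add: const_hom)

lemma ord_at_x_diff:
  assumes "a ^ 4 + b ^ 4 = 1"
  shows "ord_at (proj_point a b 1) (x_coord - const a) = (if b = 0 then 4 else 1)"
proof -
  interpret C: chart_point x_coord y_coord a b
    using assms by unfold_locales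
  obtain u v where u: "aff.val a b u v" "v \<noteq> 0" "x_coord - const a = C.param ^ (if b = 0 then 4 else 1) * u"
    using C.x_diff_factor by blast
  have "x_coord - const a = (if b = 0 then y_coord else x_coord - const a) powi (if b = 0 then 4 else 1) * u"
    using u(3) unfolding C.param_def by (cases "b = 0") simp_all
  thus ?thesis
    using ord_at_eqI[OF fermat_affine[OF assms] uniformizer_affine[OF assms]] u(1,2)
    unfolding has_value_affine by blast
qed

lemma has_value_inf_poly: "has_value (proj_point (zeta 8 * a) 1 0) (ev2 x_inf y_inf p) (pev a 0 p)"
  unfolding has_value_inf by (rule inf.val_poly)

lemma x_coord_inf: "x_coord = const (zeta 8) * x_inf / y_inf"
  using aff.y_nonzero by (simp add: x_inf_def y_inf_def)

lemma uniformizer_inf: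
  assumes "a ^ 4 = 1"
  shows "uniformizer (proj_point (zeta 8 * a) 1 0) y_inf"
proof -
  interpret C: chart_point x_inf y_inf a 0
    using assms by unfold_locales simp
  have "uniformizer (proj_point (zeta 8 * a) 1 0) C.param"
    by (rule uniformizerI[OF fermat_inf[OF assms] C.param_nonzero])
      (unfold has_value_inf function_field_inf, rule C.val_param, rule C.function_factor)
  thus ?thesis by (simp add: C.param_def)
qed

lemma ord_at_x_diff_inf:
  assumes "a ^ 4 = 1"
  shows "ord_at (proj_point (zeta 8 * a) 1 0) (x_coord - const c) = -1"
proof (rule ord_at_eqI[OF fermat_inf[OF assms] uniformizer_inf[OF assms]])
  show "has_value (proj_point (zeta 8 * a) 1 0) (const (zeta 8) * x_inf - const c * y_inf) (zeta 8 * a)"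
    using has_value_inf_poly[of a "[:[:0, zeta 8:], [:-c:]:]"] by (simp add: const_hom algebra_simps)
  show "zeta 8 * a \<noteq> 0" using assms by auto
  show "x_coord - const c = y_inf powi - 1 * (const (zeta 8) * x_inf - const c * y_inf)"
    using inf.y_nonzero by (simp add: x_coord_inf field_simps)
qed

lemma zeta_4_4: "zeta 4 ^ 4 = 1"
proof -
  have "zeta 4 ^ 4 = (zeta 4 ^ 2) ^ 2" by (simp flip: power_mult)
  thus ?thesis by (simp add: zeta_4_2)
qed

interpretation tw: chart x_coord "const (zeta 4) * y_coord"
proof
  have "const (zeta 4) ^ 4 = 1"
    unfolding const_hom(7)[symmetric] zeta_4_4 by (rule const_hom(2))
  thus "x_coord ^ 4 + (const (zeta 4) * y_coord) ^ 4 = 1"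
    by (simp add: power_mult_distrib y_coord)
qed (rule aff.transcendental)

text \<open>Both pairs of coordinates satisfy exactly the multiples of the curve equation. Hence
  replacing y by zeta_4 y is well defined and injective on functions.\<close>

lemma tw_eq_0_iff: "ev2 x_coord (const (zeta 4) * y_coord) p = 0 \<longleftrightarrow> ev2 x_coord y_coord p = 0"
proof
  assume "ev2 x_coord (const (zeta 4) * y_coord) p = 0"
  then obtain q where "p = q * curve_poly" using tw.ev2_eq_0 by blast
  thus "ev2 x_coord y_coord p = 0" by (simp add: ev2_curve_poly aff.curve)
next
  assume "ev2 x_coord y_coord p = 0"
  then obtain q where "p = q * curve_poly" using aff.ev2_eq_0 by blast
  thus "ev2 x_coord (const (zeta 4) * y_coord) p = 0" by (simp add: ev2_curve_poly tw.curve)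
qed

text \<open>The field automorphism \<open>(x, y) \<mapsto> (x, \<zeta>\<^sub>4 y)\<close>; its value outside the function field is junk.\<close>

definition tau :: "ambient \<Rightarrow> ambient" where
  "tau f = (SOME g. \<exists>p q. ev2 x_coord y_coord q \<noteq> 0 \<and> f = ev2 x_coord y_coord p / ev2 x_coord y_coord q \<and>
     g = ev2 x_coord (const (zeta 4) * y_coord) p / ev2 x_coord (const (zeta 4) * y_coord) q)"

lemma tau_eq:
  assumes "ev2 x_coord y_coord q \<noteq> 0"
  shows "tau (ev2 x_coord y_coord p / ev2 x_coord y_coord q) =
    ev2 x_coord (const (zeta 4) * y_coord) p / ev2 x_coord (const (zeta 4) * y_coord) q"
  unfolding tau_def
proof (rule some_equality)
  fix g assume "\<exists>p' q'. ev2 x_coord y_coord q' \<noteq> 0 \<and>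
    ev2 x_coord y_coord p / ev2 x_coord y_coord q = ev2 x_coord y_coord p' / ev2 x_coord y_coord q' \<and>
    g = ev2 x_coord (const (zeta 4) * y_coord) p' / ev2 x_coord (const (zeta 4) * y_coord) q'"
  then obtain p' q' where 1: "ev2 x_coord y_coord q' \<noteq> 0"
    "ev2 x_coord y_coord p / ev2 x_coord y_coord q = ev2 x_coord y_coord p' / ev2 x_coord y_coord q'"
    "g = ev2 x_coord (const (zeta 4) * y_coord) p' / ev2 x_coord (const (zeta 4) * y_coord) q'"
    by blast
  have "ev2 x_coord y_coord (p * q' - p' * q) = 0"
    using 1(1,2) assms by (simp add: frac_eq_eq)
  hence "ev2 x_coord (const (zeta 4) * y_coord) (p * q' - p' * q) = 0"
    by (simp only: tw_eq_0_iff)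
  moreover have "ev2 x_coord (const (zeta 4) * y_coord) q \<noteq> 0" "ev2 x_coord (const (zeta 4) * y_coord) q' \<noteq> 0"
    using assms 1(1) by (simp_all add: tw_eq_0_iff)
  ultimately show "g = ev2 x_coord (const (zeta 4) * y_coord) p / ev2 x_coord (const (zeta 4) * y_coord) q"
    unfolding 1(3) by (simp add: frac_eq_eq)
qed (use assms in blast)

lemma function_field_cases:
  assumes "f \<in> function_field"
  obtains p q where "f = ev2 x_coord y_coord p / ev2 x_coord y_coord q" "ev2 x_coord y_coord q \<noteq> 0"
  using assms unfolding function_field_affine aff.field_of_functions_def by blast

lemma tau_poly: "tau (ev2 x_coord y_coord p) = ev2 x_coord (const (zeta 4) * y_coord) p"
  using tau_eq[of 1 p] by simp

lemma tau_add: "f \<in> function_field \<Longrightarrow> g \<in> function_field \<Longrightarrow> tau (f + g) = tau f + tau g"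
  and tau_mult: "f \<in> function_field \<Longrightarrow> g \<in> function_field \<Longrightarrow> tau (f * g) = tau f * tau g"
proof -
  assume fg: "f \<in> function_field" "g \<in> function_field"
  obtain p q where f: "f = ev2 x_coord y_coord p / ev2 x_coord y_coord q" "ev2 x_coord y_coord q \<noteq> 0"
    using fg(1) by (rule function_field_cases)
  obtain p' q' where g: "g = ev2 x_coord y_coord p' / ev2 x_coord y_coord q'" "ev2 x_coord y_coord q' \<noteq> 0"
    using fg(2) by (rule function_field_cases)
  have nz: "ev2 x_coord (const (zeta 4) * y_coord) q \<noteq> 0" "ev2 x_coord (const (zeta 4) * y_coord) q' \<noteq> 0"
    using f(2) g(2) by (simp_all add: tw_eq_0_iff)
  have qq: "ev2 x_coord y_coord (q * q') \<noteq> 0" using f(2) g(2) by simp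
  have "f + g = ev2 x_coord y_coord (p * q' + p' * q) / ev2 x_coord y_coord (q * q')"
    unfolding f(1) g(1) using f(2) g(2) by (simp add: add_frac_eq)
  thus "tau (f + g) = tau f + tau g"
    using nz by (simp only: tau_eq[OF qq]) (simp add: f(1) g(1) tau_eq[OF f(2)] tau_eq[OF g(2)] add_frac_eq)
  have "f * g = ev2 x_coord y_coord (p * p') / ev2 x_coord y_coord (q * q')"
    unfolding f(1) g(1) by simp
  hence "tau (f * g) = ev2 x_coord (const (zeta 4) * y_coord) (p * p') / ev2 x_coord (const (zeta 4) * y_coord) (q * q')"
    by (simp only: tau_eq[OF qq])
  thus "tau (f * g) = tau f * tau g"
    unfolding f(1) g(1) tau_eq[OF f(2)] tau_eq[OF g(2)] by simp
qed

lemma ev2_pcompose: "ev2 x y (pcompose p r) = ev2 x (ev2 x y r) p"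
  by (induction p) (simp_all add: pcompose_pCons)

lemma tau_mem: "f \<in> function_field \<Longrightarrow> tau f \<in> function_field"
proof (elim function_field_cases)
  fix p q assume f: "f = ev2 x_coord y_coord p / ev2 x_coord y_coord q" "ev2 x_coord y_coord q \<noteq> 0"
  have "const (zeta 4) * y_coord = ev2 x_coord y_coord [:0, [:zeta 4:]:]" by simp
  hence "ev2 x_coord (const (zeta 4) * y_coord) p = ev2 x_coord y_coord (pcompose p [:0, [:zeta 4:]:])" for p
    by (simp only: ev2_pcompose)
  thus "tau f \<in> function_field"
    unfolding f(1) tau_eq[OF f(2)] by (metis function_field_divide function_field_poly)
qed

lemma tau_const: "tau (const c) = const c"
  using tau_poly[of "[:[:c:]:]"] by simp

lemma tau_x: "tau x_coord = x_coord"
  using tau_poly[of "[:[:0,1:]:]"] by (simp add: const_hom)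

lemma tau_y: "tau y_coord = const (zeta 4) * y_coord"
  using tau_poly[of "[:0,1:]"] by simp

lemma tau_0: "tau 0 = 0" and tau_1: "tau 1 = 1"
  using tau_const[of 0] tau_const[of 1] by (simp_all add: const_hom)

lemma tau_eq_0_iff: "f \<in> function_field \<Longrightarrow> tau f = 0 \<longleftrightarrow> f = 0"
  by (elim function_field_cases) (simp add: tau_eq tw_eq_0_iff)

lemma tau_uminus: "f \<in> function_field \<Longrightarrow> tau (- f) = - tau f"
  using tau_add[of f "-f"] by (simp add: function_field_uminus tau_0 eq_neg_iff_add_eq_0 add.commute)

lemma tau_diff: "f \<in> function_field \<Longrightarrow> g \<in> function_field \<Longrightarrow> tau (f - g) = tau f - tau g"
  using tau_add[of f "-g"] by (simp add: function_field_uminus tau_uminus)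

lemma tau_inverse: "f \<in> function_field \<Longrightarrow> tau (inverse f) = inverse (tau f)"
  using tau_mult[of f "inverse f"]
  by (cases "f = 0") (simp_all add: function_field_inverse tau_1 tau_0 inverse_unique)

lemma tau_divide: "f \<in> function_field \<Longrightarrow> g \<in> function_field \<Longrightarrow> tau (f / g) = tau f / tau g"
  by (simp add: divide_inverse tau_mult tau_inverse function_field_inverse)

lemma tau_power: "f \<in> function_field \<Longrightarrow> tau (f ^ n) = tau f ^ n"
  by (induction n) (simp_all add: tau_1 tau_mult function_field_power)

lemma tau_powi: "f \<in> function_field \<Longrightarrow> tau (f powi n) = tau f powi n"
  by (simp add: power_int_def tau_power tau_inverse function_field_inverse)

text \<open>A homomorphism that fixes constants and x is determined by the image of y; applied to
  the fourfold iterate of \<open>tau\<close>.\<close>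

lemma ev2_eq_via_hom:
  assumes "\<And>c. t (const c) = const c" "t x_coord = x_coord" "t y_coord = z"
    "\<And>f g. f \<in> function_field \<Longrightarrow> g \<in> function_field \<Longrightarrow> t (f + g) = t f + t g"
    "\<And>f g. f \<in> function_field \<Longrightarrow> g \<in> function_field \<Longrightarrow> t (f * g) = t f * t g"
  shows "t (ev2 x_coord y_coord p) = ev2 x_coord z p"
proof -
  have 0: "t 0 = 0" using assms(1)[of 0] by (simp add: const_hom)
  have e1: "ev1 x_coord c \<in> function_field" for c
    using function_field_poly[of "[:c:]"] by simp
  have 1: "t (ev1 x_coord c) = ev1 x_coord c" for c
    by (induction c) (use e1 in \<open>simp_all add: 0 assms function_field_intros\<close>)
  show ?thesis
    by (induction p) (use e1 function_field_poly in \<open>simp_all add: 0 1 assms function_field_intros\<close>)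
qed

lemma tau_tau_tau_tau: "f \<in> function_field \<Longrightarrow> tau (tau (tau (tau f))) = f"
proof (elim function_field_cases)
  fix p q assume f: "f = ev2 x_coord y_coord p / ev2 x_coord y_coord q" "ev2 x_coord y_coord q \<noteq> 0"
  have c4: "const (zeta 4) * (const (zeta 4) * (const (zeta 4) * (const (zeta 4) * y_coord))) = y_coord"
    using zeta_4_4 unfolding mult.assoc[symmetric] const_hom(4)[symmetric]
    by (simp add: power4_eq_xxxx const_hom(2))
  have *: "tau (tau (tau (tau (ev2 x_coord y_coord p)))) = ev2 x_coord y_coord p" for p
    by (rule ev2_eq_via_hom) (simp_all add: tau_const tau_x tau_y tau_add tau_mult tau_mem
        function_field_const function_field_y function_field_mult c4)
  show "tau (tau (tau (tau f))) = f"
    unfolding f(1) by (simp add: tau_divide tau_mem function_field_poly *)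
qed

section \<open>The rotation of the points and its compatibility with \<open>tau\<close>\<close>

definition rotate :: "point \<Rightarrow> point" where
  "rotate P = (\<lambda>(a, b, c). (a, zeta 4 * b, c)) ` P"

lemma rotate_proj_point: "rotate (proj_point a b c) = proj_point a (zeta 4 * b) c"
  unfolding rotate_def proj_point_def by (auto simp: image_iff algebra_simps)

lemma rotate_fermat: "P \<in> fermat \<Longrightarrow> rotate P \<in> fermat"
proof -
  assume "P \<in> fermat"
  then obtain a b c where P: "P = proj_point a b c" "(a, b, c) \<noteq> (0, 0, 0)" "a ^ 4 + b ^ 4 = c ^ 4"
    unfolding fermat_def by blast
  thus "rotate P \<in> fermat"
    unfolding fermat_def P(1) rotate_proj_point
    by (intro CollectI exI[of _ a] exI[of _ "zeta 4 * b"] exI[of _ c]) (simp add: power_mult_distrib zeta_4_4)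
qed

lemma rotate_4: "P \<in> fermat \<Longrightarrow> rotate (rotate (rotate (rotate P))) = P"
  unfolding fermat_def using zeta_4_4 by (auto simp: rotate_proj_point mult.assoc[symmetric] power4_eq_xxxx)

lemma form_twist: "form d g a (s * b) c = form d (\<lambda>i j. g i j * s ^ j) a b c"
  unfolding form_def by (intro sum.cong refl) (simp add: power_mult_distrib algebra_simps)

lemma tau_restr: "tau (restr d g) = restr d (\<lambda>i j. g i j * zeta 4 ^ j)"
  unfolding restr_eq tau_poly unfolding ev2_form_poly form_twist by (simp add: const_hom)

lemma restr_mem: "restr d g \<in> function_field"
  unfolding restr_eq by (rule function_field_poly)

lemma has_value_tau_aux:
  assumes "P \<in> fermat" "has_value (rotate P) f v"
  shows "has_value P (tau f) v"
proof -
  obtain a b c where P: "P = proj_point a b c"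
    using assms(1) unfolding fermat_def by blast
  obtain d g h where *: "form d h a (zeta 4 * b) c \<noteq> 0" "f = restr d g / restr d h"
    "v = form d g a (zeta 4 * b) c / form d h a (zeta 4 * b) c"
    using assms(2) unfolding P rotate_proj_point has_value_rep by blast
  have "tau f = tau (restr d g) / tau (restr d h)"
    unfolding *(2) by (rule tau_divide[OF restr_mem restr_mem])
  thus ?thesis
    using * unfolding P has_value_rep tau_restr form_twist by blast
qed

text \<open>The reverse implication is the forward one applied three more times, since four steps
  are the identity on points and on functions.\<close>

lemma has_value_tau:
  assumes "P \<in> fermat" "f \<in> function_field"
  shows "has_value P (tau f) v \<longleftrightarrow> has_value (rotate P) f v"
proof
  assume "has_value P (tau f) v"
  hence "has_value (rotate (rotate (rotate (rotate P)))) (tau f) v"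
    using rotate_4[OF assms(1)] by simp
  moreover have P: "rotate P \<in> fermat" "rotate (rotate P) \<in> fermat" "rotate (rotate (rotate P)) \<in> fermat"
    using assms(1) by (simp_all add: rotate_fermat)
  ultimately have "has_value (rotate P) (tau (tau (tau (tau f)))) v"
    using has_value_tau_aux[OF P(1)] has_value_tau_aux[OF P(2)] has_value_tau_aux[OF P(3)] by blast
  thus "has_value (rotate P) f v" by (simp add: tau_tau_tau_tau[OF assms(2)])
qed (rule has_value_tau_aux[OF assms(1)])

lemma value_at_tau: "P \<in> fermat \<Longrightarrow> f \<in> function_field \<Longrightarrow> value_at P (tau f) = value_at (rotate P) f"
  unfolding value_at_def by (rule arg_cong[of _ _ The]) (intro ext has_value_tau)

lemma ord_at_tau:
  assumes P: "P \<in> fermat" and f: "f \<in> function_field" "f \<noteq> 0"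
  shows "ord_at P (tau f) = ord_at (rotate P) f"
proof -
  have rP: "rotate P \<in> fermat" using P by (rule rotate_fermat)
  obtain t where t: "uniformizer (rotate P) t" using uniformizer_exists[OF rP] by blast
  note T = uniformizer_factor[OF rP t]
  have tK: "t \<in> function_field" using has_value_mem[OF rP T(2)] .
  have ut: "uniformizer P (tau t)"
  proof (rule uniformizerI[OF P])
    show "tau t \<noteq> 0" "has_value P (tau t) 0"
      using T(1,2) tK P by (simp_all add: tau_eq_0_iff has_value_tau)
    fix g assume g: "g \<in> function_field" "g \<noteq> 0"
    \<comment> \<open>The inverse of \<open>tau\<close> is its cube.\<close>
    define h where "h = tau (tau (tau g))"
    have h: "h \<in> function_field" "h \<noteq> 0" "tau h = g"
      using g by (simp_all add: h_def tau_mem tau_eq_0_iff tau_tau_tau_tau)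
    obtain n u v where u: "has_value (rotate P) u v" "v \<noteq> 0" "h = t powi n * u"
      using T(3)[OF h(1,2)] by blast
    have uK: "u \<in> function_field" using has_value_mem[OF rP u(1)] .
    have "g = tau t powi n * tau u"
      using h(3) u(3) tK uK by (simp add: tau_mult tau_powi function_field_powi)
    thus "\<exists>n u v. has_value P u v \<and> v \<noteq> 0 \<and> g = tau t powi n * u"
      using u(1,2) has_value_tau_aux[OF P] by blast
  qed
  obtain u v where u: "has_value (rotate P) u v" "v \<noteq> 0" "f = t powi ord_at (rotate P) f * u"
    using ord_at_factor[OF rP t f] by blast
  have "tau f = tau (t powi ord_at (rotate P) f * u)" using u(3) by simp
  also have "\<dots> = tau t powi ord_at (rotate P) f * tau u"
    using tK has_value_mem[OF rP u(1)] by (simp add: tau_mult tau_powi function_field_powi)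
  finally show ?thesis
    using ord_at_eqI[OF P ut has_value_tau_aux[OF P u(1)] u(2)] by blast
qed

section \<open>Tame symbols\<close>

text \<open>
  For functions coming from the quotient of the curve by a subgroup of the rotations, whose orders at
  \<open>P\<close> are divisible by the ramification index \<open>e\<close>, this is the tame symbol at the image of \<open>P\<close>.
\<close>

definition tame :: "int \<Rightarrow> point \<Rightarrow> ambient \<Rightarrow> ambient \<Rightarrow> qbar" where
  "tame e P f g = (-1) powi ((ord_at P f div e) * (ord_at P g div e)) *
     value_at P (f powi (ord_at P g div e) / g powi (ord_at P f div e))"

definition tame_dom :: "int \<Rightarrow> point \<Rightarrow> ambient set" where
  "tame_dom e P = {f \<in> function_field. f \<noteq> 0 \<and> e dvd ord_at P f}"

context
  fixes P :: point
  assumes P: "P \<in> fermat"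
begin

lemma value_at_mult_unit:
  assumes "f \<in> function_field" "f \<noteq> 0" "ord_at P f = 0" "g \<in> function_field" "g \<noteq> 0" "ord_at P g = 0"
  shows "value_at P (f * g) = value_at P f * value_at P g"
  using has_value_mult[OF P unit_of_ord_0(1)[OF P assms(1-3)] unit_of_ord_0(1)[OF P assms(4-6)]]
  by (rule value_at_eq[OF P])

text \<open>Since e divides both orders, the two powers have the same order ord f * ord g / e, and
  their quotient is a unit.\<close>

lemma tame_arg:
  assumes "f \<in> tame_dom e P" "g \<in> tame_dom e P"
  shows "f powi (ord_at P g div e) / g powi (ord_at P f div e) \<in> function_field"
    "f powi (ord_at P g div e) / g powi (ord_at P f div e) \<noteq> 0"
    "ord_at P (f powi (ord_at P g div e) / g powi (ord_at P f div e)) = 0"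
proof -
  have f: "f \<in> function_field" "f \<noteq> 0" "e dvd ord_at P f"
    and g: "g \<in> function_field" "g \<noteq> 0" "e dvd ord_at P g"
    using assms by (auto simp: tame_dom_def)
  show "f powi (ord_at P g div e) / g powi (ord_at P f div e) \<in> function_field"
    by (intro function_field_divide function_field_powi f g)
  show "f powi (ord_at P g div e) / g powi (ord_at P f div e) \<noteq> 0"
    using f g by simp
  have "ord_at P g div e * ord_at P f = ord_at P f div e * ord_at P g"
    using f(3) g(3) by (auto elim!: dvdE)
  thus "ord_at P (f powi (ord_at P g div e) / g powi (ord_at P f div e)) = 0"
    using f g by (simp add: ord_at_divide[OF P] ord_at_powi[OF P] function_field_powi)
qed

lemma tame_mult_left:
  assumes "f \<in> tame_dom e P" "f' \<in> tame_dom e P" "g \<in> tame_dom e P"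
  shows "tame e P (f * f') g = tame e P f g * tame e P f' g"
proof -
  have f: "f \<in> function_field" "f \<noteq> 0" "e dvd ord_at P f"
    and f': "f' \<in> function_field" "f' \<noteq> 0" "e dvd ord_at P f'" and g: "g \<noteq> 0"
    using assms by (auto simp: tame_dom_def)
  define m n k where "m = ord_at P f div e" and "n = ord_at P f' div e" and "k = ord_at P g div e"
  have mn: "ord_at P (f * f') div e = m + n"
    using f f' by (simp add: ord_at_mult[OF P] m_def n_def div_plus_div_distrib_dvd_left)
  have "(f * f') powi k / g powi (m + n) = (f powi k / g powi m) * (f' powi k / g powi n)"
    using g by (simp add: power_int_mult_distrib power_int_add)
  hence "value_at P ((f * f') powi k / g powi (m + n)) =
      value_at P (f powi k / g powi m) * value_at P (f' powi k / g powi n)"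
    unfolding m_def n_def k_def
    by (simp only: value_at_mult_unit[OF tame_arg[OF assms(1,3)] tame_arg[OF assms(2,3)]])
  thus ?thesis
    unfolding tame_def mn m_def[symmetric] n_def[symmetric] k_def[symmetric]
    by (simp add: distrib_right power_int_add)
qed

lemma tame_swap:
  assumes "f \<in> tame_dom e P" "g \<in> tame_dom e P"
  shows "tame e P f g * tame e P g f = 1"
proof -
  have f: "f \<in> function_field" "f \<noteq> 0" "e dvd ord_at P f"
    and g: "g \<in> function_field" "g \<noteq> 0" "e dvd ord_at P g"
    using assms by (auto simp: tame_dom_def)
  define m k where "m = ord_at P f div e" and "k = ord_at P g div e"
  have "value_at P (f powi k / g powi m) * value_at P (g powi m / f powi k) =
      value_at P ((f powi k / g powi m) * (g powi m / f powi k))"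
    unfolding m_def k_def
    by (rule value_at_mult_unit[OF tame_arg[OF assms] tame_arg[OF assms(2,1)], symmetric])
  also have "(f powi k / g powi m) * (g powi m / f powi k) = 1"
    using f g by simp
  also have "value_at P 1 = 1" by (rule value_at_eq[OF P has_value_1[OF P]])
  finally have v: "value_at P (f powi k / g powi m) * value_at P (g powi m / f powi k) = 1" .
  have s: "((-1::qbar) powi (m * k)) * ((-1) powi (m * k)) = 1"
    by (simp add: power_int_mult_distrib[symmetric])
  show ?thesis
    unfolding tame_def m_def[symmetric] k_def[symmetric] using v s
    by (simp only: mult.commute[of k m]) Groebner_Basis.algebra
qed

text \<open>Three cases. If one function vanishes at P, the other takes the value 1. If both orders
  are 0, nothing remains. Otherwise both have a pole of the same order and f / g takes the value -1;
  with m the order divided by e, the value (-1)^m cancels the sign (-1)^(m m), as m m + m is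
  even.\<close>

lemma tame_steinberg:
  assumes "f \<in> tame_dom e P" "g \<in> tame_dom e P" "f + g = 1" "e > 0"
  shows "tame e P f g = 1"
proof -
  have f: "f \<in> function_field" "f \<noteq> 0" "e dvd ord_at P f"
    and g: "g \<in> function_field" "g \<noteq> 0" "e dvd ord_at P g"
    using assms by (auto simp: tame_dom_def)
  have pos: "tame e P f g = 1 \<and> tame e P g f = 1" if h: "f \<in> tame_dom e P" "g \<in> tame_dom e P" "f + g = 1"
    "ord_at P f > 0" for f g
  proof -
    have f: "f \<in> function_field" "f \<noteq> 0" using h by (auto simp: tame_dom_def)
    obtain v where v: "has_value P f v" using has_value_of_ord[OF P f] h(4) by auto
    have "v = 0" using v h(4) ord_at_unit[OF P v] by auto
    hence g1: "has_value P g 1"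
      using has_value_diff[OF P has_value_1[OF P] v] h(3) by (simp add: eq_diff_eq[symmetric] add.commute)
    hence "ord_at P g = 0" by (intro ord_at_unit[OF P]) auto
    moreover have "has_value P (1 / g powi n) (1 / 1 powi n)" for n
      by (intro has_value_divide[OF P] has_value_powi[OF P] has_value_1[OF P] g1) auto
    moreover have "has_value P (g powi n / 1) (1 powi n / 1)" for n
      by (intro has_value_divide[OF P] has_value_powi[OF P] has_value_1[OF P] g1) auto
    ultimately show ?thesis
      unfolding tame_def by (simp add: value_at_eq[OF P])
  qed
  show ?thesis
  proof (cases "ord_at P f > 0 \<or> ord_at P g > 0")
    case True
    thus ?thesis using pos[of f g] pos[of g f] assms by (auto simp: add.commute)
  next
    case False
    show ?thesis
    proof (cases "ord_at P f = 0 \<and> ord_at P g = 0")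
      case True
      thus ?thesis unfolding tame_def using value_at_eq[OF P has_value_1[OF P]] by simp
    next
      case nz: False
      have key: "has_value P (f / g) (-1) \<and> ord_at P f = ord_at P g"
        if h: "f \<in> function_field" "f \<noteq> 0" "g \<in> function_field" "g \<noteq> 0" "f + g = 1" "ord_at P g < 0" for f g
      proof -
        have "ord_at P (inverse g) > 0" using h by (simp add: ord_at_inverse[OF P])
        then obtain v where v: "has_value P (inverse g) v"
          using has_value_of_ord[OF P function_field_inverse[OF h(3)]] h(4) by force
        have "v = 0"
          using v \<open>ord_at P (inverse g) > 0\<close> ord_at_unit[OF P v] by auto
        moreover have "f / g = inverse g - 1" using h(4,5) by (simp add: field_simps eq_diff_eq)
        ultimately have w: "has_value P (f / g) (-1)"
          using has_value_diff[OF P v has_value_1[OF P]] by simp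
        thus ?thesis using ord_at_unit[OF P w] w h by (simp add: ord_at_divide[OF P])
      qed
      have "has_value P (f / g) (-1) \<and> ord_at P f = ord_at P g"
      proof (cases "ord_at P g < 0")
        case True
        thus ?thesis using key f g assms(3) by blast
      next
        case g0: False
        hence "ord_at P f < 0" using nz False by auto
        hence "has_value P (g / f) (-1) \<and> ord_at P g = ord_at P f"
          using key[of g f] f g assms(3) by (simp add: add.commute)
        thus ?thesis using g0 \<open>ord_at P f < 0\<close> by simp
      qed
      hence h: "has_value P (f / g) (-1)" and o: "ord_at P f = ord_at P g" by auto
      define m where "m = ord_at P f div e"
      have "has_value P ((f / g) powi m) ((-1) powi m)"
        by (rule has_value_powi[OF P h]) simp
      hence "value_at P (f powi m / g powi m) = (-1) powi m"
        by (simp add: value_at_eq[OF P] power_int_divide_distrib)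
      moreover have "(-1::qbar) powi (m * m) * (-1) powi m = 1"
      proof -
        have "even (m * m + m)" by simp
        hence "(-1::qbar) powi (m * m + m) = 1" by (simp add: power_int_minus_one_minus)
        thus ?thesis by (simp add: power_int_add)
      qed
      ultimately show ?thesis
        unfolding tame_def o[symmetric] m_def[symmetric] by simp
    qed
  qed
qed

lemma tame_units: "ord_at P f = 0 \<Longrightarrow> ord_at P g = 0 \<Longrightarrow> tame e P f g = 1"
  unfolding tame_def using value_at_eq[OF P has_value_1[OF P]] by simp

lemma tame_tau:
  assumes "f \<in> function_field" "f \<noteq> 0" "g \<in> function_field" "g \<noteq> 0"
  shows "tame e (rotate P) f g = tame e P (tau f) (tau g)"
proof -
  have "tau f powi n / tau g powi m = tau (f powi n / g powi m)" for n m
    using assms by (simp add: tau_divide tau_powi function_field_powi)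
  thus ?thesis
    unfolding tame_def ord_at_tau[OF P assms(1,2)] ord_at_tau[OF P assms(3,4)]
    using assms by (simp add: value_at_tau[OF P] function_field_divide function_field_powi)
qed

end

section \<open>Weil reciprocity\<close>

lemma zeta_4_powi_eq_1: "zeta 4 powi n = 1 \<Longrightarrow> 4 dvd n"
proof -
  assume h: "zeta 4 powi n = 1"
  have "zeta 4 powi n = zeta 4 powi (n mod 4)"
  proof -
    have "zeta 4 powi n = zeta 4 powi (4 * (n div 4) + n mod 4)" by simp
    also have "\<dots> = (zeta 4 powi 4) powi (n div 4) * zeta 4 powi (n mod 4)"
      unfolding power_int_mult[symmetric] by (rule power_int_add) simp
    also have "zeta 4 powi 4 = 1" using zeta_4_4 by (simp add: power_int_def)
    finally show ?thesis by simp
  qed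
  hence m: "zeta 4 powi (n mod 4) = 1" using h by simp
  have z: "zeta 4 \<noteq> 1" "zeta 4 ^ 3 \<noteq> 1" "zeta 4 ^ 2 \<noteq> 1"
  proof -
    show 2: "zeta 4 ^ 2 \<noteq> 1" by (simp add: zeta_4_2)
    thus 1: "zeta 4 \<noteq> 1" by auto
    have "zeta 4 ^ 3 * zeta 4 = 1" using zeta_4_4 by (simp flip: power_Suc2)
    thus "zeta 4 ^ 3 \<noteq> 1" using 1 by auto
  qed
  have "n mod 4 = 0 \<or> n mod 4 = 1 \<or> n mod 4 = 2 \<or> n mod 4 = 3" by presburger
  thus "4 dvd n"
    using m z by (auto simp: power_int_def dvd_eq_mod_eq_0)
qed

section \<open>Fibres of x as orbits of the rotation\<close>

lemma fourth_roots:
  assumes "b ^ 4 = c ^ 4"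
  shows "\<exists>k<4. b = zeta 4 ^ k * c"
proof -
  have "(b - c) * (b + c) * (b - zeta 4 * c) * (b + zeta 4 * c) = 0"
    using assms zeta_4_2 by Groebner_Basis.algebra
  hence "b = c \<or> b = - c \<or> b = zeta 4 * c \<or> b = - (zeta 4 * c)"
    by (auto simp: eq_neg_iff_add_eq_0)
  moreover have "zeta 4 ^ 3 = - zeta 4"
    using zeta_4_2 by (simp add: power3_eq_cube power2_eq_square)
  ultimately have "b = zeta 4 ^ 0 * c \<or> b = zeta 4 ^ 2 * c \<or> b = zeta 4 ^ 1 * c \<or> b = zeta 4 ^ 3 * c"
    by (simp add: zeta_4_2)
  moreover have "(0::nat) < 4" "(1::nat) < 4" "(2::nat) < 4" "(3::nat) < 4" by simp_all
  ultimately show ?thesis by blast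
qed

text \<open>
  The points of the projective line index the fibres of \<open>x\<close>, which are the orbits of the rotation;
  the fibre over a fourth root of unity is a single, totally ramified point.
\<close>

fun base :: "qbar option \<Rightarrow> point" where
  "base None = proj_point (zeta 8) 1 0"
| "base (Some a) = proj_point a (SOME b. a ^ 4 + b ^ 4 = 1) 1"

fun ram :: "qbar option \<Rightarrow> bool" where
  "ram None = False"
| "ram (Some a) = (a ^ 4 = 1)"

lemma base_Some:
  obtains b where "base (Some a) = proj_point a b 1" "a ^ 4 + b ^ 4 = 1"
proof -
  obtain b where "b ^ 4 = 1 - a ^ 4" using nth_root_exists[of 4 "1 - a ^ 4"] by auto
  hence "a ^ 4 + b ^ 4 = 1" by simp
  hence "a ^ 4 + (SOME b. a ^ 4 + b ^ 4 = 1) ^ 4 = 1" by (rule someI)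
  thus ?thesis using that by simp
qed

lemma ram_cases:
  assumes "ram \<beta>"
  obtains a where "\<beta> = Some a" "a ^ 4 = 1" "base \<beta> = proj_point a 0 1"
proof -
  obtain a where a: "\<beta> = Some a" "a ^ 4 = 1" using assms by (cases \<beta>) auto
  obtain b where b: "base (Some a) = proj_point a b 1" "a ^ 4 + b ^ 4 = 1" by (rule base_Some)
  show thesis using that[of a] a b by simp
qed

lemma base_fermat: "base \<beta> \<in> fermat"
proof (cases \<beta>)
  case None
  thus ?thesis using fermat_inf[of 1] by simp
next
  case (Some a)
  obtain b where "base (Some a) = proj_point a b 1" "a ^ 4 + b ^ 4 = 1" by (rule base_Some)
  thus ?thesis unfolding Some by (simp only: fermat_affine)
qed

lemma rotate_funpow_fermat: "P \<in> fermat \<Longrightarrow> (rotate ^^ k) P \<in> fermat"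
  by (induction k) (simp_all add: rotate_fermat)

lemma rotate_funpow_proj: "(rotate ^^ k) (proj_point a b c) = proj_point a (zeta 4 ^ k * b) c"
  by (induction k) (simp_all add: rotate_proj_point mult_ac)

lemma rotate_ram: "ram \<beta> \<Longrightarrow> (rotate ^^ k) (base \<beta>) = base \<beta>"
  by (elim ram_cases) (simp add: rotate_funpow_proj)

lemma fermat_orbit:
  assumes "P \<in> fermat"
  shows "\<exists>\<beta>. \<exists>k<4. P = (rotate ^^ k) (base \<beta>)"
  using assms
proof (cases rule: fermat_cases)
  case (affine a b)
  obtain c where c: "base (Some a) = proj_point a c 1" "a ^ 4 + c ^ 4 = 1" by (rule base_Some)
  have "b ^ 4 = c ^ 4" using affine(1) c(2) by (metis add_left_imp_eq)
  then obtain k where "k < 4" "b = zeta 4 ^ k * c" using fourth_roots by blast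
  hence "P = (rotate ^^ k) (base (Some a))" unfolding c(1) rotate_funpow_proj affine(2) by simp
  thus ?thesis using \<open>k < 4\<close> by blast
next
  case (infinite a)
  obtain k where k: "k < 4" "1 = zeta 4 ^ k * a" using fourth_roots[of 1 a] infinite(1) by auto
  have "P = proj_point (zeta 4 ^ k * (zeta 8 * a)) (zeta 4 ^ k * 1) (zeta 4 ^ k * 0)"
    unfolding infinite(2) by (rule proj_point_scale[symmetric]) simp
  also have "zeta 4 ^ k * (zeta 8 * a) = zeta 8" using k(2) by (metis mult.left_commute mult.right_neutral)
  finally have "P = (rotate ^^ k) (base None)" by (simp add: rotate_funpow_proj)
  thus ?thesis using k(1) by blast
qed

lemma orbit_base_inj: "(rotate ^^ k) (base \<beta>) = (rotate ^^ l) (base \<gamma>) \<Longrightarrow> \<beta> = \<gamma>"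
proof -
  assume h: "(rotate ^^ k) (base \<beta>) = (rotate ^^ l) (base \<gamma>)"
  show "\<beta> = \<gamma>"
    using h by (cases \<beta>; cases \<gamma>) (simp_all add: rotate_funpow_proj proj_point_affine_eq
      proj_point_affine_neq_inf proj_point_affine_neq_inf[symmetric])
qed

lemma orbit_inj:
  assumes "\<not> ram \<beta>"
  shows "inj_on (\<lambda>k. (rotate ^^ k) (base \<beta>)) {..<4}"
proof -
  have pw: "k = l" if "zeta 4 ^ k = zeta 4 ^ l" "k < 4" "l < 4" for k l :: nat
  proof -
    have "zeta 4 powi (int k - int l) = 1"
      using that(1) by (simp add: power_int_diff)
    hence "4 dvd int k - int l" by (rule zeta_4_powi_eq_1)
    thus "k = l" using that(2,3) by presburger
  qed
  show ?thesis
  proof (cases \<beta>)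
    case None
    have "zeta 4 ^ k = zeta 4 ^ l" if "proj_point (zeta 8) (zeta 4 ^ k) 0 = proj_point (zeta 8) (zeta 4 ^ l) 0" for k l
      using proj_point_eq[OF that] by auto
    thus ?thesis unfolding None inj_on_def by (auto simp: rotate_funpow_proj intro: pw)
  next
    case (Some a)
    obtain b where b: "base (Some a) = proj_point a b 1" "a ^ 4 + b ^ 4 = 1" by (rule base_Some)
    have "b \<noteq> 0" using assms b(2) Some by auto
    thus ?thesis
      unfolding Some b(1) inj_on_def rotate_funpow_proj proj_point_affine_eq by (auto intro: pw)
  qed
qed

section \<open>Finiteness of zeros and poles\<close>

definition bad :: "ambient \<Rightarrow> qbar option set" where
  "bad f = {\<beta>. \<exists>k. ord_at ((rotate ^^ k) (base \<beta>)) f \<noteq> 0}"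

text \<open>Where a polynomial function vanishes, its norm vanishes too, and that is a polynomial in
  x with finitely many roots. The fibre at infinity is added without inspection.\<close>

lemma finite_bad_poly:
  assumes "ev2 x_coord y_coord p \<noteq> 0"
  shows "finite (bad (ev2 x_coord y_coord p))"
proof -
  obtain s n where n: "n \<noteq> 0" "ev2 x_coord y_coord p * ev2 x_coord y_coord s = ev1 x_coord n"
    using aff.norm_exists[OF assms] by blast
  have "bad (ev2 x_coord y_coord p) \<subseteq> insert None (Some ` {a. poly n a = 0})"
  proof
    fix \<beta> assume "\<beta> \<in> bad (ev2 x_coord y_coord p)"
    then obtain k where k: "ord_at ((rotate ^^ k) (base \<beta>)) (ev2 x_coord y_coord p) \<noteq> 0"
      unfolding bad_def by blast
    show "\<beta> \<in> insert None (Some ` {a. poly n a = 0})"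
    proof (cases \<beta>)
      case (Some a)
      obtain c where c: "base (Some a) = proj_point a c 1" "a ^ 4 + c ^ 4 = 1" by (rule base_Some)
      define b where "b = zeta 4 ^ k * c"
      have P: "(rotate ^^ k) (base \<beta>) = proj_point a b 1"
        unfolding Some c(1) rotate_funpow_proj b_def ..
      have "b ^ 4 = (zeta 4 ^ 4) ^ k * c ^ 4"
        unfolding b_def power_mult_distrib power_mult[symmetric] by (simp add: mult.commute)
      hence ab: "a ^ 4 + b ^ 4 = 1" using c(2) by (simp add: zeta_4_4)
      have v: "has_value (proj_point a b 1) (ev2 x_coord y_coord q) (pev a b q)" for q
        unfolding has_value_affine by (rule aff.val_poly)
      have "pev a b p = 0"
        using k ord_at_unit[OF fermat_affine[OF ab] v] unfolding P by blast
      hence "has_value (proj_point a b 1) (ev1 x_coord n) 0"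
        using has_value_mult[OF fermat_affine[OF ab] v v, of p s] n(2) by simp
      moreover have "has_value (proj_point a b 1) (ev1 x_coord n) (poly n a)"
        using v[of "[:n:]"] by simp
      ultimately have "poly n a = 0" by (rule has_value_unique[OF fermat_affine[OF ab], symmetric])
      thus ?thesis using Some by simp
    qed simp
  qed
  moreover have "finite {a. poly n a = 0}" using n(1) by (rule poly_roots_finite)
  ultimately show ?thesis using finite_subset by blast
qed

lemma finite_bad:
  assumes "f \<in> function_field" "f \<noteq> 0"
  shows "finite (bad f)"
proof -
  obtain p q where f: "f = ev2 x_coord y_coord p / ev2 x_coord y_coord q" "ev2 x_coord y_coord q \<noteq> 0"
    using assms(1) by (rule function_field_cases)
  have p: "ev2 x_coord y_coord p \<noteq> 0" using assms(2) f(1) by auto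
  have "bad f \<subseteq> bad (ev2 x_coord y_coord p) \<union> bad (ev2 x_coord y_coord q)"
    unfolding bad_def f(1)
    by (auto simp: ord_at_divide[OF rotate_funpow_fermat[OF base_fermat]] p f(2) function_field_poly)
  thus ?thesis using finite_bad_poly[OF p] finite_bad_poly[OF f(2)] finite_subset by blast
qed

text \<open>
  For \<open>l \<in> {1, 2, 4}\<close>, the fixed field of \<open>tau\<^sup>l\<close> is the function field of the quotient of the curve by
  the \<open>l\<close>-th power of the rotation. It has \<open>l\<close> places over an unramified point of the line and one over
  a ramified point, and \<open>local_symbol l \<beta>\<close> is the product of the tame symbols of that quotient over \<open>\<beta>\<close>.
\<close>

definition fixed_field :: "nat \<Rightarrow> ambient set" where
  "fixed_field l = {f \<in> function_field. (tau ^^ l) f = f}"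

definition local_symbol :: "nat \<Rightarrow> qbar option \<Rightarrow> ambient \<Rightarrow> ambient \<Rightarrow> qbar" where
  "local_symbol l \<beta> f g = (if ram \<beta> then tame (4 div int l) (base \<beta>) f g
     else \<Prod>k<l. tame 1 ((rotate ^^ k) (base \<beta>)) f g)"

definition symbol :: "nat \<Rightarrow> ambient \<Rightarrow> ambient \<Rightarrow> qbar" where
  "symbol l f g = Prod_any (\<lambda>\<beta>. local_symbol l \<beta> f g)"

lemma tau_funpow:
  assumes "f \<in> function_field"
  shows "(tau ^^ l) f \<in> function_field" "(tau ^^ l) f = 0 \<longleftrightarrow> f = 0"
    "g \<in> function_field \<Longrightarrow> (tau ^^ l) (f + g) = (tau ^^ l) f + (tau ^^ l) g"
    "g \<in> function_field \<Longrightarrow> (tau ^^ l) (f - g) = (tau ^^ l) f - (tau ^^ l) g"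
    "g \<in> function_field \<Longrightarrow> (tau ^^ l) (f * g) = (tau ^^ l) f * (tau ^^ l) g"
    "g \<in> function_field \<Longrightarrow> (tau ^^ l) (f / g) = (tau ^^ l) f / (tau ^^ l) g"
    "(tau ^^ l) (f powi n) = ((tau ^^ l) f) powi n"
proof -
  have m: "(tau ^^ l) f \<in> function_field" if "f \<in> function_field" for f
    by (induction l) (use that in \<open>simp_all add: tau_mem\<close>)
  show "(tau ^^ l) f \<in> function_field" by (rule m[OF assms])
  have m': "(tau ^^ k) f \<in> function_field" if "f \<in> function_field" for f k
    by (induction k) (use that in \<open>simp_all add: tau_mem\<close>)
  show "(tau ^^ l) f = 0 \<longleftrightarrow> f = 0"
    by (induction l) (use assms m' in \<open>simp_all add: tau_eq_0_iff\<close>)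
  show "(tau ^^ l) (f + g) = (tau ^^ l) f + (tau ^^ l) g" if "g \<in> function_field"
    by (induction l) (use assms that m' in \<open>simp_all add: tau_add\<close>)
  show "(tau ^^ l) (f - g) = (tau ^^ l) f - (tau ^^ l) g" if "g \<in> function_field"
    by (induction l) (use assms that m' in \<open>simp_all add: tau_diff\<close>)
  show "(tau ^^ l) (f * g) = (tau ^^ l) f * (tau ^^ l) g" if "g \<in> function_field"
    by (induction l) (use assms that m' in \<open>simp_all add: tau_mult\<close>)
  show "(tau ^^ l) (f / g) = (tau ^^ l) f / (tau ^^ l) g" if "g \<in> function_field"
    by (induction l) (use assms that m' in \<open>simp_all add: tau_divide\<close>)
  show "(tau ^^ l) (f powi n) = ((tau ^^ l) f) powi n"
    by (induction l) (use assms m' in \<open>simp_all add: tau_powi\<close>)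
qed

lemma tau_funpow_const: "(tau ^^ l) (const c) = const c"
  by (induction l) (simp_all add: tau_const)

text \<open>At a ramified point y is a uniformizer, which \<open>tau ^^ l\<close> multiplies by
  \<open>zeta 4 ^ l\<close>; the rotation fixes the point, hence the values of units. So the ratio
  records the order of h.\<close>

lemma ramified_ratio:
  assumes "ram \<beta>" "h \<in> function_field" "h \<noteq> 0"
  shows "has_value (base \<beta>) ((tau ^^ l) h / h) (zeta 4 powi (int l * ord_at (base \<beta>) h))"
proof -
  obtain a where a: "a ^ 4 = 1" "base \<beta> = proj_point a 0 1"
    using assms(1) by (elim ram_cases)
  define B where "B = base \<beta>"
  have B: "B \<in> fermat" unfolding B_def by (rule base_fermat)
  have y: "uniformizer B y_coord"
    using uniformizer_affine[of a 0] a by (simp add: B_def)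
  obtain u v where u: "has_value B u v" "v \<noteq> 0" "h = y_coord powi ord_at B h * u"
    using ord_at_factor[OF B y assms(2,3)] by blast
  have uK: "u \<in> function_field" by (rule has_value_mem[OF B u(1)])
  have u0: "u \<noteq> 0" by (rule has_value_nonzero[OF B u(1,2)])
  have tu: "has_value B ((tau ^^ l) u) v"
  proof (induction l)
    case (Suc l)
    have "rotate B = B" using rotate_ram[OF assms(1), of 1] by (simp add: B_def)
    thus ?case using Suc has_value_tau_aux[OF B] by simp
  qed (use u in simp)
  have ty: "(tau ^^ l) y_coord = const (zeta 4) ^ l * y_coord"
    by (induction l) (simp_all add: tau_mult tau_power tau_const tau_y function_field_intros)
  have "(tau ^^ l) h = (tau ^^ l) (y_coord powi ord_at B h * u)" using u(3) by simp
  also have "\<dots> = (const (zeta 4) ^ l * y_coord) powi ord_at B h * (tau ^^ l) u"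
    by (simp add: tau_funpow uK ty function_field_powi function_field_y)
  finally have "(tau ^^ l) h / h =
      ((const (zeta 4) ^ l * y_coord) powi ord_at B h * (tau ^^ l) u) / (y_coord powi ord_at B h * u)"
    using u(3) by simp
  also have "\<dots> = (const (zeta 4) ^ l) powi ord_at B h * ((tau ^^ l) u / u)"
    using aff.y_nonzero by (simp add: power_int_mult_distrib)
  also have "(const (zeta 4) ^ l) powi ord_at B h = const (zeta 4 powi (int l * ord_at B h))"
    by (simp add: const_powi power_int_mult const_hom)
  finally have "(tau ^^ l) h / h = const (zeta 4 powi (int l * ord_at B h)) * ((tau ^^ l) u / u)" .
  moreover have "has_value B (const (zeta 4 powi (int l * ord_at B h)) * ((tau ^^ l) u / u))
      (zeta 4 powi (int l * ord_at B h) * (v / v))"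
    by (intro has_value_mult[OF B] has_value_const[OF B] has_value_divide[OF B] tu u)
  ultimately show ?thesis using u(2) by (simp add: B_def)
qed

text \<open>Invariance makes the ratio 1, and \<open>zeta 4\<close> has order four. Thus the integer
  divisions in \<open>tame\<close> are exact on functions of the quotient.\<close>

lemma ramified_dvd:
  assumes "ram \<beta>" "h \<in> fixed_field l" "h \<noteq> 0" "l \<in> {1, 2, 4}"
  shows "4 div int l dvd ord_at (base \<beta>) h"
proof -
  have h: "h \<in> function_field" "(tau ^^ l) h = h" using assms(2) by (auto simp: fixed_field_def)
  have "has_value (base \<beta>) 1 (zeta 4 powi (int l * ord_at (base \<beta>) h))"
    using ramified_ratio[OF assms(1) h(1) assms(3), of l] h(2) assms(3) by simp
  hence "zeta 4 powi (int l * ord_at (base \<beta>) h) = 1"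
    using has_value_unique[OF base_fermat has_value_1[OF base_fermat]] by metis
  hence "4 dvd int l * ord_at (base \<beta>) h" by (rule zeta_4_powi_eq_1)
  thus ?thesis using assms(4) by auto
qed

lemma fixed_field_mem: "f \<in> fixed_field l \<Longrightarrow> f \<in> function_field"
  by (simp add: fixed_field_def)

lemma fixed_field_tame_dom:
  assumes "h \<in> fixed_field l" "h \<noteq> 0" "l \<in> {1, 2, 4}"
  shows "ram \<beta> \<Longrightarrow> h \<in> tame_dom (4 div int l) (base \<beta>)" "h \<in> tame_dom 1 P"
  using ramified_dvd assms by (auto simp: tame_dom_def fixed_field_mem)

lemma local_symbol_eq_1: "\<beta> \<notin> bad f \<Longrightarrow> \<beta> \<notin> bad g \<Longrightarrow> local_symbol l \<beta> f g = 1"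
proof -
  assume "\<beta> \<notin> bad f" "\<beta> \<notin> bad g"
  hence "tame e ((rotate ^^ k) (base \<beta>)) f g = 1" for e k
    by (intro tame_units rotate_funpow_fermat base_fermat) (auto simp: bad_def)
  from this this[of _ 0] show ?thesis by (simp add: local_symbol_def)
qed

lemma finite_local_symbol:
  assumes "f \<in> function_field" "f \<noteq> 0" "g \<in> function_field" "g \<noteq> 0"
  shows "finite {\<beta>. local_symbol l \<beta> f g \<noteq> 1}"
  by (rule finite_subset[OF _ finite_UnI[OF finite_bad[OF assms(1,2)] finite_bad[OF assms(3,4)]]])
    (use local_symbol_eq_1 in blast)

text \<open>Isolates the properties on which the algebraic reduction rests, so that it serves every
  level of the tower. Nonzero arguments stand for the multiplicative group of the field.\<close>

locale steinberg_symbol =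
  fixes M :: "ambient set" and S :: "ambient \<Rightarrow> ambient \<Rightarrow> qbar"
  assumes one: "1 \<in> M"
    and diff: "f \<in> M \<Longrightarrow> g \<in> M \<Longrightarrow> f - g \<in> M"
    and div: "f \<in> M \<Longrightarrow> g \<in> M \<Longrightarrow> f / g \<in> M"
    and mult_left: "f \<in> M \<Longrightarrow> f \<noteq> 0 \<Longrightarrow> f' \<in> M \<Longrightarrow> f' \<noteq> 0 \<Longrightarrow> g \<in> M \<Longrightarrow> g \<noteq> 0 \<Longrightarrow>
      S (f * f') g = S f g * S f' g"
    and swap: "f \<in> M \<Longrightarrow> f \<noteq> 0 \<Longrightarrow> g \<in> M \<Longrightarrow> g \<noteq> 0 \<Longrightarrow> S f g * S g f = 1"
    and steinberg: "f \<in> M \<Longrightarrow> f \<noteq> 0 \<Longrightarrow> g \<in> M \<Longrightarrow> g \<noteq> 0 \<Longrightarrow> f + g = 1 \<Longrightarrow> S f g = 1"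
begin

lemma zero: "0 \<in> M" using diff[OF one one] by simp

lemma uminus: "f \<in> M \<Longrightarrow> - f \<in> M" using diff[OF zero, of f] by simp

lemma add: "f \<in> M \<Longrightarrow> g \<in> M \<Longrightarrow> f + g \<in> M"
  by (subst diff_minus_eq_add[symmetric]) (intro diff uminus)

lemma inv: "f \<in> M \<Longrightarrow> inverse f \<in> M"
  using div[OF one, of f] by (simp add: divide_inverse)

lemma mult: "f \<in> M \<Longrightarrow> g \<in> M \<Longrightarrow> f * g \<in> M"
  using div[of f "inverse g"] inv[of g] by (simp add: divide_inverse)

lemma eq_inverse: "f \<in> M \<Longrightarrow> f \<noteq> 0 \<Longrightarrow> g \<in> M \<Longrightarrow> g \<noteq> 0 \<Longrightarrow> S f g = inverse (S g f)"
  by (rule inverse_unique[OF swap, symmetric])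

lemma nonzero: "f \<in> M \<Longrightarrow> f \<noteq> 0 \<Longrightarrow> g \<in> M \<Longrightarrow> g \<noteq> 0 \<Longrightarrow> S f g \<noteq> 0"
  using swap[of f g] by auto

lemma eq_1_swap: "f \<in> M \<Longrightarrow> f \<noteq> 0 \<Longrightarrow> g \<in> M \<Longrightarrow> g \<noteq> 0 \<Longrightarrow> S g f = 1 \<Longrightarrow> S f g = 1"
  using eq_inverse[of f g] by simp

lemma one_left: "g \<in> M \<Longrightarrow> g \<noteq> 0 \<Longrightarrow> S 1 g = 1"
  using mult_left[of 1 1 g] nonzero[of 1 g] one by simp

lemma one_right: "g \<in> M \<Longrightarrow> g \<noteq> 0 \<Longrightarrow> S g 1 = 1"
  using eq_1_swap[of g 1] one_left one by simp

lemma inv_left: "f \<in> M \<Longrightarrow> f \<noteq> 0 \<Longrightarrow> g \<in> M \<Longrightarrow> g \<noteq> 0 \<Longrightarrow> S (inverse f) g = inverse (S f g)"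
  using mult_left[of f "inverse f" g] inv[of f] one_left[of g] inverse_unique[of "S f g" "S (inverse f) g"]
  by simp

lemma div_left:
  "f \<in> M \<Longrightarrow> f \<noteq> 0 \<Longrightarrow> f' \<in> M \<Longrightarrow> f' \<noteq> 0 \<Longrightarrow> g \<in> M \<Longrightarrow> g \<noteq> 0 \<Longrightarrow> S (f / f') g = S f g / S f' g"
  by (simp add: divide_inverse mult_left inv inv_left)

lemma mult_right:
  "f \<in> M \<Longrightarrow> f \<noteq> 0 \<Longrightarrow> f' \<in> M \<Longrightarrow> f' \<noteq> 0 \<Longrightarrow> g \<in> M \<Longrightarrow> g \<noteq> 0 \<Longrightarrow> S g (f * f') = S g f * S g f'"
  using eq_inverse[of g "f * f'"] eq_inverse[of g f] eq_inverse[of g f'] mult_left[of f f' g]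
  by (simp add: mult)

lemma div_right:
  "f \<in> M \<Longrightarrow> f \<noteq> 0 \<Longrightarrow> f' \<in> M \<Longrightarrow> f' \<noteq> 0 \<Longrightarrow> g \<in> M \<Longrightarrow> g \<noteq> 0 \<Longrightarrow> S g (f / f') = S g f / S g f'"
  using eq_inverse[of g "f / f'"] eq_inverse[of g f] eq_inverse[of g f'] div_left[of f f' g]
  by (simp add: div field_simps)

text \<open>Classical: -f = (1 - f) / (1 - 1/f), and the Steinberg relation applies to the pairs f,
  1 - f and 1/f, 1 - 1/f.\<close>

lemma neg_self:
  assumes f: "f \<in> M" "f \<noteq> 0"
  shows "S f (- f) = 1"
proof (cases "f = 1")
  case True
  thus ?thesis using one_left[of "-1"] uminus[OF one] by simp
next
  case False
  have f1: "1 - f \<in> M" "1 - f \<noteq> 0" using False diff[OF one f(1)] by auto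
  have i1: "1 - inverse f \<in> M" "1 - inverse f \<noteq> 0"
    using False diff[OF one inv[OF f(1)]] f(2) by auto
  have "- f * (1 - inverse f) = 1 - f" using f(2) by (simp add: right_diff_distrib)
  hence e: "- f = (1 - f) / (1 - inverse f)" using i1(2) by (metis nonzero_mult_div_cancel_right)
  have "inverse (S f (1 - inverse f)) = 1"
    using steinberg[of "inverse f" "1 - inverse f"] inv[OF f(1)] f(2) i1 inv_left[OF f i1] by simp
  hence "S f (1 - inverse f) = 1" by simp
  moreover have "S f (1 - f) = 1" using steinberg[OF f f1] by simp
  ultimately show ?thesis
    unfolding e using div_right[OF f1 i1 f] by simp
qed

text \<open>S f (-f) = 1 splits into S f f and S f (-1), and the latter is its own inverse.\<close>

lemma self:
  assumes f: "f \<in> M" "f \<noteq> 0"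
  shows "S f f = S f (-1)"
proof -
  have "S f (- f) = S f f * S f (-1)"
    using mult_right[of f "-1" f] f uminus[OF one] by simp
  hence e: "S f f * S f (-1) = 1" using neg_self[OF f] by simp
  have "S f (-1) * S f (-1) = S f 1"
    using mult_right[of "-1" "-1" f] f uminus[OF one] by simp
  hence "S f (-1) * S f (-1) = 1" using one_right[OF f] by simp
  with e have "S f f * S f (-1) = S f (-1) * S f (-1)" by simp
  moreover have "S f (-1) \<noteq> 0" using e by auto
  ultimately show ?thesis by simp
qed

text \<open>Dividing by d gives f/d + (-g)/d = 1. Expanding the Steinberg relation for this pair
  leaves only S f g, as all symbols involving d or -1 are trivial.\<close>

lemma two_term:
  assumes "f \<in> M" "f \<noteq> 0" "g \<in> M" "g \<noteq> 0" "d \<in> M" "d \<noteq> 0" "f - g = d"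
    "S f d = 1" "S g d = 1" "S d d = 1" "S f (-1) = 1" "S d (-1) = 1"
  shows "S f g = 1"
proof -
  have g': "- g / d \<in> M" "- g / d \<noteq> 0" and f': "f / d \<in> M" "f / d \<noteq> 0"
    using assms(1-6) by (simp_all add: div uminus del: divide_minus_left)
  have "f / d + - g / d = 1" using assms(6,7) by (simp flip: diff_divide_distrib)
  hence "S (f / d) (- g / d) = 1" using f' g' by (intro steinberg)
  moreover have m: "S h (- g / d) = S h (-1) * S h g / S h d" if "h \<in> M" "h \<noteq> 0" for h
    using div_right[of "-g" d h] mult_right[of "-1" g h] that assms(1-6) uminus one
    by (simp del: divide_minus_left)
  moreover have "S (f / d) (- g / d) = S f (- g / d) / S d (- g / d)"
    by (rule div_left) (use assms g' in auto)
  moreover have "S d g = 1" using eq_1_swap assms by blast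
  ultimately show ?thesis using assms by simp
qed

text \<open>Each nonzero element is b or b (y + c) with b, c in L. Symbols with an entry in L are
  trivial, so what remains is the symbol of y + c and y + c'; if c and c' differ, the difference
  lies in L and \<open>two_term\<close> applies, otherwise \<open>self\<close> reduces to -1 in
  L.\<close>

lemma extension:
  assumes L: "L \<subseteq> M" "-1 \<in> L" "\<And>f g. f \<in> L \<Longrightarrow> g \<in> L \<Longrightarrow> f - g \<in> L" "\<And>f g. f \<in> L \<Longrightarrow> g \<in> L \<Longrightarrow> f / g \<in> L"
    and y: "y \<in> M" "\<And>m. m \<in> M \<Longrightarrow> \<exists>a\<in>L. \<exists>b\<in>L. m = a + b * y"
    and triv: "\<And>a m. a \<in> L \<Longrightarrow> a \<noteq> 0 \<Longrightarrow> m \<in> M \<Longrightarrow> m \<noteq> 0 \<Longrightarrow> S m a = 1"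
    and f: "f \<in> M" "f \<noteq> 0" and g: "g \<in> M" "g \<noteq> 0"
  shows "S f g = 1"
proof -
  have triv': "S a m = 1" if "a \<in> L" "a \<noteq> 0" "m \<in> M" "m \<noteq> 0" for a m
    using triv[OF that] eq_1_swap[of a m] that L(1) by blast
  have linear: "S (y + c) (y + c') = 1" if "c \<in> L" "c' \<in> L" "y + c \<noteq> 0" "y + c' \<noteq> 0" for c c'
  proof -
    have M: "y + c \<in> M" "y + c' \<in> M" using that L(1) y(1) by (auto intro: add)
    have m1: "-1 \<in> L" "-1 \<noteq> (0::ambient)" using L(2) by auto
    show ?thesis
    proof (cases "c = c'")
      case True
      have "S (y + c) (y + c) = 1" unfolding self[OF M(1) that(3)] by (rule triv[OF m1 M(1) that(3)])
      thus ?thesis using True by simp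
    next
      case False
      have d: "c - c' \<in> L" "c - c' \<noteq> 0" using that L(3) False by auto
      hence dM: "c - c' \<in> M" using L(1) by auto
      show ?thesis
      proof (rule two_term[OF M(1) that(3) M(2) that(4) dM d(2)])
        show "y + c - (y + c') = c - c'" by simp
        show "S (y + c) (c - c') = 1" by (rule triv[OF d M(1) that(3)])
        show "S (y + c') (c - c') = 1" by (rule triv[OF d M(2) that(4)])
        show "S (c - c') (c - c') = 1" by (rule triv[OF d dM d(2)])
        show "S (y + c) (-1) = 1" by (rule triv[OF m1 M(1) that(3)])
        show "S (c - c') (-1) = 1" by (rule triv[OF m1 dM d(2)])
      qed
    qed
  qed
  have factor: "\<exists>b m. b \<in> L \<and> b \<noteq> 0 \<and> m \<in> M \<and> m \<noteq> 0 \<and> h = b * m \<and> (m = 1 \<or> (\<exists>c\<in>L. m = y + c))"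
    if h: "h \<in> M" "h \<noteq> 0" for h
  proof -
    obtain a b where ab: "a \<in> L" "b \<in> L" "h = a + b * y" using y(2)[OF h(1)] by blast
    show ?thesis
    proof (cases "b = 0")
      case True
      hence "h = a * 1" using ab(3) by simp
      thus ?thesis using ab(1) h(2) one by (intro exI[of _ a] exI[of _ 1]) auto
    next
      case False
      have e: "h = b * (y + a / b)" using ab(3) False by (simp add: distrib_left)
      moreover have "a / b \<in> L" using L(4) ab by blast
      moreover have "y + a / b \<in> M" using add[OF y(1)] L(1) calculation(2) by blast
      moreover have "y + a / b \<noteq> 0" using e h(2) by auto
      ultimately show ?thesis using ab(2) False by (intro exI[of _ b] exI[of _ "y + a / b"]) blast
    qed
  qed
  obtain b m where b: "b \<in> L" "b \<noteq> 0" "m \<in> M" "m \<noteq> 0" "f = b * m" "m = 1 \<or> (\<exists>c\<in>L. m = y + c)"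
    using factor[OF f] by blast
  obtain b' m' where b': "b' \<in> L" "b' \<noteq> 0" "m' \<in> M" "m' \<noteq> 0" "g = b' * m'" "m' = 1 \<or> (\<exists>c\<in>L. m' = y + c)"
    using factor[OF g] by blast
  have bM: "b \<in> M" "b' \<in> M" using b(1) b'(1) L(1) by auto
  have "S m m' = 1"
    using b(6) b'(6) one_left[OF b'(3,4)] one_right[OF b(3,4)] linear b(4) b'(4) by auto
  moreover have "S f g = S b g * S m g"
    unfolding b(5) by (rule mult_left) (use b bM g in auto)
  moreover have "S m g = S m b' * S m m'"
    unfolding b'(5) by (rule mult_right) (use b b' bM in auto)
  ultimately show ?thesis using triv[OF b'(1,2) b(3,4)] triv'[OF b(1,2) g] by simp
qed

end

section \<open>The global symbols on the fixed fields\<close>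

lemma fixed_field_closed:
  shows "const c \<in> fixed_field l"
    "f \<in> fixed_field l \<Longrightarrow> g \<in> fixed_field l \<Longrightarrow> f - g \<in> fixed_field l"
    "f \<in> fixed_field l \<Longrightarrow> g \<in> fixed_field l \<Longrightarrow> f / g \<in> fixed_field l"
    "f \<in> fixed_field l \<Longrightarrow> g \<in> fixed_field l \<Longrightarrow> f * g \<in> fixed_field l"
  by (simp_all add: fixed_field_def tau_funpow tau_funpow_const function_field_intros)

text \<open>The identities hold place by place; that only finitely many local symbols differ from 1
  allows the products to be split.\<close>

lemma symbol_steinberg:
  assumes l: "l \<in> {1, 2, 4}"
  shows "steinberg_symbol (fixed_field l) (symbol l)"
proof
  have e: "4 div int l > 0" using l by auto
  have rf: "(rotate ^^ k) (base \<beta>) \<in> fermat" for k \<beta>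
    by (rule rotate_funpow_fermat[OF base_fermat])
  note dom = fixed_field_tame_dom[OF _ _ l]
  show "1 \<in> fixed_field l" using fixed_field_closed(1)[of 1] by (simp add: const_hom)
  show "f - g \<in> fixed_field l" "f / g \<in> fixed_field l" if "f \<in> fixed_field l" "g \<in> fixed_field l" for f g
    using that by (simp_all add: fixed_field_closed)
  show "symbol l (f * f') g = symbol l f g * symbol l f' g"
    if h: "f \<in> fixed_field l" "f \<noteq> 0" "f' \<in> fixed_field l" "f' \<noteq> 0" "g \<in> fixed_field l" "g \<noteq> 0" for f f' g
  proof -
    have "local_symbol l \<beta> (f * f') g = local_symbol l \<beta> f g * local_symbol l \<beta> f' g" for \<beta>
      unfolding local_symbol_def
      using tame_mult_left[OF base_fermat dom(1)[OF h(1,2)] dom(1)[OF h(3,4)] dom(1)[OF h(5,6)]]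
        tame_mult_left[OF rf dom(2)[OF h(1,2)] dom(2)[OF h(3,4)] dom(2)[OF h(5,6)]]
      by (simp add: prod.distrib)
    thus ?thesis
      unfolding symbol_def using h
      by (simp add: Prod_any.distrib finite_local_symbol fixed_field_mem)
  qed
  show "symbol l f g * symbol l g f = 1"
    if h: "f \<in> fixed_field l" "f \<noteq> 0" "g \<in> fixed_field l" "g \<noteq> 0" for f g
  proof -
    have "local_symbol l \<beta> f g * local_symbol l \<beta> g f = 1" for \<beta>
      unfolding local_symbol_def
      using tame_swap[OF base_fermat dom(1)[OF h(1,2)] dom(1)[OF h(3,4)]]
        tame_swap[OF rf dom(2)[OF h(1,2)] dom(2)[OF h(3,4)]]
      by (simp add: prod.distrib[symmetric])
    thus ?thesis
      unfolding symbol_def using h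
      by (simp add: Prod_any.distrib[symmetric] finite_local_symbol fixed_field_mem)
  qed
  show "symbol l f g = 1"
    if h: "f \<in> fixed_field l" "f \<noteq> 0" "g \<in> fixed_field l" "g \<noteq> 0" and fg: "f + g = 1" for f g
  proof -
    have "local_symbol l \<beta> f g = 1" for \<beta>
      unfolding local_symbol_def
      using tame_steinberg[OF base_fermat dom(1)[OF h(1,2)] dom(1)[OF h(3,4)] fg e]
        tame_steinberg[OF rf dom(2)[OF h(1,2)] dom(2)[OF h(3,4)] fg]
      by (simp add: prod.neutral)
    thus ?thesis unfolding symbol_def by simp
  qed
qed

text \<open>
  The projection formula for the double cover of quotients. At a ramified place the sign
  by which \<open>tau\<^sup>l h / h\<close> differs from 1 is absorbed by the sign in the tame symbol.
\<close>

lemma local_symbol_projection: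
  assumes l: "l \<in> {1, 2}" and a: "a \<in> fixed_field l" "a \<noteq> 0" and h: "h \<in> fixed_field (2 * l)" "h \<noteq> 0"
  shows "local_symbol (2 * l) \<beta> h a = local_symbol l \<beta> (h * (tau ^^ l) h) a"
proof -
  have aK: "a \<in> function_field" "(tau ^^ l) a = a" and hK: "h \<in> function_field"
    using a h by (auto simp: fixed_field_def)
  have tK: "(tau ^^ l) h \<in> function_field" "(tau ^^ l) h \<noteq> 0" using tau_funpow(1,2)[OF hK] h(2) by auto
  show ?thesis
  proof (cases "ram \<beta>")
    case True
    define B where "B = base \<beta>"
    have B: "B \<in> fermat" unfolding B_def by (rule base_fermat)
    \<comment> \<open>The index \<open>e\<close> belongs to the upper quotient; for the lower one it
      is \<open>2 * e\<close>, as the double cover ramifies here.\<close>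
    define e where "e = 4 div (2 * int l)"
    have e: "e > 0" "4 div int l = 2 * e" "int l * e = 2" using l by (auto simp: e_def)
    have de: "4 div int (2 * l) = e" by (simp add: e_def)
    have l2: "2 * l \<in> {1, 2, 4}" "l \<in> {1, 2, 4}" using l by auto
    obtain n where n: "ord_at B h = e * n"
      using ramified_dvd[OF True h l2(1)] unfolding de B_def by (auto elim: dvdE)
    obtain m where m: "ord_at B a = 2 * e * m"
      using ramified_dvd[OF True a l2(2)] unfolding e(2) B_def by (auto elim: dvdE)
    have sgn: "zeta 4 powi (int l * ord_at B h) = (-1) powi n"
    proof -
      have "int l * ord_at B h = 2 * n" unfolding n using e(3) by (simp add: mult.assoc[symmetric])
      hence "zeta 4 powi (int l * ord_at B h) = (zeta 4 powi 2) powi n"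
        by (simp only: power_int_mult)
      also have "zeta 4 powi 2 = -1" using zeta_4_2 by (simp add: power_int_def)
      finally show ?thesis .
    qed
    have ratio: "has_value B ((tau ^^ l) h / h) ((-1) powi n)"
      using ramified_ratio[OF True hK h(2), of l] unfolding B_def[symmetric] sgn .
    have ot: "ord_at B ((tau ^^ l) h) = e * n"
      using ord_at_unit[OF B ratio] n ord_at_divide[OF B tK hK h(2)] by simp
    \<comment> \<open>The argument of the upper symbol; that of the lower symbol differs from it by
      a power of \<open>(tau ^^ l) h / h\<close>, whose value is a sign.\<close>
    define w where "w = h powi (2 * m) / a powi n"
    have w: "w \<in> function_field" "w \<noteq> 0" "ord_at B w = 0"
    proof -
      show "w \<in> function_field" "w \<noteq> 0" using aK hK a(2) h(2) by (auto simp: w_def function_field_intros)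
      show "ord_at B w = 0" using aK(1) hK a(2) h(2)
        by (simp add: w_def ord_at_divide[OF B] ord_at_powi[OF B] function_field_powi n m)
    qed
    have "(h * (tau ^^ l) h) powi m / a powi n = ((tau ^^ l) h / h) powi m * w"
    proof -
      have "h powi (2 * m) = h powi m * h powi m"
        using h(2) by (simp add: power_int_add[symmetric])
      thus ?thesis unfolding w_def using h(2) by (simp add: power_int_mult_distrib power_int_divide_distrib)
    qed
    moreover have "has_value B (((tau ^^ l) h / h) powi m * w) (((-1) powi n) powi m * value_at B w)"
      by (intro has_value_mult[OF B] has_value_powi[OF B] ratio unit_of_ord_0(1)[OF B w]) simp
    ultimately have v: "value_at B ((h * (tau ^^ l) h) powi m / a powi n) = (-1) powi (n * m) * value_at B w"
      by (simp add: value_at_eq[OF B] power_int_mult)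
    have d1: "ord_at B h div e = n" "ord_at B a div e = 2 * m" using e(1) by (simp_all add: n m mult.assoc)
    have d2: "ord_at B (h * (tau ^^ l) h) div (2 * e) = n" "ord_at B a div (2 * e) = m"
      using e(1) h(2) tK by (simp_all add: ord_at_mult[OF B hK] ot n m)
    have s1: "(-1::qbar) powi (n * (2 * m)) = 1"
      by (simp add: power_int_minus_one_minus)
    have s2: "(-1::qbar) powi (n * m) * (-1) powi (n * m) = 1"
      by (simp add: power_int_mult_distrib[symmetric])
    have "tame e B h a = value_at B w"
      unfolding tame_def d1 s1 w_def by simp
    moreover have "tame (2 * e) B (h * (tau ^^ l) h) a = value_at B w"
      unfolding tame_def d2 v using s2 by (simp add: mult.assoc[symmetric])
    ultimately show ?thesis
      using True unfolding local_symbol_def B_def[symmetric] de e(2) by simp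
  next
    case False
    have rf: "(rotate ^^ k) (base \<beta>) \<in> fermat" for k
      by (rule rotate_funpow_fermat[OF base_fermat])
    have shift: "tame 1 ((rotate ^^ k) P) f g = tame 1 P ((tau ^^ k) f) ((tau ^^ k) g)"
      if "P \<in> fermat" "f \<in> function_field" "f \<noteq> 0" "g \<in> function_field" "g \<noteq> 0" for k P f g
      using that
    proof (induction k arbitrary: f g)
      case (Suc k)
      have "tame 1 ((rotate ^^ Suc k) P) f g = tame 1 ((rotate ^^ k) P) (tau f) (tau g)"
        using Suc.prems by (simp add: tame_tau rotate_funpow_fermat)
      also have "\<dots> = tame 1 P ((tau ^^ k) (tau f)) ((tau ^^ k) (tau g))"
        using Suc.prems by (intro Suc.IH) (simp_all add: tau_mem tau_eq_0_iff)
      finally show ?case by (simp add: funpow_swap1)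
    qed simp
    \<comment> \<open>The 2 l upper places come in pairs k, k + l over the l lower ones. The
      rotation by l steps exchanges them, so the second factor of a pair is the symbol of
      \<open>(tau ^^ l) h\<close> at the first place.\<close>
    have "(\<Prod>k<2 * l. tame 1 ((rotate ^^ k) (base \<beta>)) h a) =
        (\<Prod>k<l. tame 1 ((rotate ^^ k) (base \<beta>)) h a) * (\<Prod>k<l. tame 1 ((rotate ^^ (k + l)) (base \<beta>)) h a)"
    proof -
      have "{..<2 * l} = {..<l} \<union> {l..<l + l}" by auto
      moreover have "(\<Prod>k\<in>{l..<l + l}. tame 1 ((rotate ^^ k) (base \<beta>)) h a) =
          (\<Prod>k<l. tame 1 ((rotate ^^ (k + l)) (base \<beta>)) h a)"
        using prod.shift_bounds_nat_ivl[of "\<lambda>k. tame 1 ((rotate ^^ k) (base \<beta>)) h a" 0 l l]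
        by (simp add: atLeast0LessThan)
      ultimately show ?thesis by (simp add: prod.union_disjoint ivl_disj_int)
    qed
    also have "\<dots> = (\<Prod>k<l. tame 1 ((rotate ^^ k) (base \<beta>)) h a * tame 1 ((rotate ^^ (k + l)) (base \<beta>)) h a)"
      by (rule prod.distrib[symmetric])
    also have "\<dots> = (\<Prod>k<l. tame 1 ((rotate ^^ k) (base \<beta>)) (h * (tau ^^ l) h) a)"
    proof (intro prod.cong refl)
      fix k
      have "tame 1 ((rotate ^^ (k + l)) (base \<beta>)) h a = tame 1 ((rotate ^^ l) ((rotate ^^ k) (base \<beta>))) h a"
        by (simp add: add.commute[of k l] funpow_add)
      also have "\<dots> = tame 1 ((rotate ^^ k) (base \<beta>)) ((tau ^^ l) h) a"
        using shift[OF rf hK h(2) aK(1) a(2), of l k] aK(2) by simp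
      finally show "tame 1 ((rotate ^^ k) (base \<beta>)) h a * tame 1 ((rotate ^^ (k + l)) (base \<beta>)) h a =
          tame 1 ((rotate ^^ k) (base \<beta>)) (h * (tau ^^ l) h) a"
        by (simp add: tame_mult_left[OF rf] tame_dom_def hK h(2) aK a(2) tK)
    qed
    finally show ?thesis using False by (simp add: local_symbol_def)
  qed
qed

lemma symbol_projection:
  assumes "l \<in> {1, 2}" "a \<in> fixed_field l" "a \<noteq> 0" "h \<in> fixed_field (2 * l)" "h \<noteq> 0"
  shows "symbol (2 * l) h a = symbol l (h * (tau ^^ l) h) a"
  unfolding symbol_def by (simp add: local_symbol_projection[OF assms])

section \<open>The fields of the tower\<close>

lemma fixed_field_4: "fixed_field 4 = function_field"
proof -
  have "(tau ^^ 4) f = tau (tau (tau (tau f)))" for f by (simp add: eval_nat_numeral)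
  thus ?thesis by (auto simp: fixed_field_def tau_tau_tau_tau)
qed

text \<open>After the norm has cleared the denominator, invariance under y -> zeta_4 y is a linear
  relation between y, y^2, y^3, which linear independence makes trivial.\<close>

lemma fixed_field_1:
  assumes "f \<in> fixed_field 1"
  obtains p q where "f = ev1 x_coord p / ev1 x_coord q" "ev1 x_coord q \<noteq> 0"
proof -
  have f: "f \<in> function_field" "tau f = f" using assms by (auto simp: fixed_field_def)
  obtain p q where pq: "f = ev2 x_coord y_coord p / ev2 x_coord y_coord q" "ev2 x_coord y_coord q \<noteq> 0"
    using f(1) by (rule function_field_cases)
  obtain s n where n: "n \<noteq> 0" "ev2 x_coord y_coord q * ev2 x_coord y_coord s = ev1 x_coord n"
    using aff.norm_exists[OF pq(2)] by blast
  have n0: "ev1 x_coord n \<noteq> 0" using n(1) aff.transcendental by blast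
  have e1K: "ev1 x_coord r \<in> function_field" for r using function_field_poly[of "[:r:]"] by simp
  have t1: "tau (ev1 x_coord r) = ev1 x_coord r" for r using tau_poly[of "[:r:]"] by simp
  obtain a0 a1 a2 a3 where a: "ev2 x_coord y_coord (p * s) = ev2 x_coord y_coord [:a0,a1,a2,a3:]"
    by (rule aff.ev2_reduce[of "p * s"])
  define g where "g = f * ev1 x_coord n"
  have g: "g = ev2 x_coord y_coord [:a0,a1,a2,a3:]"
    unfolding g_def a[symmetric] pq(1) n(2)[symmetric] using pq(2) by simp
  have "tau g = g" using f e1K by (simp add: g_def tau_mult t1)
  moreover have "tau g = ev1 x_coord a0 + ev1 x_coord a1 * (const (zeta 4) * y_coord) +
      ev1 x_coord a2 * (const (zeta 4) * y_coord) ^ 2 + ev1 x_coord a3 * (const (zeta 4) * y_coord) ^ 3"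
    unfolding g tau_poly tw.ev2_cubic ..
  moreover have "const (zeta 4) ^ 2 = -1" using zeta_4_2 by (metis const_hom(2,5,7))
  \<comment> \<open>The factors are zeta_4^k - 1 for k = 1, 2, 3, simplified with zeta_4^2 =
    -1.\<close>
  ultimately have "aff.linear_rel 0 (Polynomial.smult (zeta 4 - 1) a1) (Polynomial.smult (-2) a2)
      (Polynomial.smult (- zeta 4 - 1) a3)"
    unfolding g aff.linear_rel_def aff.ev2_cubic ev1_smult const_hom ev1_simps by Groebner_Basis.algebra
  note z = aff.linear_rel_trivial[OF this]
  have "zeta 4 - 1 \<noteq> 0" "- zeta 4 - 1 \<noteq> 0"
    using zeta_4_2 by (auto simp: eq_neg_iff_add_eq_0[symmetric] diff_eq_eq neg_eq_iff_add_eq_0)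
  hence "a1 = 0" "a2 = 0" "a3 = 0" using z(2-4) by (simp_all add: smult_eq_0_iff)
  hence "g = ev1 x_coord a0" unfolding g by simp
  hence "f = ev1 x_coord a0 / ev1 x_coord n" using n0 by (simp add: g_def field_simps)
  thus thesis using n0 that by blast
qed

text \<open>Split f into its invariant and anti-invariant parts under the involution
  \<open>tau ^^ l\<close>; the second divided by the anti-invariant z is invariant.\<close>

lemma fixed_field_decomp:
  assumes f: "f \<in> fixed_field (2 * l)" and z: "z \<in> fixed_field (2 * l)" "z \<noteq> 0" "(tau ^^ l) z = - z"
  shows "\<exists>a\<in>fixed_field l. \<exists>b\<in>fixed_field l. f = a + b * z"
proof -
  have tt: "(tau ^^ l) ((tau ^^ l) f) = f"
    using f by (simp add: fixed_field_def mult_2 funpow_add)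
  have K: "f \<in> function_field" "z \<in> function_field" "(tau ^^ l) f \<in> function_field"
    using f z tau_funpow(1) by (auto simp: fixed_field_def)
  have 2: "(tau ^^ l) 2 = 2" using tau_funpow_const[of l 2] by (simp add: const_hom)
  have 2: "(tau ^^ l) 2 = 2" "2 \<in> function_field"
    using 2 function_field_const[of 2] by (simp_all add: const_hom)
  define a b where "a = (f + (tau ^^ l) f) / 2" and "b = (f - (tau ^^ l) f) / (2 * z)"
  have "a \<in> fixed_field l"
    unfolding fixed_field_def a_def using K 2 tt by (simp add: tau_funpow function_field_intros add.commute)
  moreover have "b \<in> fixed_field l"
  proof -
    have "(tau ^^ l) b = ((tau ^^ l) f - f) / (2 * (- z))"
      unfolding b_def using K 2 tt z(3) by (simp add: tau_funpow function_field_intros)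
    also have "\<dots> = b" unfolding b_def by (metis minus_diff_eq minus_divide_divide mult_minus_right)
    finally show ?thesis
      unfolding fixed_field_def using K 2 by (simp add: b_def function_field_intros)
  qed
  moreover have "f = a + b * z"
  proof -
    have nz: "(2::ambient) \<noteq> 0" using const_eq_0_iff[of 2] by (simp add: const_hom)
    have "2 * (a + b * z) = (f + (tau ^^ l) f) + (f - (tau ^^ l) f)"
      using nz z(2) by (simp add: a_def b_def distrib_left)
    also have "\<dots> = 2 * f" by simp
    finally have "2 * (a + b * z) = 2 * f" .
    thus ?thesis unfolding mult_left_cancel[OF nz] by (rule sym)
  qed
  ultimately show ?thesis by blast
qed

section \<open>Reciprocity on the projective line\<close>

lemma base_x_diff:
  "ord_at (base \<beta>) (x_coord - const c) = (case \<beta> of None \<Rightarrow> -1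
     | Some a \<Rightarrow> if a = c then (if ram \<beta> then 4 else 1) else 0)"
proof (cases \<beta>)
  case None
  thus ?thesis using ord_at_x_diff_inf[of 1 c] by simp
next
  case (Some a)
  obtain b where b: "base (Some a) = proj_point a b 1" "a ^ 4 + b ^ 4 = 1" by (rule base_Some)
  have r: "ram (Some a) \<longleftrightarrow> b = 0" using b(2) by auto
  show ?thesis
  proof (cases "a = c")
    case True
    thus ?thesis using ord_at_x_diff[OF b(2)] r Some b(1) by simp
  next
    case False
    have "has_value (proj_point a b 1) (x_coord - const c) (a - c)"
      by (intro has_value_diff has_value_x has_value_const fermat_affine b(2))
    hence "ord_at (proj_point a b 1) (x_coord - const c) = 0"
      using False by (intro ord_at_unit[OF fermat_affine[OF b(2)]]) auto
    thus ?thesis using False Some b(1) by simp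
  qed
qed

text \<open>The zero a contributes c and the pole at infinity 1/c. Over a ramified a the order four
  is divided by the index four, so the contribution is the same.\<close>

lemma symbol_1_const_linear:
  assumes "c \<noteq> 0"
  shows "symbol 1 (const c) (x_coord - const a) = 1"
proof -
  have v: "value_at (base \<beta>) (const d) = d" for \<beta> d
    by (rule value_at_eq[OF base_fermat has_value_const[OF base_fermat]])
  have "local_symbol 1 \<beta> (const c) (x_coord - const a) =
      (case \<beta> of None \<Rightarrow> inverse c | Some b \<Rightarrow> if b = a then c else 1)" for \<beta>
  proof -
    have o: "ord_at (base \<beta>) (const c) = 0" by (rule ord_at_const[OF base_fermat assms])
    have "tame e (base \<beta>) (const c) (x_coord - const a) =
        c powi (ord_at (base \<beta>) (x_coord - const a) div e)" for e
      unfolding tame_def o by (simp add: const_powi[symmetric] v)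
    thus ?thesis
      by (cases \<beta>) (auto simp: local_symbol_def base_x_diff power_int_minus simp del: base.simps)
  qed
  hence "symbol 1 (const c) (x_coord - const a) =
      Prod_any (\<lambda>\<beta>. case \<beta> of None \<Rightarrow> inverse c | Some b \<Rightarrow> if b = a then c else 1)"
    by (simp add: symbol_def)
  also have "\<dots> = (\<Prod>\<beta>\<in>{None, Some a}. case \<beta> of None \<Rightarrow> inverse c | Some b \<Rightarrow> if b = a then c else 1)"
    by (rule Prod_any.expand_superset) (auto split: option.splits if_splits)
  also have "\<dots> = 1" using assms by simp
  finally show ?thesis .
qed

lemma symbol_const_const:
  assumes "c \<noteq> 0" "d \<noteq> 0"
  shows "symbol l (const c) (const d) = 1"
proof -
  have "bad (const b) = {}" if "b \<noteq> 0" for b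
    using that ord_at_const[OF rotate_funpow_fermat[OF base_fermat]] by (auto simp: bad_def)
  hence "local_symbol l \<beta> (const c) (const d) = 1" for \<beta>
    using assms by (intro local_symbol_eq_1) auto
  thus ?thesis by (simp add: symbol_def)
qed

lemma const_fixed: "const c \<in> fixed_field l"
  by (rule fixed_field_closed(1))

lemma x_diff_fixed: "x_coord - const c \<in> fixed_field l"
proof -
  have "(tau ^^ l) x_coord = x_coord" by (induction l) (simp_all add: tau_x)
  hence "x_coord \<in> fixed_field l" by (simp add: fixed_field_def function_field_x)
  thus ?thesis by (intro fixed_field_closed)
qed

text \<open>Constants and linear polynomials generate the nonzero rational functions in x
  multiplicatively, so bimultiplicativity leaves symbols of generators. Two distinct linear ones
  differ by a constant, which \<open>two_term\<close> handles.\<close>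

lemma symbol_1_trivial:
  assumes f: "f \<in> fixed_field 1" "f \<noteq> 0" and g: "g \<in> fixed_field 1" "g \<noteq> 0"
  shows "symbol 1 f g = 1"
proof -
  interpret S: steinberg_symbol "fixed_field 1" "symbol 1" by (rule symbol_steinberg) simp
  define Gen where "Gen = {const c | c. c \<noteq> 0} \<union> {x_coord - const c | c. True}"
  have Gen: "h \<in> fixed_field 1" "h \<noteq> 0" if "h \<in> Gen" for h
    using that const_fixed x_diff_fixed aff.x_nonconst by (auto simp: Gen_def)
  have cl: "symbol 1 (const c) h = 1" if "c \<noteq> 0" "h \<in> Gen" for c h
    using that by (auto simp: Gen_def symbol_const_const symbol_1_const_linear[simplified])
  have gens: "symbol 1 h h' = 1" if hh: "h \<in> Gen" "h' \<in> Gen" for h h'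
  proof (cases "\<exists>c. c \<noteq> 0 \<and> (h = const c \<or> h' = const c)")
    case True
    thus ?thesis using cl hh S.eq_1_swap Gen by blast
  next
    case False
    then obtain a b where ab: "h = x_coord - const a" "h' = x_coord - const b"
      using hh by (auto simp: Gen_def)
    have cr: "symbol 1 k (const c) = 1" if "k \<in> Gen" "c \<noteq> 0" for k c
    proof -
      have "const c \<in> Gen" using that(2) by (auto simp: Gen_def)
      thus ?thesis using S.eq_1_swap[OF Gen(1,2)[OF that(1)] Gen(1,2)] cl that by blast
    qed
    have m1: "symbol 1 k (-1) = 1" if "k \<in> Gen" for k
      using cr[OF that, of "-1"] by (simp add: const_hom)
    show ?thesis
    proof (cases "a = b")
      case True
      thus ?thesis using S.self[OF Gen(1,2)[OF hh(1)]] m1[OF hh(1)] ab by simp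
    next
      case False
      have d: "h - h' = const (b - a)" by (simp add: ab const_hom)
      have dG: "const (b - a) \<in> Gen" "b - a \<noteq> 0" using False by (auto simp: Gen_def)
      show ?thesis
        by (rule S.two_term[OF Gen(1,2)[OF hh(1)] Gen(1,2)[OF hh(2)] Gen(1,2)[OF dG(1)] d
              cr[OF hh(1) dG(2)] cr[OF hh(2) dG(2)] cr[OF dG] m1[OF hh(1)] m1[OF dG(1)]])
    qed
  qed
  \<comment> \<open>Induction over products and quotients of generators, applied below to each entry
    of the symbol in turn.\<close>
  have span: "Q f" if f: "f \<in> fixed_field 1" "f \<noteq> 0"
    and Q: "\<And>h. h \<in> Gen \<Longrightarrow> Q h"
      "\<And>h h'. h \<in> fixed_field 1 \<Longrightarrow> h \<noteq> 0 \<Longrightarrow> h' \<in> fixed_field 1 \<Longrightarrow> h' \<noteq> 0 \<Longrightarrow> Q h \<Longrightarrow> Q h' \<Longrightarrow> Q (h * h')"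
      "\<And>h h'. h \<in> fixed_field 1 \<Longrightarrow> h \<noteq> 0 \<Longrightarrow> h' \<in> fixed_field 1 \<Longrightarrow> h' \<noteq> 0 \<Longrightarrow> Q h \<Longrightarrow> Q h' \<Longrightarrow> Q (h / h')"
    for Q f
  proof -
    have poly: "Q (ev1 x_coord p) \<and> ev1 x_coord p \<in> fixed_field 1 \<and> ev1 x_coord p \<noteq> 0"
      if "ev1 x_coord p \<noteq> 0" for p
    proof -
      have "p \<noteq> 0" using that by auto
      then obtain A where A: "p = Polynomial.smult (Polynomial.lead_coeff p) (\<Prod>x\<in>#A. [:-x, 1:])"
        using alg_closed_imp_factorization by blast
      have c: "Polynomial.lead_coeff p \<noteq> 0" using \<open>p \<noteq> 0\<close> by simp
      have "Q (const c * (\<Prod>x\<in>#A. x_coord - const x)) \<and>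
          const c * (\<Prod>x\<in>#A. x_coord - const x) \<in> fixed_field 1 \<and>
          const c * (\<Prod>x\<in>#A. x_coord - const x) \<noteq> 0" if "c \<noteq> 0" for c
      proof (induction A)
        case empty
        have "const c \<in> Gen" using that by (auto simp: Gen_def)
        thus ?case using Q(1) Gen that by simp
      next
        case (add x A)
        have x: "x_coord - const x \<in> Gen" by (auto simp: Gen_def)
        have e: "const c * (\<Prod>x\<in>#add_mset x A. x_coord - const x) =
            (x_coord - const x) * (const c * (\<Prod>x\<in>#A. x_coord - const x))"
          by (simp add: mult_ac)
        show ?case
          unfolding e using Q(2)[OF Gen[OF x]] Q(1)[OF x] add Gen[OF x] by (simp add: fixed_field_closed(4))
      qed
      moreover have "ev1 x_coord (\<Prod>x\<in>#A. [:-x, 1:]) = (\<Prod>x\<in>#A. x_coord - const x)"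
        by (induction A) (simp_all add: const_hom algebra_simps)
      hence "ev1 x_coord p = const (Polynomial.lead_coeff p) * (\<Prod>x\<in>#A. x_coord - const x)"
        by (subst A) simp
      ultimately show ?thesis using c by metis
    qed
    obtain p q where pq: "f = ev1 x_coord p / ev1 x_coord q" "ev1 x_coord q \<noteq> 0"
      using f(1) by (rule fixed_field_1)
    have "ev1 x_coord p \<noteq> 0" using f(2) pq(1) by auto
    thus ?thesis unfolding pq(1) using poly[of p] poly[OF pq(2)] Q(3) by blast
  qed
  have step: "symbol 1 f h = 1" if h: "h \<in> Gen" for h
    by (rule span[OF f, of "\<lambda>k. symbol 1 k h = 1"])
      (simp_all add: gens[OF _ h] S.mult_left S.div_left Gen[OF h] del: One_nat_def)
  show ?thesis
    by (rule span[OF g, of "\<lambda>k. symbol 1 f k = 1"])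
      (simp_all add: step S.mult_right S.div_right f del: One_nat_def)
qed

text \<open>The projection formula replaces m by its norm \<open>m * (tau ^^ l) m\<close>, which
  lies in the smaller field, where the symbol is trivial. This supplies the hypothesis of
  \<open>extension\<close> on symbols with one entry in the smaller field.\<close>

lemma symbol_step:
  assumes l: "l \<in> {1, 2}" and z: "z \<in> fixed_field (2 * l)" "z \<noteq> 0" "(tau ^^ l) z = - z"
    and triv: "\<And>f g. f \<in> fixed_field l \<Longrightarrow> f \<noteq> 0 \<Longrightarrow> g \<in> fixed_field l \<Longrightarrow> g \<noteq> 0 \<Longrightarrow> symbol l f g = 1"
    and f: "f \<in> fixed_field (2 * l)" "f \<noteq> 0" and g: "g \<in> fixed_field (2 * l)" "g \<noteq> 0"
  shows "symbol (2 * l) f g = 1"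
proof -
  interpret S: steinberg_symbol "fixed_field (2 * l)" "symbol (2 * l)"
    by (rule symbol_steinberg) (use l in auto)
  have sub: "fixed_field l \<subseteq> fixed_field (2 * l)"
    by (auto simp: fixed_field_def mult_2 funpow_add)
  show ?thesis
  proof (rule S.extension[of "fixed_field l" z, OF sub _ _ _ z(1) _ _ f g])
    show "-1 \<in> fixed_field l" using const_fixed[of "-1" l] by (simp add: const_hom)
    show "h - k \<in> fixed_field l" "h / k \<in> fixed_field l" if "h \<in> fixed_field l" "k \<in> fixed_field l" for h k
      using that by (simp_all add: fixed_field_closed)
    show "\<exists>a\<in>fixed_field l. \<exists>b\<in>fixed_field l. m = a + b * z" if "m \<in> fixed_field (2 * l)" for m
      by (rule fixed_field_decomp[OF that z])
    show "symbol (2 * l) m a = 1" if "a \<in> fixed_field l" "a \<noteq> 0" "m \<in> fixed_field (2 * l)" "m \<noteq> 0" for a m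
    proof -
      have m: "m \<in> function_field" "(tau ^^ l) ((tau ^^ l) m) = m"
        using that(3) by (simp_all add: fixed_field_def mult_2 funpow_add)
      have "m * (tau ^^ l) m \<in> fixed_field l"
        using m tau_funpow(1)[OF m(1)] by (simp add: fixed_field_def tau_funpow function_field_mult mult.commute)
      moreover have "m * (tau ^^ l) m \<noteq> 0" using that(4) tau_funpow(2)[OF m(1)] by simp
      ultimately show ?thesis
        unfolding symbol_projection[OF l that] using triv that(1,2) by blast
    qed
  qed
qed

text \<open>Because zeta_4^2 = -1, y^2 is anti-invariant under \<open>tau\<close> and y under its
  square; they generate the two quadratic steps.\<close>

lemma symbol_4_trivial:
  assumes f: "f \<in> function_field" "f \<noteq> 0" and g: "g \<in> function_field" "g \<noteq> 0"
  shows "symbol 4 f g = 1"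
proof -
  have ty: "(tau ^^ 2) y_coord = - y_coord"
  proof -
    have "(tau ^^ 2) y_coord = const (zeta 4) * (const (zeta 4) * y_coord)"
      by (simp add: eval_nat_numeral tau_y tau_mult tau_const function_field_const function_field_y)
    also have "\<dots> = const (zeta 4 ^ 2) * y_coord" by (simp add: const_hom power2_eq_square)
    finally show ?thesis by (simp add: zeta_4_2 const_hom)
  qed
  have ty2: "tau (y_coord ^ 2) = - (y_coord ^ 2)"
  proof -
    have "tau (y_coord ^ 2) = const (zeta 4 ^ 2) * y_coord ^ 2"
      by (simp add: tau_power function_field_y tau_y power_mult_distrib const_hom)
    thus ?thesis by (simp add: zeta_4_2 const_hom)
  qed
  have "y_coord ^ 2 \<in> fixed_field 2"
    using ty2 by (simp add: fixed_field_def function_field_intros eval_nat_numeral tau_uminus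
        function_field_mult[OF function_field_y function_field_y])
  hence s2: "symbol 2 f g = 1" if "f \<in> fixed_field 2" "f \<noteq> 0" "g \<in> fixed_field 2" "g \<noteq> 0" for f g
    using symbol_step[of 1 "y_coord ^ 2" f g] symbol_1_trivial that ty2 aff.y_nonzero by simp
  show ?thesis
    using symbol_step[of 2 y_coord f g] s2 assms ty aff.y_nonzero function_field_y
    by (simp add: fixed_field_4)
qed

section \<open>Reciprocity on the curve and its consequences\<close>

definition support :: "ambient \<Rightarrow> point set" where
  "support f = {P \<in> fermat. ord_at P f \<noteq> 0}"

lemma finite_support:
  assumes "f \<in> function_field" "f \<noteq> 0"
  shows "finite (support f)"
proof -
  have "support f \<subseteq> (\<lambda>(\<beta>, k). (rotate ^^ k) (base \<beta>)) ` (bad f \<times> {..<4})"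
  proof
    fix P assume P: "P \<in> support f"
    then obtain \<beta> k where k: "k < 4" "P = (rotate ^^ k) (base \<beta>)"
      using fermat_orbit[of P] by (auto simp: support_def)
    hence "\<beta> \<in> bad f" using P by (auto simp: support_def bad_def)
    thus "P \<in> (\<lambda>(\<beta>, k). (rotate ^^ k) (base \<beta>)) ` (bad f \<times> {..<4})" using k by force
  qed
  thus ?thesis using finite_bad[OF assms] finite_subset by blast
qed

text \<open>Only a regrouping of \<open>symbol_4_trivial\<close>: the points are collected into
  rotation orbits, and an orbit of four points or a single ramified point yields exactly one factor
  \<open>local_symbol 4\<close>.\<close>

theorem weil_reciprocity:
  assumes f: "f \<in> function_field" "f \<noteq> 0" and g: "g \<in> function_field" "g \<noteq> 0"
    and A: "finite A" "A \<subseteq> fermat" "support f \<subseteq> A" "support g \<subseteq> A"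
  shows "(\<Prod>P\<in>A. tame 1 P f g) = 1"
proof -
  define B where "B = bad f \<union> bad g \<union> {\<beta>. \<exists>k<4. (rotate ^^ k) (base \<beta>) \<in> A}"
  define orb where "orb \<beta> = (\<lambda>k. (rotate ^^ k) (base \<beta>)) ` {..<4}" for \<beta>
  \<comment> \<open>A point determines its fibre, so only finitely many fibres meet
    \<open>A\<close>.\<close>
  have "{\<beta>. \<exists>k<4. (rotate ^^ k) (base \<beta>) \<in> A} \<subseteq> (\<lambda>P. SOME \<beta>. \<exists>k<4. P = (rotate ^^ k) (base \<beta>)) ` A"
  proof
    fix \<beta> assume "\<beta> \<in> {\<beta>. \<exists>k<4. (rotate ^^ k) (base \<beta>) \<in> A}"
    then obtain k where k: "k < 4" "(rotate ^^ k) (base \<beta>) \<in> A" by blast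
    have "(SOME \<gamma>. \<exists>l<4. (rotate ^^ k) (base \<beta>) = (rotate ^^ l) (base \<gamma>)) = \<beta>"
      by (rule some_equality) (use k(1) orbit_base_inj in blast)+
    thus "\<beta> \<in> (\<lambda>P. SOME \<beta>. \<exists>k<4. P = (rotate ^^ k) (base \<beta>)) ` A"
      using k(2) by (intro image_eqI[of _ _ "(rotate ^^ k) (base \<beta>)"]) simp_all
  qed
  hence finB: "finite B"
    unfolding B_def using A(1) finite_bad[OF f] finite_bad[OF g] finite_subset by blast
  have one: "tame 1 P f g = 1" if "P \<in> fermat" "P \<notin> A" for P
    using that A(3,4) by (intro tame_units) (auto simp: support_def)
  have AU: "A \<subseteq> (\<Union>\<beta>\<in>B. orb \<beta>)"
  proof
    fix P assume P: "P \<in> A"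
    then obtain \<beta> k where k: "k < 4" "P = (rotate ^^ k) (base \<beta>)"
      using fermat_orbit[of P] A(2) by blast
    hence "\<beta> \<in> B" using P by (auto simp: B_def)
    thus "P \<in> (\<Union>\<beta>\<in>B. orb \<beta>)" using k by (auto simp: orb_def)
  qed
  have orbF: "orb \<beta> \<subseteq> fermat" for \<beta>
    using rotate_funpow_fermat[OF base_fermat] by (auto simp: orb_def)
  have "(\<Prod>P\<in>A. tame 1 P f g) = (\<Prod>P\<in>(\<Union>\<beta>\<in>B. orb \<beta>). tame 1 P f g)"
  proof (rule prod.mono_neutral_left[OF _ AU])
    show "finite (\<Union>\<beta>\<in>B. orb \<beta>)" using finB by (simp add: orb_def)
    show "\<forall>P\<in>(\<Union>\<beta>\<in>B. orb \<beta>) - A. tame 1 P f g = 1" using orbF one by blast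
  qed
  also have "\<dots> = (\<Prod>\<beta>\<in>B. \<Prod>P\<in>orb \<beta>. tame 1 P f g)"
  proof (rule prod.UNION_disjoint[OF finB])
    show "\<forall>\<beta>\<in>B. finite (orb \<beta>)" by (simp add: orb_def)
    show "\<forall>\<beta>\<in>B. \<forall>\<gamma>\<in>B. \<beta> \<noteq> \<gamma> \<longrightarrow> orb \<beta> \<inter> orb \<gamma> = {}"
      using orbit_base_inj by (auto simp: orb_def)
  qed
  also have "\<dots> = (\<Prod>\<beta>\<in>B. local_symbol 4 \<beta> f g)"
  proof (intro prod.cong refl)
    fix \<beta>
    show "(\<Prod>P\<in>orb \<beta>. tame 1 P f g) = local_symbol 4 \<beta> f g"
    proof (cases "ram \<beta>")
      case True
      hence "orb \<beta> = {base \<beta>}" by (auto simp: orb_def rotate_ram image_constant_conv lessThan_empty_iff)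
      thus ?thesis using True by (simp add: local_symbol_def)
    next
      case False
      thus ?thesis unfolding orb_def local_symbol_def by (simp add: prod.reindex[OF orbit_inj])
    qed
  qed
  also have "\<dots> = symbol 4 f g"
    unfolding symbol_def
    by (rule Prod_any.expand_superset[OF finB, symmetric]) (use local_symbol_eq_1 in \<open>auto simp: B_def\<close>)
  finally show ?thesis using symbol_4_trivial[OF f g] by simp
qed

text \<open>The symbols of the constant 2 with f multiply to 2 raised to the degree of the divisor
  of f, and in characteristic zero only the power 0 of 2 is 1.\<close>

lemma degree_zero:
  assumes f: "f \<in> function_field" "f \<noteq> 0" and A: "finite A" "A \<subseteq> fermat" "support f \<subseteq> A"
  shows "(\<Sum>P\<in>A. ord_at P f) = 0"
proof -
  have two: "const 2 \<noteq> 0" "support (const 2) = {}"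
    by (auto simp: support_def ord_at_const)
  have "tame 1 P (const 2) f = 2 powi ord_at P f" if "P \<in> fermat" for P
    unfolding tame_def using that
    by (simp add: ord_at_const const_powi[symmetric] value_at_eq[OF that has_value_const[OF that]])
  hence "(\<Prod>P\<in>A. tame 1 P (const 2) f) = (\<Prod>P\<in>A. (2::qbar) powi ord_at P f)"
    using A(2) by (intro prod.cong) auto
  also have "\<dots> = 2 powi (\<Sum>P\<in>A. ord_at P f)"
    using A(1) by (induction A rule: finite_induct) (simp_all add: power_int_add)
  finally have "(2::qbar) powi (\<Sum>P\<in>A. ord_at P f) = 1"
    using weil_reciprocity[OF function_field_const two(1) f A(1,2)] two(2) A(3) by simp
  moreover have "n = 0" if "(2::qbar) powi n = 1" for n
  proof -
    have *: "k = 0" if "(2::qbar) ^ k = 1" for k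
    proof -
      have "of_nat (2 ^ k) = (of_nat 1 :: qbar)" using that by simp
      hence "2 ^ k = (1::nat)" by (simp only: of_nat_eq_iff)
      thus "k = 0" by simp
    qed
    show "n = 0"
    proof (cases "n \<ge> 0")
      case True
      thus ?thesis using that *[of "nat n"] by (simp add: power_int_def)
    next
      case False
      have "(2::qbar) powi (- n) = 1" using that by (simp add: power_int_minus)
      hence "(2::qbar) ^ nat (- n) = 1" using False by (simp add: power_int_def)
      thus ?thesis using *[of "nat (- n)"] False by simp
    qed
  qed
  ultimately show ?thesis by blast
qed

text \<open>Subtracting the value at one point would leave, if not 0, a function without poles but
  with a zero, whose divisor has positive degree.\<close>

lemma constant_if_no_zeros:
  assumes f: "f \<in> function_field" "f \<noteq> 0" "\<And>P. P \<in> fermat \<Longrightarrow> ord_at P f = 0"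
  shows "\<exists>c. c \<noteq> 0 \<and> f = const c"
proof -
  define P where "P = base None"
  have P: "P \<in> fermat" unfolding P_def by (rule base_fermat)
  define c where "c = value_at P f"
  have v: "has_value P f c" "c \<noteq> 0" unfolding c_def using unit_of_ord_0[OF P f(1,2) f(3)[OF P]] by auto
  have "f - const c = 0"
  proof (rule ccontr)
    assume nz: "f - const c \<noteq> 0"
    have gK: "f - const c \<in> function_field" using f(1) by (intro function_field_intros)
    have ge: "ord_at Q (f - const c) \<ge> 0" if Q: "Q \<in> fermat" for Q
      using has_value_diff[OF Q unit_of_ord_0(1)[OF Q f(1,2) f(3)[OF Q]] has_value_const[OF Q]]
        ord_at_nonneg(1)[OF Q _ nz] by blast
    have "has_value P (f - const c) (c - c)"
      by (rule has_value_diff[OF P v(1) has_value_const[OF P]])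
    hence gt: "ord_at P (f - const c) > 0" using ord_at_nonneg(2)[OF P _ nz] by simp
    have fin: "finite (support (f - const c))" by (rule finite_support[OF gK nz])
    have PS: "P \<in> support (f - const c)" using P gt by (simp add: support_def)
    have "(\<Sum>Q\<in>support (f - const c). ord_at Q (f - const c)) > 0"
    proof (rule sum_pos2[OF fin PS])
      show "ord_at P (f - const c) > 0" by (rule gt)
      show "ord_at Q (f - const c) \<ge> 0" if "Q \<in> support (f - const c)" for Q
        using ge that by (simp add: support_def)
    qed
    moreover have "(\<Sum>Q\<in>support (f - const c). ord_at Q (f - const c)) = 0"
      by (rule degree_zero[OF gK nz fin]) (auto simp: support_def)
    ultimately show False by simp
  qed
  thus ?thesis using v(2) by auto
qed

section \<open>Principal divisors and the Weil pairing\<close>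

lemma has_divisor_keys:
  assumes "has_divisor f D"
  shows "Poly_Mapping.keys D = support f" "Poly_Mapping.keys D \<subseteq> fermat"
  using assms by (auto simp: has_divisor_def support_def in_keys_iff subset_iff)

lemma has_divisor_mult:
  assumes "has_divisor f D" "has_divisor g E"
  shows "has_divisor (f * g) (D + E)"
  using assms Poly_Mapping.keys_add[of D E]
  by (auto simp: has_divisor_def lookup_add ord_at_mult function_field_mult)

lemma has_divisor_divide:
  assumes "has_divisor f D" "has_divisor g E"
  shows "has_divisor (f / g) (D - E)"
  using assms keys_diff[of D E]
  by (auto simp: has_divisor_def lookup_minus ord_at_divide function_field_divide)

lemma has_divisor_power:
  assumes "has_divisor f D"
  shows "has_divisor (f ^ n) (frag_cmul (int n) D)"
  using assms keys_cmul[of "int n" D]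
  by (auto simp: has_divisor_def ord_at_power function_field_power)

lemma has_divisor_one: "has_divisor 1 0"
  by (auto simp: has_divisor_def function_field_1 ord_at_unit[OF _ has_value_1])

lemma has_divisor_unique:
  assumes "has_divisor f D" "has_divisor g D"
  shows "\<exists>c. c \<noteq> 0 \<and> f = const c * g"
proof -
  have h: "has_divisor (f / g) 0" using has_divisor_divide[OF assms] by simp
  have "\<exists>c. c \<noteq> 0 \<and> f / g = const c"
    by (rule constant_if_no_zeros) (use h in \<open>auto simp: has_divisor_def\<close>)
  moreover have "g \<noteq> 0" using assms(2) by (simp add: has_divisor_def)
  ultimately show ?thesis by (auto simp: field_simps)
qed

lemma principal_add: "D \<in> principal \<Longrightarrow> E \<in> principal \<Longrightarrow> D + E \<in> principal"
  unfolding principal_def using has_divisor_mult by blast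

lemma principal_diff: "D \<in> principal \<Longrightarrow> E \<in> principal \<Longrightarrow> D - E \<in> principal"
  unfolding principal_def using has_divisor_divide by blast

lemma principal_zero: "0 \<in> principal"
  unfolding principal_def using has_divisor_one by blast

lemma Div0_mult: "x \<otimes>\<^bsub>Div0\<^esub> y = x + y"
  by (simp add: Div0_def free_Abelian_group_def)

lemma Div0_iff: "D \<in> carrier Div0 \<longleftrightarrow> Poly_Mapping.keys D \<subseteq> fermat \<and> degree_div D = 0"
  by (simp add: Div0_def)

lemma jac_class_eq: "jac_class D = {N + D | N. N \<in> principal}"
  unfolding jac_class_def r_coset_def Div0_mult by auto

lemma jac_class_eq_imp: "jac_class D = jac_class E \<Longrightarrow> D - E \<in> principal"
proof -
  assume h: "jac_class D = jac_class E"
  have "0 + D \<in> jac_class D" unfolding jac_class_eq using principal_zero by blast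
  then obtain N where "D = N + E" "N \<in> principal" unfolding h unfolding jac_class_eq by auto
  thus "D - E \<in> principal" by simp
qed

lemma jac_class_principal: "D \<in> principal \<Longrightarrow> jac_class D = principal"
proof -
  assume D: "D \<in> principal"
  have "N \<in> jac_class D" if "N \<in> principal" for N
    unfolding jac_class_eq using principal_diff[OF that D] by (intro CollectI exI[of _ "N - D"]) simp
  thus ?thesis unfolding jac_class_eq using D principal_add by auto
qed

lemma jac_class_mult: "jac_class D <#>\<^bsub>Div0\<^esub> jac_class E = jac_class (D + E)"
proof -
  have "N + (D + E) \<in> jac_class D <#>\<^bsub>Div0\<^esub> jac_class E" if "N \<in> principal" for N
  proof -
    have "N + (D + E) = (N + D) + (0 + E)" by simp
    thus ?thesis unfolding set_mult_def Div0_mult jac_class_eq using that principal_zero by blast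
  qed
  moreover have "(N + D) + (N' + E) \<in> jac_class (D + E)" if "N \<in> principal" "N' \<in> principal" for N N'
  proof -
    have "(N + D) + (N' + E) = (N + N') + (D + E)" by simp
    thus ?thesis unfolding jac_class_eq using principal_add[OF that] by blast
  qed
  ultimately show ?thesis
    unfolding set_mult_def Div0_mult by (auto simp: jac_class_eq)
qed

lemma jac_class_torsion:
  assumes "D \<in> carrier Div0" "frag_cmul 4 D \<in> principal"
  shows "jac_class D \<in> Jac_torsion 4"
proof -
  have m: "\<alpha> \<otimes>\<^bsub>Jac\<^esub> \<beta> = \<alpha> <#>\<^bsub>Div0\<^esub> \<beta>" for \<alpha> \<beta> by (simp add: Jac_def FactGroup_def)
  have o: "\<one>\<^bsub>Jac\<^esub> = jac_class 0"
    unfolding jac_class_principal[OF principal_zero] by (simp add: Jac_def FactGroup_def)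
  have "jac_class D [^]\<^bsub>Jac\<^esub> n = jac_class (frag_cmul (int n) D)" for n :: nat
    by (induction n) (simp_all add: nat_pow_def o m jac_class_mult frag_cmul_distrib add.commute)
  hence "jac_class D [^]\<^bsub>Jac\<^esub> (4::nat) = \<one>\<^bsub>Jac\<^esub>"
    using jac_class_principal[OF assms(2)] jac_class_principal[OF principal_zero] o by simp
  moreover have "jac_class D \<in> carrier Jac"
    using assms(1) by (auto simp: Jac_def FactGroup_def RCOSETS_def jac_class_def)
  ultimately show ?thesis by (simp add: Jac_torsion_def)
qed

section \<open>Independence of the Weil product of the representatives\<close>

definition weil_factor :: "divisor \<Rightarrow> divisor \<Rightarrow> ambient \<Rightarrow> ambient \<Rightarrow> point \<Rightarrow> qbar" where
  "weil_factor D E f\<^sub>D f\<^sub>E P = value_at P (f\<^sub>E powi ord_div P D / f\<^sub>D powi ord_div P E)"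

lemma minus_one_powi_even: "(-1::qbar) powi (4 * m * n) = 1"
proof -
  have "(-1::qbar) powi (4 * m * n) = ((-1) powi 4) powi (m * n)"
    by (simp only: mult.assoc power_int_mult)
  thus ?thesis by simp
qed

lemma weil_product_superset:
  assumes "finite A" "A \<subseteq> fermat" "Poly_Mapping.keys D \<subseteq> A" "Poly_Mapping.keys E \<subseteq> A"
  shows "weil_product D E f\<^sub>D f\<^sub>E = (\<Prod>P\<in>A. weil_factor D E f\<^sub>D f\<^sub>E P)"
proof -
  have "weil_product D E f\<^sub>D f\<^sub>E = (\<Prod>P\<in>Poly_Mapping.keys D \<union> Poly_Mapping.keys E. weil_factor D E f\<^sub>D f\<^sub>E P)"
    unfolding weil_product_def weil_factor_def minus_one_powi_even by simp
  also have "\<dots> = (\<Prod>P\<in>A. weil_factor D E f\<^sub>D f\<^sub>E P)"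
  proof (rule prod.mono_neutral_left)
    show "\<forall>P\<in>A - (Poly_Mapping.keys D \<union> Poly_Mapping.keys E). weil_factor D E f\<^sub>D f\<^sub>E P = 1"
      using assms(2) value_at_eq[OF _ has_value_1] by (auto simp: weil_factor_def in_keys_iff)
  qed (use assms in auto)
  finally show ?thesis .
qed

context
  fixes D E f\<^sub>D f\<^sub>E P
  assumes P: "P \<in> fermat"
    and f: "has_divisor f\<^sub>D (frag_cmul 4 D)" and g: "has_divisor f\<^sub>E (frag_cmul 4 E)"
begin

lemma weil_factor_unit:
  "f\<^sub>E powi ord_div P D / f\<^sub>D powi ord_div P E \<in> function_field"
  "f\<^sub>E powi ord_div P D / f\<^sub>D powi ord_div P E \<noteq> 0"
  "ord_at P (f\<^sub>E powi ord_div P D / f\<^sub>D powi ord_div P E) = 0"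
proof -
  have K: "f\<^sub>D \<in> function_field" "f\<^sub>D \<noteq> 0" "f\<^sub>E \<in> function_field" "f\<^sub>E \<noteq> 0"
    using f g by (auto simp: has_divisor_def)
  show "f\<^sub>E powi ord_div P D / f\<^sub>D powi ord_div P E \<in> function_field"
    "f\<^sub>E powi ord_div P D / f\<^sub>D powi ord_div P E \<noteq> 0"
    using K by (auto intro: function_field_intros)
  have "ord_at P f\<^sub>D = 4 * ord_div P D" "ord_at P f\<^sub>E = 4 * ord_div P E"
    using f g P by (auto simp: has_divisor_def)
  thus "ord_at P (f\<^sub>E powi ord_div P D / f\<^sub>D powi ord_div P E) = 0"
    using K by (simp add: ord_at_divide[OF P] ord_at_powi[OF P] function_field_powi)
qed

end

lemma weil_product_swap:
  assumes D: "Poly_Mapping.keys D \<subseteq> fermat" "Poly_Mapping.keys E \<subseteq> fermat"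
    and f: "has_divisor f\<^sub>D (frag_cmul 4 D)" and g: "has_divisor f\<^sub>E (frag_cmul 4 E)"
  shows "weil_product E D f\<^sub>E f\<^sub>D * weil_product D E f\<^sub>D f\<^sub>E = 1"
proof -
  let ?A = "Poly_Mapping.keys D \<union> Poly_Mapping.keys E"
  have A: "finite ?A" "?A \<subseteq> fermat" using D by auto
  have "weil_factor E D f\<^sub>E f\<^sub>D P * weil_factor D E f\<^sub>D f\<^sub>E P = 1" if P: "P \<in> fermat" for P
  proof -
    have "weil_factor E D f\<^sub>E f\<^sub>D P * weil_factor D E f\<^sub>D f\<^sub>E P =
        value_at P ((f\<^sub>D powi ord_div P E / f\<^sub>E powi ord_div P D) * (f\<^sub>E powi ord_div P D / f\<^sub>D powi ord_div P E))"
      unfolding weil_factor_def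
      by (rule value_at_mult_unit[OF P weil_factor_unit[OF P g f] weil_factor_unit[OF P f g], symmetric])
    also have "(f\<^sub>D powi ord_div P E / f\<^sub>E powi ord_div P D) * (f\<^sub>E powi ord_div P D / f\<^sub>D powi ord_div P E) = 1"
      using f g by (simp add: has_divisor_def)
    finally show ?thesis using value_at_eq[OF P has_value_1[OF P]] by simp
  qed
  hence "(\<Prod>P\<in>?A. weil_factor E D f\<^sub>E f\<^sub>D P * weil_factor D E f\<^sub>D f\<^sub>E P) = 1"
    using A(2) by (intro prod.neutral) blast
  thus ?thesis
    using weil_product_superset[OF A, of E D f\<^sub>E f\<^sub>D] weil_product_superset[OF A, of D E f\<^sub>D f\<^sub>E]
    by (simp add: prod.distrib)
qed

lemma prod_powi:
  "finite A \<Longrightarrow> (c::qbar) \<noteq> 0 \<Longrightarrow> (\<Prod>x\<in>A. c powi u x) = c powi (\<Sum>x\<in>A. u x)"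
  by (induction A rule: finite_induct) (simp_all add: power_int_add)

text \<open>With D' = D + div h, the function for D' is a constant c times the one for D times h^4.
  Each local factor changes by a tame symbol of \<open>f\<^sub>E\<close> and h and by c to the power
  -ord_P E; reciprocity removes the first change, degree zero of E the second.\<close>

lemma weil_product_left:
  assumes D: "D \<in> carrier Div0" "D' \<in> carrier Div0" "E \<in> carrier Div0"
    and N: "D' - D \<in> principal"
    and f: "has_divisor f\<^sub>D (frag_cmul 4 D)" and f': "has_divisor f' (frag_cmul 4 D')"
    and g: "has_divisor f\<^sub>E (frag_cmul 4 E)"
  shows "weil_product D' E f' f\<^sub>E = weil_product D E f\<^sub>D f\<^sub>E"
proof -
  obtain h where h: "has_divisor h (D' - D)" using N unfolding principal_def by blast
  have K: "f\<^sub>D \<in> function_field" "f\<^sub>D \<noteq> 0" "f\<^sub>E \<in> function_field" "f\<^sub>E \<noteq> 0"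
    "h \<in> function_field" "h \<noteq> 0"
    using f g h by (auto simp: has_divisor_def)
  have "has_divisor (f\<^sub>D * h ^ 4) (frag_cmul 4 D + frag_cmul 4 (D' - D))"
    using has_divisor_mult[OF f has_divisor_power[OF h, of 4]] by simp
  also have "frag_cmul 4 D + frag_cmul 4 (D' - D) = frag_cmul 4 D'"
    by (simp add: frag_cmul_distrib2[symmetric])
  finally obtain c where c: "c \<noteq> 0" "f' = const c * (f\<^sub>D * h ^ 4)"
    using has_divisor_unique[OF f'] by blast
  define A where "A = Poly_Mapping.keys D \<union> Poly_Mapping.keys D' \<union> Poly_Mapping.keys E \<union> support h"
  have A: "finite A" "A \<subseteq> fermat"
    using D finite_support[OF K(5,6)] by (auto simp: A_def Div0_iff support_def)
  have "weil_factor D' E f' f\<^sub>E P =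
      weil_factor D E f\<^sub>D f\<^sub>E P * c powi (- ord_div P E) * tame 1 P f\<^sub>E h" if P: "P \<in> fermat" for P
  proof -
    define d e n where "d = ord_div P D" and "e = ord_div P E" and "n = ord_at P h"
    have d': "ord_div P D' = d + n"
      using h P by (auto simp: has_divisor_def d_def n_def lookup_minus)
    have oE: "ord_at P f\<^sub>E = 4 * e" using g P by (auto simp: has_divisor_def e_def)
    have dom: "f\<^sub>E \<in> tame_dom 1 P" "h \<in> tame_dom 1 P" using K by (auto simp: tame_dom_def)
    have T: "f\<^sub>E powi n / h powi (4 * e) \<in> function_field" "f\<^sub>E powi n / h powi (4 * e) \<noteq> 0"
      "ord_at P (f\<^sub>E powi n / h powi (4 * e)) = 0"
      using tame_arg[OF P dom] by (simp_all add: oE n_def)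
    have t: "tame 1 P f\<^sub>E h = value_at P (f\<^sub>E powi n / h powi (4 * e))"
      unfolding tame_def by (simp add: oE n_def[symmetric] minus_one_powi_even)
    have C: "const (c powi (- e)) \<in> function_field" "const (c powi (- e)) \<noteq> 0"
      "ord_at P (const (c powi (- e))) = 0"
      using c(1) by (simp_all add: function_field_const ord_at_const[OF P])
    note W = weil_factor_unit[OF P f g, folded d_def e_def]
    have WC: "f\<^sub>E powi d / f\<^sub>D powi e * const (c powi (- e)) \<in> function_field"
      "f\<^sub>E powi d / f\<^sub>D powi e * const (c powi (- e)) \<noteq> 0"
      "ord_at P (f\<^sub>E powi d / f\<^sub>D powi e * const (c powi (- e))) = 0"
      using W C by (simp_all only: function_field_mult mult_eq_0_iff ord_at_mult[OF P] simp_thms)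
    have "(h ^ 4) powi e = h powi (4 * e)" by (simp add: power_int_mult)
    hence "f\<^sub>E powi (d + n) / f' powi e =
        (f\<^sub>E powi d / f\<^sub>D powi e * const (c powi (- e))) * (f\<^sub>E powi n / h powi (4 * e))"
      using K c(1) unfolding c(2)
      by (simp add: power_int_mult_distrib power_int_add const_powi const_inverse power_int_minus divide_inverse mult_ac)
    hence "value_at P (f\<^sub>E powi (d + n) / f' powi e) =
        value_at P (f\<^sub>E powi d / f\<^sub>D powi e) * value_at P (const (c powi (- e))) * value_at P (f\<^sub>E powi n / h powi (4 * e))"
      by (simp only: value_at_mult_unit[OF P WC T] value_at_mult_unit[OF P W C])
    thus ?thesis
      unfolding weil_factor_def d' t e_def[symmetric] d_def[symmetric]
      by (simp only: value_at_eq[OF P has_value_const[OF P]])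
  qed
  hence "(\<Prod>P\<in>A. weil_factor D' E f' f\<^sub>E P) =
      (\<Prod>P\<in>A. weil_factor D E f\<^sub>D f\<^sub>E P * c powi (- ord_div P E) * tame 1 P f\<^sub>E h)"
    using A(2) by (intro prod.cong) auto
  also have "\<dots> = (\<Prod>P\<in>A. weil_factor D E f\<^sub>D f\<^sub>E P) * (\<Prod>P\<in>A. c powi (- ord_div P E)) * (\<Prod>P\<in>A. tame 1 P f\<^sub>E h)"
    by (simp only: prod.distrib)
  also have "(\<Prod>P\<in>A. tame 1 P f\<^sub>E h) = 1"
    by (rule weil_reciprocity[OF K(3-6) A])
      (use has_divisor_keys(1)[OF g] in \<open>auto simp: A_def\<close>)
  also have "(\<Prod>P\<in>A. c powi (- ord_div P E)) = c powi (\<Sum>P\<in>A. - ord_div P E)"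
    by (rule prod_powi[OF A(1) c(1)])
  also have "(\<Sum>P\<in>A. - ord_div P E) = - degree_div E"
    unfolding degree_div_def sum_negf
    by (intro arg_cong[of _ _ uminus] sum.mono_neutral_right A(1)) (auto simp: A_def in_keys_iff)
  also have "degree_div E = 0" using D(3) by (simp add: Div0_iff)
  finally have "(\<Prod>P\<in>A. weil_factor D' E f' f\<^sub>E P) = (\<Prod>P\<in>A. weil_factor D E f\<^sub>D f\<^sub>E P)"
    by simp
  moreover have "Poly_Mapping.keys D \<subseteq> A" "Poly_Mapping.keys D' \<subseteq> A" "Poly_Mapping.keys E \<subseteq> A"
    by (auto simp: A_def)
  ultimately show ?thesis
    using weil_product_superset[OF A, of D' E f' f\<^sub>E] weil_product_superset[OF A, of D E f\<^sub>D f\<^sub>E]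
    by simp
qed

text \<open>A change in the second argument is turned into one in the first by antisymmetry.\<close>

lemma weil_product_class:
  assumes "D \<in> carrier Div0" "D' \<in> carrier Div0" "E \<in> carrier Div0" "E' \<in> carrier Div0"
    "jac_class D' = jac_class D" "jac_class E' = jac_class E"
    "has_divisor f (frag_cmul 4 D)" "has_divisor f' (frag_cmul 4 D')"
    "has_divisor g (frag_cmul 4 E)" "has_divisor g' (frag_cmul 4 E')"
  shows "weil_product D' E' f' g' = weil_product D E f g"
proof -
  have k: "Poly_Mapping.keys D \<subseteq> fermat" "Poly_Mapping.keys E \<subseteq> fermat" "Poly_Mapping.keys E' \<subseteq> fermat"
    using assms(1,3,4) by (simp_all add: Div0_iff)
  have "weil_product D' E' f' g' = weil_product D E' f g'"
    by (rule weil_product_left) (use assms jac_class_eq_imp in blast)+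
  moreover have "weil_product E' D g' f = weil_product E D g f"
    by (rule weil_product_left) (use assms jac_class_eq_imp in blast)+
  moreover note weil_product_swap[OF k(1,2) assms(7,9)] weil_product_swap[OF k(1,3) assms(7,10)]
  ultimately show ?thesis using inverse_unique by metis
qed

lemma of_nat_4_eq: "zeta 4 ^ k = zeta 4 ^ l \<Longrightarrow> (of_nat k :: 4) = of_nat l"
proof -
  assume "zeta 4 ^ k = zeta 4 ^ l"
  hence "zeta 4 powi (int k - int l) = 1" by (simp add: power_int_diff)
  hence "4 dvd int k - int l" by (rule zeta_4_powi_eq_1)
  then obtain m where "int k - int l = 4 * m" by (elim dvdE)
  hence "(of_int (int k - int l) :: 4) = of_int (4 * m)" by simp
  hence "(of_nat k :: 4) - of_nat l = 4 * of_int m" by simp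
  also have "(4::4) = 0" by simp
  finally show ?thesis by simp
qed

text \<open>One evaluation suffices: independence of the class representatives gives the universal
  statement in the \<open>THE\<close>, and the given representative makes it nonvacuous, so the
  exponent is determined modulo 4.\<close>

lemma weil_pairing_eqI:
  assumes "D \<in> carrier Div0" "E \<in> carrier Div0"
    "has_divisor f (frag_cmul 4 D)" "has_divisor g (frag_cmul 4 E)"
    "weil_product D E f g = zeta 4 ^ k"
  shows "weil_pairing (jac_class D) (jac_class E) = of_nat k"
  unfolding weil_pairing_def
proof (rule the_equality)
  show "\<forall>D' E' f' g'. D' \<in> carrier Div0 \<and> E' \<in> carrier Div0 \<and> jac_class D' = jac_class D \<and>
      jac_class E' = jac_class E \<and> has_divisor f' (frag_cmul 4 D') \<and> has_divisor g' (frag_cmul 4 E') \<longrightarrow>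
      is_log_mu4 (weil_product D' E' f' g') (of_nat k)"
  proof (intro allI impI, elim conjE)
    fix D' E' f' g'
    assume h: "D' \<in> carrier Div0" "E' \<in> carrier Div0" "jac_class D' = jac_class D" "jac_class E' = jac_class E"
      "has_divisor f' (frag_cmul 4 D')" "has_divisor g' (frag_cmul 4 E')"
    have "weil_product D' E' f' g' = zeta 4 ^ k"
      unfolding assms(5)[symmetric]
      by (rule weil_product_class[OF assms(1) h(1) assms(2) h(2-4) assms(3) h(5) assms(4) h(6)])
    thus "is_log_mu4 (weil_product D' E' f' g') (of_nat k)" unfolding is_log_mu4_def by blast
  qed
next
  fix a assume "\<forall>D' E' f' g'. D' \<in> carrier Div0 \<and> E' \<in> carrier Div0 \<and> jac_class D' = jac_class D \<and>
      jac_class E' = jac_class E \<and> has_divisor f' (frag_cmul 4 D') \<and> has_divisor g' (frag_cmul 4 E') \<longrightarrow>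
      is_log_mu4 (weil_product D' E' f' g') a"
  hence "is_log_mu4 (weil_product D E f g) a" using assms(1-4) by blast
  then obtain l where l: "a = of_nat l" "zeta 4 ^ k = zeta 4 ^ l" unfolding is_log_mu4_def assms(5) by blast
  show "a = of_nat k" unfolding l(1) by (rule of_nat_4_eq[OF l(2), symmetric])
qed

section \<open>Divisors supported away from one hyperflex\<close>

abbreviation pt :: "qbar \<times> qbar \<times> qbar \<Rightarrow> point" where
  "pt p \<equiv> proj_point (fst p) (fst (snd p)) (snd (snd p))"

abbreviation eval_form :: "nat \<Rightarrow> (nat \<Rightarrow> nat \<Rightarrow> qbar) \<Rightarrow> qbar \<times> qbar \<times> qbar \<Rightarrow> qbar" where
  "eval_form k g p \<equiv> form k g (fst p) (fst (snd p)) (snd (snd p))"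

text \<open>The line \<open>X = Z\<close> is the tangent at \<open>B\<^sub>0 = [1 : 0 : 1]\<close> and meets the curve nowhere else.\<close>

definition tangent_function :: "nat \<Rightarrow> (nat \<Rightarrow> nat \<Rightarrow> qbar) \<Rightarrow> ambient" where
  "tangent_function k g = restr k g / (x_coord - 1) ^ k"

definition div_of :: "(qbar \<times> qbar \<times> qbar) list \<Rightarrow> divisor" where
  "div_of ps = (\<Sum>p\<leftarrow>ps. frag_of (pt p)) - frag_cmul (int (length ps)) (frag_of (ptB 0))"

text \<open>Asks only for lower bounds on the contact; nonvanishing of the form at
  \<open>ptB 0\<close> makes the pole there exact, and exactness elsewhere follows from the
  degree.\<close>

definition osculating :: "(qbar \<times> qbar \<times> qbar) list \<Rightarrow> (nat \<Rightarrow> nat \<Rightarrow> qbar) \<Rightarrow> bool" where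
  "osculating ps g \<longleftrightarrow> distinct (map pt ps) \<and> eval_form (length ps) g (1, 0, 1) \<noteq> 0 \<and>
     (\<forall>p\<in>set ps. pt p \<in> fermat \<and> fst p \<noteq> snd (snd p) \<and> ord_at (pt p) (tangent_function (length ps) g) \<ge> 4)"

text \<open>The form (X - Z)^k, by the binomial theorem.\<close>

definition tangent_form :: "nat \<Rightarrow> nat \<Rightarrow> nat \<Rightarrow> 'a :: comm_ring_1" where
  "tangent_form k i j = (if j = 0 then of_nat (k choose i) * (- 1) ^ (k - i) else 0)"

lemma form_tangent: "form k (tangent_form k) a b c = (a - c) ^ k"
proof -
  have "form k (tangent_form k) a b c = (\<Sum>i\<le>k. of_nat (k choose i) * a ^ i * (- c) ^ (k - i))"
    unfolding form_def
  proof (rule sum.cong[OF refl])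
    fix i
    have "(\<Sum>j\<le>k - i. tangent_form k i j * a ^ i * b ^ j * c ^ (k - i - j)) =
        (\<Sum>j\<in>{0}. tangent_form k i j * a ^ i * b ^ j * c ^ (k - i - j))"
      by (rule sum.mono_neutral_right) (auto simp: tangent_form_def)
    also have "\<dots> = of_nat (k choose i) * a ^ i * (- c) ^ (k - i)"
      unfolding power_minus[of c] by (simp add: tangent_form_def mult_ac)
    finally show "(\<Sum>j\<le>k - i. tangent_form k i j * a ^ i * b ^ j * c ^ (k - i - j)) =
      of_nat (k choose i) * a ^ i * (- c) ^ (k - i)" .
  qed
  also have "\<dots> = (a + - c) ^ k" by (rule binomial_ring[symmetric])
  finally show ?thesis by simp
qed

lemma const_of_nat: "const (of_nat n) = of_nat n"
  by (induction n) (simp_all add: const_hom)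

lemma restr_tangent: "restr k (tangent_form k) = (x_coord - 1) ^ k"
proof -
  have "(\<lambda>i j. const (tangent_form k i j)) = tangent_form k"
    by (intro ext) (simp add: tangent_form_def const_hom const_of_nat)
  thus ?thesis by (simp add: restr_def form_tangent)
qed

lemma B0_fermat: "ptB 0 \<in> fermat" and B0_eq: "ptB 0 = proj_point 1 0 1"
  by (simp_all add: ptB_def fermat_affine)

text \<open>On the line X = Z the curve equation reads Y^4 = 0.\<close>

lemma fst_eq_imp_B0:
  assumes "pt p \<in> fermat" "fst p = snd (snd p)"
  shows "pt p = ptB 0"
proof -
  obtain a b c where *: "proj_point (fst p) (fst (snd p)) (snd (snd p)) = proj_point a b c"
    "(a, b, c) \<noteq> (0, 0, 0)" "a ^ 4 + b ^ 4 = c ^ 4"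
    using assms(1) unfolding fermat_def by blast
  obtain t where t: "t \<noteq> 0" "a = t * fst p" "b = t * fst (snd p)" "c = t * snd (snd p)"
    using proj_point_eq[OF *(1)[symmetric]] by blast
  have ac: "a = c" using t assms(2) by simp
  hence "b = 0" using *(3) by simp
  have "a \<noteq> 0" using *(2) ac \<open>b = 0\<close> by blast
  have "proj_point a b c = proj_point (a * 1) (a * 0) (a * 1)" using ac \<open>b = 0\<close> by simp
  also have "\<dots> = ptB 0" unfolding B0_eq by (rule proj_point_scale[OF \<open>a \<noteq> 0\<close>])
  finally show ?thesis using *(1) by simp
qed

lemma B0_imp_fst_eq: "pt p = ptB 0 \<Longrightarrow> fst p = snd (snd p)"
  unfolding B0_eq by (drule proj_point_eq) auto

lemma has_value_tangent_function:
  "fst p \<noteq> snd (snd p) \<Longrightarrow>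
    has_value (pt p) (tangent_function k g) (eval_form k g p / (fst p - snd (snd p)) ^ k)"
  unfolding has_value_rep tangent_function_def
  by (intro exI[of _ k] exI[of _ g] exI[of _ "tangent_form k"]) (simp add: form_tangent restr_tangent)

lemma has_value_restr_B0: "has_value (ptB 0) (restr k g) (eval_form k g (1, 0, 1))"
  unfolding B0_eq has_value_affine restr_eq fst_conv snd_conv pev_form_poly[symmetric] by (rule aff.val_poly)

context
  fixes ps g
  assumes o: "osculating ps g"
begin

lemma restr_nonzero: "restr (length ps) g \<noteq> 0"
  using has_value_nonzero[OF B0_fermat has_value_restr_B0] o by (auto simp: osculating_def)

lemma x_minus_1: "x_coord - 1 \<noteq> 0" "x_coord - 1 \<in> function_field" "ord_at (ptB 0) (x_coord - 1) = 4"
  using aff.x_nonconst[of 1] ord_at_x_diff[of 1 0]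
  by (auto simp: const_hom B0_eq intro: function_field_intros)

lemma tangent_function_mem: "tangent_function (length ps) g \<in> function_field" "tangent_function (length ps) g \<noteq> 0"
  using restr_nonzero x_minus_1 by (auto simp: tangent_function_def restr_mem intro!: function_field_intros)

lemma ord_B0: "ord_at (ptB 0) (tangent_function (length ps) g) = - 4 * int (length ps)"
proof -
  have "ord_at (ptB 0) (restr (length ps) g) = 0"
    using o by (intro ord_at_unit[OF B0_fermat has_value_restr_B0]) (auto simp: osculating_def)
  thus ?thesis
    using restr_nonzero x_minus_1
    by (simp add: tangent_function_def ord_at_divide[OF B0_fermat] ord_at_power[OF B0_fermat]
        restr_mem function_field_power)
qed

lemma B0_notin: "ptB 0 \<notin> pt ` set ps"
  using o B0_imp_fst_eq by (auto simp: osculating_def)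

lemma lookup_div_of:
  "ord_div P (div_of ps) = (if P \<in> pt ` set ps then 1 else if P = ptB 0 then - int (length ps) else 0)"
proof -
  have "Poly_Mapping.lookup (\<Sum>p\<leftarrow>qs. frag_of (pt p)) P = (if P \<in> pt ` set qs then 1 else 0)"
    if "distinct (map pt qs)" for qs
    using that by (induction qs) (auto simp: lookup_add)
  moreover have "distinct (map pt ps)" using o by (simp add: osculating_def)
  ultimately show ?thesis
    using B0_notin by (auto simp: div_of_def lookup_minus)
qed

lemma keys_div_of: "Poly_Mapping.keys (div_of ps) \<subseteq> insert (ptB 0) (pt ` set ps)"
  by (auto simp: in_keys_iff lookup_div_of split: if_splits)

lemma points_fermat: "pt ` set ps \<subseteq> fermat"
  using o by (auto simp: osculating_def)

lemma sum_div_of: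
  assumes "finite A" "insert (ptB 0) (pt ` set ps) \<subseteq> A"
  shows "(\<Sum>P\<in>A. ord_div P (div_of ps)) = 0"
proof -
  have "(\<Sum>P\<in>A. ord_div P (div_of ps)) = (\<Sum>P\<in>insert (ptB 0) (pt ` set ps). ord_div P (div_of ps))"
    using assms by (intro sum.mono_neutral_right) (auto simp: lookup_div_of)
  also have "\<dots> = - int (length ps) + (\<Sum>P\<in>pt ` set ps. 1)"
    using B0_notin by (simp add: lookup_div_of)
  also have "(\<Sum>P\<in>pt ` set ps. 1) = int (length ps)"
    using o distinct_card[of "map pt ps"] by (simp add: osculating_def)
  finally show ?thesis by simp
qed

lemma div_of_Div0: "div_of ps \<in> carrier Div0"
proof -
  have "degree_div (div_of ps) = (\<Sum>P\<in>insert (ptB 0) (pt ` set ps). ord_div P (div_of ps))"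
    unfolding degree_div_def using keys_div_of by (intro sum.mono_neutral_left) (auto simp: in_keys_iff)
  thus ?thesis
    using sum_div_of[of "insert (ptB 0) (pt ` set ps)"] keys_div_of points_fermat B0_fermat
    by (auto simp: Div0_iff)
qed

text \<open>The order minus four times the coefficient of \<open>div_of\<close> is nonnegative
  everywhere: by contact at the listed points, by equality at \<open>ptB 0\<close>, and elsewhere
  because the denominator does not vanish. Both sides have degree zero, so every difference is
  0.\<close>

lemma has_divisor_tangent_function:
  "has_divisor (tangent_function (length ps) g) (frag_cmul 4 (div_of ps))"
proof -
  let ?f = "tangent_function (length ps) g"
  note f = tangent_function_mem
  define A where "A = support ?f \<union> insert (ptB 0) (pt ` set ps)"
  have A: "finite A" "A \<subseteq> fermat"
    using finite_support[OF f] points_fermat B0_fermat by (auto simp: A_def support_def)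
  have ge: "ord_at P ?f - 4 * ord_div P (div_of ps) \<ge> 0" if P: "P \<in> fermat" for P
  proof (cases "P \<in> pt ` set ps \<or> P = ptB 0")
    case True
    thus ?thesis
      using o B0_notin by (auto simp: lookup_div_of ord_B0 osculating_def)
  next
    case False
    obtain a b c where abc: "P = pt (a, b, c)" using P unfolding fermat_def by auto
    have "fst (a, b, c) \<noteq> snd (snd (a, b, c))"
      using fst_eq_imp_B0[of "(a, b, c)"] False P unfolding abc by blast
    from has_value_tangent_function[OF this] have "ord_at P ?f \<ge> 0"
      unfolding abc using ord_at_nonneg(1)[OF P[unfolded abc] _ f(2)] by blast
    thus ?thesis using False by (simp add: lookup_div_of)
  qed
  have "(\<Sum>P\<in>A. ord_at P ?f) = 0"
    by (rule degree_zero[OF f A]) (auto simp: A_def)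
  moreover have "(\<Sum>P\<in>A. ord_div P (div_of ps)) = 0"
    by (rule sum_div_of[OF A(1)]) (auto simp: A_def)
  ultimately have "(\<Sum>P\<in>A. ord_at P ?f - 4 * ord_div P (div_of ps)) = 0"
    unfolding sum_subtractf sum_distrib_left[symmetric] by simp
  hence eq: "\<forall>P\<in>A. ord_at P ?f - 4 * ord_div P (div_of ps) = 0"
    using sum_nonneg_eq_0_iff[OF A(1), of "\<lambda>P. ord_at P ?f - 4 * ord_div P (div_of ps)"] ge A(2) by blast
  have "ord_div P (frag_cmul 4 (div_of ps)) = ord_at P ?f" if P: "P \<in> fermat" for P
  proof (cases "P \<in> A")
    case True
    thus ?thesis using eq by auto
  next
    case False
    thus ?thesis using P by (auto simp: A_def support_def lookup_div_of)
  qed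
  moreover have "Poly_Mapping.keys (frag_cmul 4 (div_of ps)) \<subseteq> fermat"
    using keys_div_of points_fermat B0_fermat by auto
  ultimately show ?thesis using f by (simp add: has_divisor_def)
qed

lemma osculating_torsion: "jac_class (div_of ps) \<in> Jac_torsion 4"
  using has_divisor_tangent_function
  by (intro jac_class_torsion div_of_Div0) (auto simp: principal_def)

text \<open>With the same divisor and function on both sides, each local factor is a quotient of
  equal powers.\<close>

lemma weil_pairing_self: "weil_pairing (jac_class (div_of ps)) (jac_class (div_of ps)) = 0"
proof -
  let ?f = "tangent_function (length ps) g"
  have "weil_factor (div_of ps) (div_of ps) ?f ?f P = 1" if P: "P \<in> fermat" for P
    unfolding weil_factor_def using tangent_function_mem(2) value_at_eq[OF P has_value_1[OF P]] by simp
  hence "weil_product (div_of ps) (div_of ps) ?f ?f = zeta 4 ^ 0"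
    using weil_product_superset[of "Poly_Mapping.keys (div_of ps)" "div_of ps" "div_of ps"] div_of_Div0
    by (auto simp: Div0_iff intro!: prod.neutral)
  from weil_pairing_eqI[OF div_of_Div0 div_of_Div0 has_divisor_tangent_function has_divisor_tangent_function this]
  show ?thesis by simp
qed

end

context
  fixes ps g qs h
  assumes o: "osculating ps g" "osculating qs h" and disj: "pt ` set ps \<inter> pt ` set qs = {}"
begin

text \<open>At the points of ps only the second function enters, at those of qs only the inverse of
  the first. At \<open>ptB 0\<close>, where both have poles, the powers of x - 1 cancel and the
  values of the two forms remain.\<close>

lemma weil_product_osculating:
  "weil_product (div_of ps) (div_of qs) (tangent_function (length ps) g) (tangent_function (length qs) h) =
    (\<Prod>p\<leftarrow>ps. eval_form (length qs) h p / (fst p - snd (snd p)) ^ length qs) *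
    inverse (\<Prod>q\<leftarrow>qs. eval_form (length ps) g q / (fst q - snd (snd q)) ^ length ps) *
    (eval_form (length ps) g (1, 0, 1) ^ length qs / eval_form (length qs) h (1, 0, 1) ^ length ps)"
proof -
  define k l where "k = length ps" and "l = length qs"
  define f f' where "f = tangent_function k g" and "f' = tangent_function l h"
  define w where "w = weil_factor (div_of ps) (div_of qs) f f'"
  have dv: "has_divisor f (frag_cmul 4 (div_of ps))" "has_divisor f' (frag_cmul 4 (div_of qs))"
    unfolding f_def f'_def k_def l_def by (rule has_divisor_tangent_function[OF o(1)])
      (rule has_divisor_tangent_function[OF o(2)])
  let ?S = "pt ` set ps" and ?T = "pt ` set qs"
  have F: "?S \<subseteq> fermat" "?T \<subseteq> fermat" using points_fermat[OF o(1)] points_fermat[OF o(2)] .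
  have "weil_product (div_of ps) (div_of qs) f f' = (\<Prod>P\<in>insert (ptB 0) (?S \<union> ?T). w P)"
    unfolding w_def using F B0_fermat keys_div_of[OF o(1)] keys_div_of[OF o(2)]
    by (intro weil_product_superset) auto
  also have "\<dots> = w (ptB 0) * (\<Prod>P\<in>?S \<union> ?T. w P)"
    using B0_notin[OF o(1)] B0_notin[OF o(2)] by (intro prod.insert) auto
  also have "(\<Prod>P\<in>?S \<union> ?T. w P) = (\<Prod>P\<in>?S. w P) * (\<Prod>P\<in>?T. w P)"
    using disj by (intro prod.union_disjoint) auto
  also have "(\<Prod>P\<in>?S. w P) = (\<Prod>p\<leftarrow>ps. eval_form l h p / (fst p - snd (snd p)) ^ l)"
  proof -
    have "w (pt p) = eval_form l h p / (fst p - snd (snd p)) ^ l" if p: "p \<in> set ps" for p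
    proof -
      have P: "pt p \<in> fermat" "fst p \<noteq> snd (snd p)" using o(1) p by (auto simp: osculating_def)
      have "pt p \<notin> ?T" "pt p \<noteq> ptB 0" using disj p B0_notin[OF o(1)] by auto
      hence "w (pt p) = value_at (pt p) f'"
        using p by (simp add: w_def weil_factor_def lookup_div_of[OF o(1)] lookup_div_of[OF o(2)])
      thus ?thesis
        unfolding f'_def using value_at_eq[OF P(1) has_value_tangent_function[OF P(2)]] by simp
    qed
    hence "(\<Prod>P\<in>set (map pt ps). w P) = (\<Prod>p\<leftarrow>ps. eval_form l h p / (fst p - snd (snd p)) ^ l)"
      using o(1) prod.distinct_set_conv_list[of "map pt ps" w]
      by (simp add: osculating_def comp_def cong: map_cong)
    thus ?thesis by simp
  qed
  also have "(\<Prod>P\<in>?T. w P) = (\<Prod>q\<leftarrow>qs. inverse (eval_form k g q / (fst q - snd (snd q)) ^ k))"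
  proof -
    have "w (pt p) = inverse (eval_form k g p / (fst p - snd (snd p)) ^ k)" if p: "p \<in> set qs" for p
    proof -
      have P: "pt p \<in> fermat" "fst p \<noteq> snd (snd p)" using o(2) p by (auto simp: osculating_def)
      have n: "pt p \<notin> ?S" "pt p \<noteq> ptB 0" using disj p B0_notin[OF o(2)] by auto
      hence e: "w (pt p) = value_at (pt p) (inverse f)"
        using p by (auto simp: w_def weil_factor_def lookup_div_of[OF o(1)] lookup_div_of[OF o(2)] divide_inverse)
      have "ord_at (pt p) f = 0"
        using bspec[OF conjunct2[OF conjunct2[OF conjunct2[OF dv(1)[unfolded has_divisor_def]]]] P(1)] n
        by (simp add: lookup_div_of[OF o(1)])
      hence "value_at (pt p) f \<noteq> 0"
        using dv(1) by (intro unit_of_ord_0(2)[OF P(1)]) (auto simp: has_divisor_def)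
      moreover have v: "has_value (pt p) f (eval_form k g p / (fst p - snd (snd p)) ^ k)"
        unfolding f_def by (rule has_value_tangent_function[OF P(2)])
      ultimately have nz: "eval_form k g p / (fst p - snd (snd p)) ^ k \<noteq> 0"
        using value_at_eq[OF P(1) v] by simp
      show ?thesis
        unfolding e by (rule value_at_eq[OF P(1) has_value_inverse[OF P(1) v nz]])
    qed
    hence "(\<Prod>P\<in>set (map pt qs). w P) = (\<Prod>q\<leftarrow>qs. inverse (eval_form k g q / (fst q - snd (snd q)) ^ k))"
      using o(2) prod.distinct_set_conv_list[of "map pt qs" w]
      by (simp add: osculating_def comp_def cong: map_cong)
    thus ?thesis by simp
  qed
  also have "(\<Prod>q\<leftarrow>qs. inverse (eval_form k g q / (fst q - snd (snd q)) ^ k)) =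
      inverse (\<Prod>q\<leftarrow>qs. eval_form k g q / (fst q - snd (snd q)) ^ k)"
    by (induction qs) (simp_all only: list.map prod_list.Cons prod_list.Nil inverse_1 inverse_mult_distrib)
  also have "w (ptB 0) = eval_form k g (1, 0, 1) ^ l / eval_form l h (1, 0, 1) ^ k"
  proof -
    have nz: "restr k g \<noteq> 0" "restr l h \<noteq> 0" "x_coord - 1 \<noteq> 0"
      unfolding k_def l_def using restr_nonzero[OF o(1)] restr_nonzero[OF o(2)] x_minus_1(1)[OF o(1)] .
    have "f' powi (- int k) / f powi (- int l) = f ^ l / f' ^ k"
      by (simp add: power_int_minus field_simps)
    also have "\<dots> = restr k g ^ l / restr l h ^ k"
    proof -
      have "((x_coord - 1) ^ k) ^ l = ((x_coord - 1) ^ l) ^ k"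
        by (simp add: power_mult[symmetric] mult.commute)
      thus ?thesis using nz unfolding f_def f'_def tangent_function_def by (simp add: power_divide)
    qed
    finally have "w (ptB 0) = value_at (ptB 0) (restr k g ^ l / restr l h ^ k)"
      using B0_notin[OF o(1)] B0_notin[OF o(2)]
      by (simp add: w_def weil_factor_def lookup_div_of[OF o(1)] lookup_div_of[OF o(2)] k_def l_def)
    moreover have "has_value (ptB 0) (restr k g ^ l / restr l h ^ k)
        (eval_form k g (1, 0, 1) ^ l / eval_form l h (1, 0, 1) ^ k)"
      using o(2) by (intro has_value_divide[OF B0_fermat] has_value_power[OF B0_fermat] has_value_restr_B0)
        (simp add: osculating_def l_def)
    ultimately show ?thesis using value_at_eq[OF B0_fermat] by simp
  qed
  finally show ?thesis
    by (simp only: f_def f'_def k_def l_def mult_ac)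
qed

text \<open>The hypothesis is the previous formula cleared of denominators, an identity fit for
  Groebner bases. The reversed pairing is -n, written as 3 n modulo 4.\<close>

lemma weil_pairing_osculating:
  assumes eq: "(\<Prod>p\<leftarrow>ps. eval_form (length qs) h p) * (\<Prod>q\<leftarrow>qs. (fst q - snd (snd q)) ^ length ps) *
      eval_form (length ps) g (1, 0, 1) ^ length qs =
    zeta 4 ^ n * ((\<Prod>q\<leftarrow>qs. eval_form (length ps) g q) * (\<Prod>p\<leftarrow>ps. (fst p - snd (snd p)) ^ length qs) *
      eval_form (length qs) h (1, 0, 1) ^ length ps)"
  shows "weil_pairing (jac_class (div_of ps)) (jac_class (div_of qs)) = of_nat n"
    and "weil_pairing (jac_class (div_of qs)) (jac_class (div_of ps)) = of_nat (3 * n)"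
proof -
  let ?f = "tangent_function (length ps) g" and ?f' = "tangent_function (length qs) h"
  have pd: "(\<Prod>p\<leftarrow>xs. u p / v p) = (\<Prod>p\<leftarrow>xs. u p) / (\<Prod>p\<leftarrow>xs. v p)"
    for xs :: "(qbar \<times> qbar \<times> qbar) list" and u v :: "_ \<Rightarrow> qbar"
    by (induction xs) simp_all
  have d: "(\<Prod>p\<leftarrow>ps. (fst p - snd (snd p)) ^ length qs) \<noteq> 0" "(\<Prod>q\<leftarrow>qs. (fst q - snd (snd q)) ^ length ps) \<noteq> 0"
    using o by (auto simp: prod_list_zero_iff osculating_def)
  have e: "eval_form (length ps) g (1, 0, 1) \<noteq> 0" "eval_form (length qs) h (1, 0, 1) \<noteq> 0"
    using o by (auto simp: osculating_def)
  have D: "div_of ps \<in> carrier Div0" "div_of qs \<in> carrier Div0"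
    using div_of_Div0[OF o(1)] div_of_Div0[OF o(2)] .
  have dv: "has_divisor ?f (frag_cmul 4 (div_of ps))" "has_divisor ?f' (frag_cmul 4 (div_of qs))"
    using has_divisor_tangent_function[OF o(1)] has_divisor_tangent_function[OF o(2)] .
  have sw: "weil_product (div_of qs) (div_of ps) ?f' ?f * weil_product (div_of ps) (div_of qs) ?f ?f' = 1"
    using D by (intro weil_product_swap dv) (auto simp: Div0_iff)
  \<comment> \<open>If this product vanished, \<open>inverse\<close> would return 0 and the Weil
    product would be 0, contradicting \<open>sw\<close>.\<close>
  hence "(\<Prod>q\<leftarrow>qs. eval_form (length ps) g q) \<noteq> 0"
    unfolding weil_product_osculating pd by auto
  hence w: "weil_product (div_of ps) (div_of qs) ?f ?f' = zeta 4 ^ n"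
    unfolding weil_product_osculating pd using d e eq by (simp add: field_simps)
  show "weil_pairing (jac_class (div_of ps)) (jac_class (div_of qs)) = of_nat n"
    by (rule weil_pairing_eqI[OF D dv w])
  have "zeta 4 ^ (3 * n) * zeta 4 ^ n = (zeta 4 ^ 4) ^ n"
    by (simp flip: power_add power_mult)
  hence "zeta 4 ^ (3 * n) * zeta 4 ^ n = 1" by (simp add: zeta_4_4)
  hence "weil_product (div_of qs) (div_of ps) ?f' ?f = zeta 4 ^ (3 * n)"
    using sw unfolding w by (metis mult_right_cancel power_not_zero zeta_4_nonzero)
  thus "weil_pairing (jac_class (div_of qs)) (jac_class (div_of ps)) = of_nat (3 * n)"
    by (rule weil_pairing_eqI[OF D(2,1) dv(2,1)])
qed

end

section \<open>Jets\<close>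

definition regular :: "point \<Rightarrow> ambient \<Rightarrow> bool" where
  "regular P f \<longleftrightarrow> (\<exists>v. has_value P f v)"

text \<open>Taylor expansion modulo s^4; no further precision is needed, since only contact of order
  at least four is tested.\<close>

definition jet :: "point \<Rightarrow> ambient \<Rightarrow> ambient \<Rightarrow> qbar \<Rightarrow> qbar \<Rightarrow> qbar \<Rightarrow> qbar \<Rightarrow> bool" where
  "jet P s f c0 c1 c2 c3 \<longleftrightarrow>
    (\<exists>r. regular P r \<and> f = const c0 + const c1 * s + const c2 * s ^ 2 + const c3 * s ^ 3 + s ^ 4 * r)"

context
  fixes P s
  assumes P: "P \<in> fermat" and s: "has_value P s 0"
begin

lemma regular_intros:
  "regular P (const c)" "regular P s"
  "regular P f \<Longrightarrow> regular P g \<Longrightarrow> regular P (f + g)"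
  "regular P f \<Longrightarrow> regular P g \<Longrightarrow> regular P (f * g)"
  "regular P f \<Longrightarrow> regular P (f ^ n)"
  unfolding regular_def
  by (rule exI, rule has_value_const[OF P], rule exI, rule s)
    (elim exE, rule exI, erule (1) has_value_add[OF P],
     elim exE, rule exI, erule (1) has_value_mult[OF P],
     elim exE, rule exI, erule has_value_power[OF P])

lemma jet_const: "jet P s (const c) c 0 0 0"
  unfolding jet_def using regular_intros(1)[of 0] by (intro exI[of _ 0]) (simp add: const_hom)

lemma jet_add:
  assumes "jet P s f a0 a1 a2 a3" "jet P s g b0 b1 b2 b3"
  shows "jet P s (f + g) (a0 + b0) (a1 + b1) (a2 + b2) (a3 + b3)"
proof -
  obtain r where r: "regular P r" "f = const a0 + const a1 * s + const a2 * s ^ 2 + const a3 * s ^ 3 + s ^ 4 * r"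
    using assms(1) unfolding jet_def by blast
  obtain r' where r': "regular P r'" "g = const b0 + const b1 * s + const b2 * s ^ 2 + const b3 * s ^ 3 + s ^ 4 * r'"
    using assms(2) unfolding jet_def by blast
  show ?thesis unfolding jet_def
    by (intro exI[of _ "r + r'"] conjI regular_intros r(1) r'(1))
      (unfold r(2) r'(2), simp add: const_hom algebra_simps)
qed

lemma jet_mult:
  assumes "jet P s f a0 a1 a2 a3" "jet P s g b0 b1 b2 b3"
  shows "jet P s (f * g) (a0 * b0) (a0 * b1 + a1 * b0) (a0 * b2 + a1 * b1 + a2 * b0)
    (a0 * b3 + a1 * b2 + a2 * b1 + a3 * b0)"
proof -
  obtain r where r: "regular P r" "f = const a0 + const a1 * s + const a2 * s ^ 2 + const a3 * s ^ 3 + s ^ 4 * r"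
    using assms(1) unfolding jet_def by blast
  obtain r' where r': "regular P r'" "g = const b0 + const b1 * s + const b2 * s ^ 2 + const b3 * s ^ 3 + s ^ 4 * r'"
    using assms(2) unfolding jet_def by blast
  let ?A = "const a0 + const a1 * s + const a2 * s ^ 2 + const a3 * s ^ 3"
  let ?B = "const b0 + const b1 * s + const b2 * s ^ 2 + const b3 * s ^ 3"
  \<comment> \<open>All terms of degree at least four in s of the product, divided by s^4.\<close>
  let ?R = "const a1 * const b3 + const a2 * const b2 + const a3 * const b1 +
    (const a2 * const b3 + const a3 * const b2) * s + const a3 * const b3 * s ^ 2 + ?A * r' + ?B * r + s ^ 4 * (r * r')"
  show ?thesis unfolding jet_def
    by (intro exI[of _ ?R] conjI regular_intros r(1) r'(1))
      (unfold r(2) r'(2) const_hom(3,4), Groebner_Basis.algebra)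
qed

lemma jet_zero_ord:
  assumes "jet P s f c0 c1 c2 c3" "c0 = 0" "c1 = 0" "c2 = 0" "c3 = 0" "f \<noteq> 0" "ord_at P s = 1"
  shows "ord_at P f \<ge> 4"
proof -
  obtain r v where r: "has_value P r v" "f = s ^ 4 * r"
    using assms(1-5) unfolding jet_def regular_def by (auto simp: const_hom)
  have nz: "s \<noteq> 0" "r \<noteq> 0" using assms(6) r(2) by auto
  have "ord_at P f = 4 + ord_at P r"
    unfolding r(2) using nz has_value_mem[OF P s] has_value_mem[OF P r(1)] assms(7)
    by (simp add: ord_at_mult[OF P] ord_at_power[OF P] function_field_power)
  thus ?thesis using ord_at_nonneg(1)[OF P r(1) nz(2)] by simp
qed

end

text \<open>
  The expansion of the coordinates in \<open>s = (x - a) / a\<close>: for \<open>k = a\<^sup>4 / b\<^sup>4\<close>, the fourth power of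
  \<open>y / b\<close> is \<open>1 - k ((1 + s)\<^sup>4 - 1)\<close>.
\<close>

abbreviation affine_pt :: "qbar \<Rightarrow> qbar \<Rightarrow> point" where
  "affine_pt a b \<equiv> proj_point a b 1"

abbreviation rel_param :: "qbar \<Rightarrow> ambient" where
  "rel_param a \<equiv> (x_coord - const a) / const a"

context
  fixes a b :: qbar
  assumes ab: "a ^ 4 + b ^ 4 = 1" "a \<noteq> 0" "b \<noteq> 0"
begin

lemma affine_pt_fermat: "affine_pt a b \<in> fermat" by (rule fermat_affine[OF ab(1)])

lemma has_value_rel_param: "has_value (affine_pt a b) (rel_param a) 0"
proof -
  have "has_value (affine_pt a b) (rel_param a) ((a - a) / a)"
    by (intro has_value_divide has_value_diff has_value_const has_value_x affine_pt_fermat ab(1,2))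
  thus ?thesis by simp
qed

lemma ord_at_rel_param: "ord_at (affine_pt a b) (rel_param a) = 1"
  using ord_at_x_diff[OF ab(1)] ab aff.x_nonconst[of a]
  by (simp add: ord_at_divide[OF affine_pt_fermat] ord_at_const[OF affine_pt_fermat] function_field_intros)

lemma jet_x: "jet (affine_pt a b) (rel_param a) x_coord a a 0 0"
  unfolding jet_def using ab(2) regular_intros(1)[OF affine_pt_fermat has_value_rel_param, of 0]
  by (intro exI[of _ 0]) (simp add: const_hom)

text \<open>The constants are the coefficients up to s^3 of (1 + t)^(1/4) for t = -k ((1 + s)^4 -
  1). The truncation U satisfies U^4 = u^4 modulo s^4, where u = y / b. The cofactor of u - U in u^4
  - U^4 takes the value 4 at the point, hence is a unit, and u = U modulo s^4.\<close>

lemma jet_y: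
  assumes k: "k * b ^ 4 = a ^ 4" and c: "c1 = - k" "2 * c2 = - 3 * (k + k ^ 2)" "2 * c3 = - (2 * k + 9 * k ^ 2 + 7 * k ^ 3)"
  shows "jet (affine_pt a b) (rel_param a) y_coord b (c1 * b) (c2 * b) (c3 * b)"
proof -
  define s where "s = rel_param a"
  have has_value_s: "has_value (affine_pt a b) s 0" unfolding s_def by (rule has_value_rel_param)
  define u where "u = y_coord / const b"
  define U where "U = const 1 + const (- k) * s + const c2 * s ^ 2 + const c3 * s ^ 3"
  have jU: "jet (affine_pt a b) s U 1 (- k) c2 c3"
    unfolding jet_def U_def using regular_intros(1)[OF affine_pt_fermat has_value_s, of 0]
    by (intro exI[of _ 0]) (simp add: const_hom)
  define e2 e3 where "e2 = 1 * c2 + - k * - k + c2 * 1" and "e3 = 1 * c3 + - k * c2 + c2 * - k + c3 * 1"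
  have j2: "jet (affine_pt a b) s (U * U) 1 (- 2 * k) e2 e3"
    using jet_mult[OF affine_pt_fermat has_value_s jU jU] by (simp add: e2_def e3_def)
  have "jet (affine_pt a b) s (U * U * (U * U)) 1 (- 4 * k) (- 6 * k) (- 4 * k)"
  proof -
    have "1 * e2 + - 2 * k * (- 2 * k) + e2 * 1 = - 6 * k"
      unfolding e2_def using c(2) by Groebner_Basis.algebra
    moreover have "1 * e3 + - 2 * k * e2 + e2 * (- 2 * k) + e3 * 1 = - 4 * k"
      unfolding e2_def e3_def using c(2,3) by Groebner_Basis.algebra
    moreover have "1 * (- 2 * k) + - 2 * k * 1 = - 4 * k" by simp
    ultimately show ?thesis
      using jet_mult[OF affine_pt_fermat has_value_s j2 j2] by simp
  qed
  then obtain R where R: "regular (affine_pt a b) R"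
    "U * U * (U * U) = const 1 + const (- 4 * k) * s + const (- 6 * k) * s ^ 2 + const (- 4 * k) * s ^ 3 + s ^ 4 * R"
    unfolding jet_def by blast
  have x: "x_coord = const a * (1 + s)" using ab(2) by (simp add: s_def field_simps)
  have y: "y_coord = const b * u" using ab(3) by (simp add: u_def)
  have "const a ^ 4 * (1 + s) ^ 4 + const b ^ 4 * u ^ 4 = 1"
    using aff.curve unfolding power_mult_distrib[symmetric] x[symmetric] y[symmetric] .
  moreover have "const k * const b ^ 4 = const a ^ 4" using k by (metis const_hom(4,7))
  moreover have "const a ^ 4 + const b ^ 4 = 1" using ab(1) by (metis const_hom(2,3,7))
  ultimately have "const b ^ 4 * u ^ 4 = const b ^ 4 * (const k + 1 - const k * (1 + s) ^ 4)"
    by Groebner_Basis.algebra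
  hence u4: "u ^ 4 = const k + 1 - const k * (1 + s) ^ 4" using ab(3) by simp
  define co where "co = u^3 + u^2 * U + u * U^2 + U^3"
  have hu: "has_value (affine_pt a b) u 1"
    unfolding u_def using has_value_divide[OF affine_pt_fermat has_value_y[OF ab(1)] has_value_const[OF affine_pt_fermat] ab(3)] ab(3) by simp
  have hU: "has_value (affine_pt a b) U (1 + - k * 0 + c2 * 0 ^ 2 + c3 * 0 ^ 3)"
    unfolding U_def by (intro has_value_add[OF affine_pt_fermat] has_value_mult[OF affine_pt_fermat] has_value_power[OF affine_pt_fermat] has_value_const[OF affine_pt_fermat] has_value_s)
  have hU: "has_value (affine_pt a b) U 1" using hU by simp
  have "has_value (affine_pt a b) co (1 ^ 3 + 1 ^ 2 * 1 + 1 * 1 ^ 2 + 1 ^ 3)"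
    unfolding co_def by (intro has_value_add[OF affine_pt_fermat] has_value_mult[OF affine_pt_fermat] has_value_power[OF affine_pt_fermat] hu hU)
  hence hco: "has_value (affine_pt a b) co 4" by simp
  have co0: "co \<noteq> 0" by (rule has_value_nonzero[OF affine_pt_fermat hco]) simp
  have hi: "regular (affine_pt a b) (inverse co)"
    unfolding regular_def using has_value_inverse[OF affine_pt_fermat hco] by auto
  have "(u - U) * co = u ^ 4 - U * U * (U * U)"
    unfolding co_def by Groebner_Basis.algebra
  also have "\<dots> = s ^ 4 * (const (- k) + const (- 1) * R)"
    unfolding u4 R(2) by (simp only: const_hom(2,4-6,8)) Groebner_Basis.algebra
  finally have e: "(u - U) * co = s ^ 4 * (const (- k) + const (- 1) * R)" .
  define Z where "Z = (const (- k) + const (- 1) * R) * inverse co"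
  have "u - U = (u - U) * co * inverse co" using co0 by simp
  hence "u = U + s ^ 4 * Z" unfolding e Z_def by (simp only: mult.assoc diff_eq_eq add.commute)
  moreover have "regular (affine_pt a b) Z"
    unfolding Z_def by (intro regular_intros[OF affine_pt_fermat has_value_s] R(1) hi)
  ultimately have "jet (affine_pt a b) s u (1) (- k) c2 c3"
    unfolding jet_def U_def by blast
  from jet_mult[OF affine_pt_fermat has_value_s jet_const[OF affine_pt_fermat has_value_s, of b] this]
  show ?thesis unfolding y s_def[symmetric] c(1) by (simp add: mult.commute)
qed

end

section \<open>The six classes\<close>

definition linear_form :: "qbar \<Rightarrow> qbar \<Rightarrow> qbar \<Rightarrow> nat \<Rightarrow> nat \<Rightarrow> qbar" where
  "linear_form u v w i j = (if i = 1 then u else if j = 1 then v else w)"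

lemma form_1: "form 1 g x y z = g 0 0 * z + g 0 1 * y + g 1 0 * x"
  by (simp add: form_def)

lemma form_linear: "form 1 (linear_form u v w) a b c = u * a + v * b + w * c"
  unfolding form_1 by (simp add: linear_form_def)

lemma restr_linear: "restr 1 (linear_form u v w) = const u * x_coord + const v * y_coord + const w"
  unfolding restr_def by (simp only: form_1) (simp add: linear_form_def)

lemma x_coord_minus_1: "x_coord - 1 \<noteq> 0" "x_coord - 1 \<in> function_field"
  using aff.x_nonconst[of 1] by (auto simp: const_hom intro: function_field_intros)

text \<open>Here y - \<eta> divides y^4 - 1 = -x^4 with a cofactor that is a unit at the point, and
  x vanishes there to order one.\<close>

lemma osculating_A:
  assumes "\<eta> ^ 4 = 1"
  shows "osculating [(0, \<eta>, 1)] (linear_form 0 1 (- \<eta>))"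
proof -
  define P where "P = proj_point 0 \<eta> 1"
  have c: "0 ^ 4 + \<eta> ^ 4 = 1" "\<eta> \<noteq> 0" using assms by auto
  have P: "P \<in> fermat" unfolding P_def by (rule fermat_affine[OF c(1)])
  let ?c = "y_coord^3 + y_coord^2 * const \<eta> + y_coord * const \<eta> ^ 2 + const \<eta> ^ 3"
  have e4: "const \<eta> ^ 4 = 1" unfolding const_hom(7)[symmetric] assms by (rule const_hom(2))
  have y0: "y_coord - const \<eta> \<noteq> 0"
  proof
    assume "y_coord - const \<eta> = 0"
    hence "y_coord ^ 4 = 1" using e4 by simp
    thus False using aff.curve aff.x_nonzero by simp
  qed
  have e: "(y_coord - const \<eta>) * ?c = const (-1) * x_coord ^ 4"
    using aff.curve e4 by (simp only: const_hom(2,5)) Groebner_Basis.algebra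
  have hc: "has_value P ?c (\<eta>^3 + \<eta>^2 * \<eta> + \<eta> * \<eta> ^ 2 + \<eta> ^ 3)"
    unfolding P_def by (intro has_value_add has_value_mult has_value_power has_value_const has_value_y fermat_affine c)
  have "\<eta>^3 + \<eta>^2 * \<eta> + \<eta> * \<eta> ^ 2 + \<eta> ^ 3 = 4 * \<eta> ^ 3" by Groebner_Basis.algebra
  with hc have hc: "has_value P ?c (4 * \<eta> ^ 3)" by (simp only:)
  have oc: "ord_at P ?c = 0" "?c \<noteq> 0"
    by (rule ord_at_unit[OF P hc], use c(2) in simp) (rule has_value_nonzero[OF P hc], use c(2) in simp)
  have ox: "ord_at P x_coord = 1"
    using ord_at_x_diff[OF c(1)] c(2) by (simp add: P_def const_hom)
  have "ord_at P (y_coord - const \<eta>) + ord_at P ?c = ord_at P (const (-1) * x_coord ^ 4)"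
    unfolding e[symmetric] using y0 oc(2) by (intro ord_at_mult[OF P, symmetric]) (auto intro!: function_field_intros)
  also have "\<dots> = 4"
    using aff.x_nonzero ox
    by (simp add: ord_at_mult[OF P] ord_at_power[OF P] ord_at_const[OF P] function_field_intros)
  finally have o: "ord_at P (y_coord - const \<eta>) = 4" using oc(1) by simp
  have "has_value P (x_coord - 1) (0 - 1)"
    unfolding P_def by (intro has_value_diff has_value_x has_value_1 fermat_affine c(1))
  hence o1: "ord_at P (x_coord - 1) = 0" by (intro ord_at_unit[OF P]) auto
  have "tangent_function 1 (linear_form 0 1 (- \<eta>)) = (y_coord - const \<eta>) / (x_coord - 1)"
    by (simp only: tangent_function_def restr_linear) (simp add: const_hom)
  hence "ord_at P (tangent_function 1 (linear_form 0 1 (- \<eta>))) = 4"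
    using o o1 y0 x_coord_minus_1 by (simp add: ord_at_divide[OF P] function_field_intros)
  thus ?thesis
    using P c(2) by (simp add: osculating_def form_linear[unfolded One_nat_def] P_def)
qed

text \<open>The point is totally ramified over x = \<eta>, so x - \<eta> vanishes there to order
  four. The excluded root 1 belongs to \<open>ptB 0\<close>.\<close>

lemma osculating_B:
  assumes "\<eta> ^ 4 = 1" "\<eta> \<noteq> 1"
  shows "osculating [(\<eta>, 0, 1)] (linear_form 1 0 (- \<eta>))"
proof -
  define P where "P = proj_point \<eta> 0 1"
  have c: "\<eta> ^ 4 + 0 ^ 4 = 1" using assms by auto
  have P: "P \<in> fermat" unfolding P_def by (rule fermat_affine[OF c])
  have "has_value P (x_coord - 1) (\<eta> - 1)"
    unfolding P_def by (intro has_value_diff has_value_x has_value_1 fermat_affine c)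
  hence o1: "ord_at P (x_coord - 1) = 0" using assms(2) by (intro ord_at_unit[OF P]) auto
  have "tangent_function 1 (linear_form 1 0 (- \<eta>)) = (x_coord - const \<eta>) / (x_coord - 1)"
    by (simp only: tangent_function_def restr_linear) (simp add: const_hom)
  hence "ord_at P (tangent_function 1 (linear_form 1 0 (- \<eta>))) = 4"
    using ord_at_x_diff[OF c] o1 aff.x_nonconst[of \<eta>] x_coord_minus_1
    by (simp add: ord_at_divide[OF P] function_field_intros P_def[symmetric])
  thus ?thesis
    using P assms(2) by (simp add: osculating_def form_linear[unfolded One_nat_def] P_def)
qed

text \<open>In the coordinates at infinity the two lines are given by
  \<open>x_inf - const \<eta>\<close>, up to a constant, and by the unit
  \<open>const (zeta 8) * x_inf - y_inf\<close>; the common pole 1 / \<open>y_inf\<close>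
  cancels.\<close>

lemma osculating_C:
  assumes "\<eta> ^ 4 = 1"
  shows "osculating [(zeta 8 * \<eta>, 1, 0)] (linear_form 1 (- (zeta 8 * \<eta>)) 0)"
proof -
  define P where "P = proj_point (zeta 8 * \<eta>) 1 0"
  have P: "P \<in> fermat" unfolding P_def by (rule fermat_inf[OF assms])
  have \<eta>: "\<eta> \<noteq> 0" using assms by auto
  interpret C: chart_point x_inf y_inf \<eta> 0
    using assms by unfold_locales simp
  obtain u v where u: "inf.val \<eta> 0 u v" "v \<noteq> 0" "x_inf - const \<eta> = C.param ^ 4 * u"
    using C.x_diff_factor by auto
  have o: "ord_at P (x_inf - const \<eta>) = 4"
    using ord_at_eqI[OF P uniformizer_inf[OF assms, folded P_def], of u v "x_inf - const \<eta>" 4] u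
    by (simp add: has_value_inf P_def C.param_def)
  have hd: "has_value P (const (zeta 8) * x_inf - y_inf) (zeta 8 * \<eta>)"
    unfolding P_def using has_value_inf_poly[of \<eta> "[:[:0, zeta 8:], [:-1:]:]"] by (simp add: const_hom algebra_simps)
  have od: "ord_at P (const (zeta 8) * x_inf - y_inf) = 0" "const (zeta 8) * x_inf - y_inf \<noteq> 0"
    using ord_at_unit[OF P hd] has_value_nonzero[OF P hd] \<eta> by simp_all
  have K: "x_inf - const \<eta> \<in> function_field" "const (zeta 8) * x_inf - y_inf \<in> function_field" "x_inf - const \<eta> \<noteq> 0"
    using inf.x_nonconst[of \<eta>] by (auto simp: x_inf_def y_inf_def intro!: function_field_intros)
  have "tangent_function 1 (linear_form 1 (- (zeta 8 * \<eta>)) 0) =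
      (x_coord - const (zeta 8) * const \<eta> * y_coord) / (x_coord - 1)"
    by (simp only: tangent_function_def restr_linear) (simp add: const_hom)
  also have "\<dots> = ((const (zeta 8) * (x_inf - const \<eta>)) / y_inf) / ((const (zeta 8) * x_inf - y_inf) / y_inf)"
  proof -
    have y: "y_coord = 1 / y_inf" by (simp add: y_inf_def)
    have "x_coord - const (zeta 8) * const \<eta> * y_coord = const (zeta 8) * (x_inf - const \<eta>) / y_inf"
      unfolding x_coord_inf unfolding y unfolding right_diff_distrib diff_divide_distrib by (simp only: times_divide_eq_right mult_1_right)
    moreover have "x_coord - 1 = (const (zeta 8) * x_inf - y_inf) / y_inf"
      using inf.y_nonzero by (simp add: x_coord_inf diff_divide_distrib)
    ultimately show ?thesis by simp
  qed
  also have "\<dots> = const (zeta 8) * (x_inf - const \<eta>) / (const (zeta 8) * x_inf - y_inf)"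
    using inf.y_nonzero by simp
  finally have "ord_at P (tangent_function 1 (linear_form 1 (- (zeta 8 * \<eta>)) 0)) = 4"
    using o od K by (simp add: ord_at_divide[OF P] ord_at_mult[OF P] ord_at_const[OF P] function_field_intros)
  thus ?thesis
    using P \<eta> by (simp add: osculating_def form_linear[unfolded One_nat_def] P_def)
qed

section \<open>The sixth class: a cubic with fourfold contact\<close>

abbreviation rt :: qbar where "rt \<equiv> fourth_root_2"

lemma rt_4: "rt ^ 4 = 2"
proof -
  have "complex_of_real (root 4 2) ^ 4 = complex_of_real (root 4 2 ^ 4)" by (simp only: of_real_power)
  also have "root 4 2 ^ 4 = (2::real)" by (rule real_root_pow_pos2) auto
  finally have "complex_of_real (root 4 2) ^ 4 = 2" by simp
  moreover have "complex_of_qbar 2 = 2"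
    unfolding one_add_one[symmetric] plus_qbar.rep_eq one_qbar.rep_eq ..
  ultimately have "complex_of_qbar (rt ^ 4) = complex_of_qbar 2"
    by (simp add: complex_of_qbar_power fourth_root_2.rep_eq)
  thus ?thesis by (simp only: complex_of_qbar_inject)
qed

text \<open>This is zeta_8 = (1 + i) / sqrt 2 with sqrt 2 = rt^2. The minimal polynomials do not fix
  the sign; it comes from the choice of the positive real root and of the exponential.\<close>

lemma two_zeta_8: "2 * zeta 8 = (1 + zeta 4) * rt ^ 2"
proof -
  have "root 4 2 ^ 2 = sqrt (2::real)"
    by (rule real_sqrt_unique[symmetric]) (simp_all add: power_mult[symmetric] real_root_pow_pos2)
  hence s: "complex_of_real (root 4 2) ^ 2 = complex_of_real (sqrt 2)"
    by (metis of_real_power)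
  have e8: "exp (2 * complex_of_real pi * \<i> / 8) = complex_of_real (cos (pi / 4)) + \<i> * complex_of_real (sin (pi / 4))"
  proof -
    have "2 * complex_of_real pi * \<i> / 8 = \<i> * complex_of_real (pi / 4)" by simp
    thus ?thesis by (simp only: cis_conv_exp[symmetric]) (simp add: cis.ctr complex_eq_iff)
  qed
  have e4: "exp (2 * complex_of_real pi * \<i> / 4) = \<i>"
  proof -
    have "2 * complex_of_real pi * \<i> / 4 = \<i> * complex_of_real (pi / 2)" by simp
    thus ?thesis by (simp only: cis_conv_exp[symmetric]) (simp add: cis.ctr complex_eq_iff)
  qed
  have "2 * exp (2 * complex_of_real pi * \<i> / 8) = (1 + \<i>) * complex_of_real (sqrt 2)"
    unfolding e8 cos_45 sin_45 by (simp add: complex_eq_iff)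
  hence "2 * exp (2 * complex_of_real pi * \<i> / 8) = (1 + exp (2 * complex_of_real pi * \<i> / 4)) * complex_of_real (root 4 2) ^ 2"
    unfolding e4 s .
  moreover have "complex_of_qbar 2 = 2"
    unfolding one_add_one[symmetric] plus_qbar.rep_eq one_qbar.rep_eq ..
  ultimately have "complex_of_qbar (2 * zeta 8) = complex_of_qbar ((1 + zeta 4) * rt ^ 2)"
    by (simp add: times_qbar.rep_eq plus_qbar.rep_eq one_qbar.rep_eq complex_of_qbar_power
        fourth_root_2.rep_eq zeta.rep_eq)
  thus ?thesis by (simp only: complex_of_qbar_inject)
qed

lemma coordinate_relations:
  "rt ^ 4 - 2 = 0" "zeta 4 ^ 2 + 1 = 0" "2 * zeta 8 - (1 + zeta 4) * rt ^ 2 = 0"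
  by (simp_all add: rt_4 zeta_4_2 two_zeta_8)

text \<open>
  The cubic meeting the curve with multiplicity four at each of the three points. Such a cubic is unique
  up to scaling; it was found by solving the linear system for its coefficients.
\<close>

definition cubic :: "nat \<Rightarrow> nat \<Rightarrow> qbar" where
  "cubic i j = (let
     d = - 2 + 4 * rt - 4 * rt * zeta 4 + 2 * rt ^ 2 * zeta 4;
     p = 4 * rt - 4 * rt ^ 2 - 6 * zeta 4 + 4 * rt * zeta 4;
     q = - 4 - 3 * rt ^ 2 + 4 * rt ^ 3 + 4 * zeta 4 - 3 * rt ^ 2 * zeta 4;
     m = - 10 + 8 * rt ^ 3 + 10 * zeta 4 - 8 * rt * zeta 4;
     c = - 2 + rt ^ 2 - 2 * zeta 4 - rt ^ 2 * zeta 4 + 4 * rt ^ 3 * zeta 4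
   in [[c, p, q, d], [p, m, - zeta 4 * p], [q, - zeta 4 * p], [d]] ! i ! j)"

lemma form_3:
  "form 3 g x y z = g 0 0 * z ^ 3 + g 0 1 * y * z ^ 2 + g 0 2 * y ^ 2 * z + g 0 3 * y ^ 3 +
     g 1 0 * x * z ^ 2 + g 1 1 * x * y * z + g 1 2 * x * y ^ 2 + g 2 0 * x ^ 2 * z + g 2 1 * x ^ 2 * y + g 3 0 * x ^ 3"
  by (simp add: form_def eval_nat_numeral algebra_simps)

text \<open>The cubic with free variables in place of the two field generators. It is symmetric in x
  and y, in accordance with the exchange of coordinates, which swaps \<open>P\<^sub>1\<close> and
  \<open>P\<^sub>2\<close> and fixes \<open>P\<^sub>3\<close>.\<close>

definition cubic_value :: "qbar \<Rightarrow> qbar \<Rightarrow> qbar \<Rightarrow> qbar \<Rightarrow> qbar \<Rightarrow> qbar" where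
  "cubic_value r i x y z = (let
     d = - 2 + 4 * r - 4 * r * i + 2 * r ^ 2 * i;
     p = 4 * r - 4 * r ^ 2 - 6 * i + 4 * r * i;
     q = - 4 - 3 * r ^ 2 + 4 * r ^ 3 + 4 * i - 3 * r ^ 2 * i;
     m = - 10 + 8 * r ^ 3 + 10 * i - 8 * r * i;
     c = - 2 + r ^ 2 - 2 * i - r ^ 2 * i + 4 * r ^ 3 * i
   in d * (x ^ 3 + y ^ 3) + p * (x + y) * z ^ 2 - i * p * (x * y * (x + y)) + q * (x ^ 2 + y ^ 2) * z + m * (x * y) * z + c * z ^ 3)"

lemma cubic_simps:
  "cubic 0 0 = - 2 + rt ^ 2 - 2 * zeta 4 - rt ^ 2 * zeta 4 + 4 * rt ^ 3 * zeta 4"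
  "cubic 0 1 = 4 * rt - 4 * rt ^ 2 - 6 * zeta 4 + 4 * rt * zeta 4"
  "cubic 0 2 = - 4 - 3 * rt ^ 2 + 4 * rt ^ 3 + 4 * zeta 4 - 3 * rt ^ 2 * zeta 4"
  "cubic 0 3 = - 2 + 4 * rt - 4 * rt * zeta 4 + 2 * rt ^ 2 * zeta 4"
  "cubic 1 0 = cubic 0 1" "cubic 1 1 = - 10 + 8 * rt ^ 3 + 10 * zeta 4 - 8 * rt * zeta 4"
  "cubic 1 2 = - zeta 4 * cubic 0 1" "cubic 2 0 = cubic 0 2" "cubic 2 1 = - zeta 4 * cubic 0 1" "cubic 3 0 = cubic 0 3"
  by (simp_all add: cubic_def Let_def eval_nat_numeral)

lemma form_cubic: "form 3 cubic x y z = cubic_value rt (zeta 4) x y z"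
  unfolding form_3 cubic_simps cubic_value_def Let_def by Groebner_Basis.algebra

lemma restr_cubic:
  "restr 3 cubic = const (cubic 0 3) * (x_coord * x_coord * x_coord + y_coord * y_coord * y_coord) +
     const (cubic 0 1) * (x_coord + y_coord) + const (- zeta 4 * cubic 0 1) * (x_coord * y_coord * (x_coord + y_coord)) +
     const (cubic 0 2) * (x_coord * x_coord + y_coord * y_coord) + const (cubic 1 1) * (x_coord * y_coord) + const (cubic 0 0)"
  unfolding restr_def form_3 unfolding cubic_simps(5,7-10) power_one mult_1_right by Groebner_Basis.algebra

lemma restr_cubic_nonzero: "restr 3 cubic \<noteq> 0" and cubic_B0: "form 3 cubic 1 0 1 \<noteq> 0"
proof -
  have "form 3 cubic 1 0 1 = cubic 0 3 + cubic 0 1 + cubic 0 2 + cubic 0 0"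
    unfolding form_3 cubic_simps(5,8,10) by simp
  \<comment> \<open>The second factor is 8 times the inverse of the value, expanded in the products
    of powers of \<open>rt\<close> and \<open>zeta 4\<close>.\<close>
  hence "form 3 cubic 1 0 1 * (- 7 - 6 * rt - 5 * rt ^ 2 - 4 * rt ^ 3 + 3 * zeta 4 + 2 * rt * zeta 4 +
      2 * rt ^ 2 * zeta 4 + 2 * rt ^ 3 * zeta 4) = 8"
    unfolding cubic_simps using coordinate_relations by Groebner_Basis.algebra
  thus nz: "form 3 cubic 1 0 1 \<noteq> 0" by auto
  have "has_value (ptB 0) (restr 3 cubic) (form 3 cubic 1 0 1)"
    using has_value_restr_B0[of 3 cubic] by simp
  from has_value_nonzero[OF B0_fermat this nz] show "restr 3 cubic \<noteq> 0" .
qed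

lemma point_powers:
  "(rt * zeta 4) ^ 4 = 2" "zeta 8 ^ 4 = -1" "inverse rt ^ 4 = 1 / 2"
  by (simp_all add: power_mult_distrib rt_4 zeta_4_4 zeta_8_4 power_inverse)

text \<open>With w = 2^(-1/4) all constants become polynomials in w and \<open>zeta 4\<close>,
  subject only to 2 w^4 = 1 and zeta_4^2 = -1; this eliminates inverses before Groebner bases are
  used.\<close>

lemma in_inverse_rt:
  obtains w where "inverse rt = w" "rt = 2 * w ^ 3" "rt ^ 2 = 2 * w ^ 2" "rt ^ 3 = 2 * w"
    "zeta 8 = (1 + zeta 4) * w ^ 2" "2 * w ^ 4 - 1 = 0"
proof -
  obtain w where w: "inverse rt = w" by blast
  have "rt \<noteq> 0" using rt_4 by auto
  hence i: "rt * w - 1 = 0" unfolding w[symmetric] by simp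
  have "rt = 2 * w ^ 3" "rt ^ 2 = 2 * w ^ 2" "rt ^ 3 = 2 * w" "2 * w ^ 4 - 1 = 0"
    using i coordinate_relations(1) by Groebner_Basis.algebra+
  moreover have "zeta 8 = (1 + zeta 4) * w ^ 2"
    using two_zeta_8 unfolding \<open>rt ^ 2 = 2 * w ^ 2\<close> by simp
  ultimately show ?thesis using w that by blast
qed

context
  fixes a b k c1 c2 c3 :: qbar
  assumes ab: "a ^ 4 + b ^ 4 = 1" "a \<noteq> 0" "b \<noteq> 0"
    and k: "k * b ^ 4 = a ^ 4" "c1 = - k" "2 * c2 = - 3 * (k + k ^ 2)" "2 * c3 = - (2 * k + 9 * k ^ 2 + 7 * k ^ 3)"
begin

lemmas jet_rules = jet_add[OF affine_pt_fermat[OF ab] has_value_rel_param[OF ab]] jet_mult[OF affine_pt_fermat[OF ab] has_value_rel_param[OF ab]]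
  jet_const[OF affine_pt_fermat[OF ab] has_value_rel_param[OF ab]] jet_x[OF ab] jet_y[OF ab k]

end

lemmas jet_zero_cubic = jet_zero_ord[OF affine_pt_fermat has_value_rel_param _ _ _ _ _ restr_cubic_nonzero ord_at_rel_param]

text \<open>At the three points k = a^4 / b^4 is -2, -1/2 and 1, and the coefficients required by
  \<open>jet_y\<close> are (2, -3, 12), (1/2, 3/8, -3/16) and (-1, -3, -9). The expansions of x and
  y are propagated through the cubic, whose first four coefficients vanish by the relations between
  the constants.\<close>

lemma ord_cubic_1: "ord_at (proj_point (rt * zeta 4) (zeta 8) 1) (restr 3 cubic) \<ge> 4"
proof -
  have ab: "(rt * zeta 4) ^ 4 + zeta 8 ^ 4 = 1" "rt * zeta 4 \<noteq> 0" "zeta 8 \<noteq> 0"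
    using rt_4 by (auto simp: point_powers)
  have k: "(-2) * zeta 8 ^ 4 = (rt * zeta 4) ^ 4" "2 = - (-2 :: qbar)" "2 * (-3) = - 3 * ((-2) + (-2) ^ 2 :: qbar)"
    "2 * 12 = - (2 * (-2) + 9 * (-2) ^ 2 + 7 * (-2) ^ 3 :: qbar)"
    unfolding point_powers by (simp_all add: power2_eq_square power3_eq_cube)
  show ?thesis
    apply (rule jet_zero_cubic[OF ab ab _ _ _ _ _ ab])
    apply (subst restr_cubic, (rule jet_rules[OF ab k])+)
    unfolding cubic_simps using coordinate_relations by Groebner_Basis.algebra+
qed

lemma ord_cubic_2: "ord_at (proj_point (zeta 8) (rt * zeta 4) 1) (restr 3 cubic) \<ge> 4"
proof -
  have ab: "zeta 8 ^ 4 + (rt * zeta 4) ^ 4 = 1" "zeta 8 \<noteq> 0" "rt * zeta 4 \<noteq> 0"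
    using rt_4 by (auto simp: point_powers)
  have k: "(-1/2) * (rt * zeta 4) ^ 4 = zeta 8 ^ 4" "1/2 = - (-1/2 :: qbar)" "2 * (3/8) = - 3 * ((-1/2) + (-1/2) ^ 2 :: qbar)"
    "2 * (-3/16) = - (2 * (-1/2) + 9 * (-1/2) ^ 2 + 7 * (-1/2) ^ 3 :: qbar)"
    unfolding point_powers by (simp_all add: power2_eq_square power3_eq_cube)
  show ?thesis
    apply (rule jet_zero_cubic[OF ab ab _ _ _ _ _ ab])
    apply (subst restr_cubic, (rule jet_rules[OF ab k])+)
    unfolding cubic_simps using coordinate_relations by Groebner_Basis.algebra+
qed

lemma ord_cubic_3: "ord_at (proj_point (inverse rt) (inverse rt) 1) (restr 3 cubic) \<ge> 4"
proof -
  have ab: "inverse rt ^ 4 + inverse rt ^ 4 = 1" "inverse rt \<noteq> 0" "inverse rt \<noteq> 0"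
    using rt_4 by (auto simp: point_powers)
  have k: "1 * inverse rt ^ 4 = inverse rt ^ 4" "-1 = - (1 :: qbar)" "2 * (-3) = - 3 * (1 + 1 ^ 2 :: qbar)"
    "2 * (-9) = - (2 * 1 + 9 * 1 ^ 2 + 7 * 1 ^ 3 :: qbar)"
    by (simp_all add: power2_eq_square power3_eq_cube)
  obtain w where w: "inverse rt = w" and r: "rt = 2 * w ^ 3" "rt ^ 2 = 2 * w ^ 2" "rt ^ 3 = 2 * w"
    and w4: "2 * w ^ 4 - 1 = 0"
    by (rule in_inverse_rt)
  show ?thesis
    apply (rule jet_zero_cubic[OF ab ab _ _ _ _ _ ab])
    apply (subst restr_cubic, (rule jet_rules[OF ab k])+)
    unfolding cubic_simps unfolding w r(2,3) unfolding r(1) mult_zero_left mult_zero_right add_0_left add_0_right mult_minus1 mult_1_left mult_1_right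
    subgoal using w4 coordinate_relations(2) by Groebner_Basis.algebra
    subgoal by Groebner_Basis.algebra
    subgoal using w4 coordinate_relations(2) by Groebner_Basis.algebra
    subgoal using w4 coordinate_relations(2) by Groebner_Basis.algebra
    done
qed

lemma zeta_4_neq: "zeta 4 \<noteq> 1" "zeta 4 \<noteq> -1"
  using zeta_4_2 by auto

text \<open>Apart from nonvanishing, the fourth powers 2, -1, 1/2 and 1 already separate the
  coordinates.\<close>

lemma sixth_points_neq:
  "rt * zeta 4 \<noteq> 0" "rt \<noteq> 0" "rt * zeta 4 \<noteq> 1" "zeta 8 \<noteq> 1" "inverse rt \<noteq> 1"
  "rt * zeta 4 \<noteq> zeta 8" "rt * zeta 4 \<noteq> inverse rt" "zeta 8 \<noteq> inverse rt"
proof -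
  have two: "(2::qbar) \<noteq> 1" "(2::qbar) \<noteq> -1" "(2::qbar) \<noteq> 1 / 2" "(-1::qbar) \<noteq> 1 / 2"
    by (simp_all add: eq_divide_eq)
  show "rt \<noteq> 0" using rt_4 by auto
  thus "rt * zeta 4 \<noteq> 0" by simp
  have neq: "x \<noteq> y" if "x ^ 4 \<noteq> y ^ 4" for x y :: qbar using that by auto
  thus "rt * zeta 4 \<noteq> 1" "zeta 8 \<noteq> 1" "inverse rt \<noteq> 1" "rt * zeta 4 \<noteq> zeta 8"
    "rt * zeta 4 \<noteq> inverse rt" "zeta 8 \<noteq> inverse rt"
    by - (rule neq, use two in \<open>simp add: point_powers\<close>)+
qed

abbreviation "sixth_points \<equiv> [(rt * zeta 4, zeta 8, 1), (zeta 8, rt * zeta 4, 1), (inverse rt, inverse rt, 1 :: qbar)]"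

lemma osculating_cubic: "osculating sixth_points cubic"
proof -
  have ge: "ord_at (proj_point a b 1) (tangent_function 3 cubic) \<ge> 4"
    if ab: "a ^ 4 + b ^ 4 = 1" "a \<noteq> 1" and o: "ord_at (proj_point a b 1) (restr 3 cubic) \<ge> 4" for a b
  proof -
    have P: "proj_point a b 1 \<in> fermat" by (rule fermat_affine[OF ab(1)])
    have "has_value (proj_point a b 1) (x_coord - 1) (a - 1)"
      by (intro has_value_diff has_value_x has_value_1 P ab(1))
    hence "ord_at (proj_point a b 1) (x_coord - 1) = 0"
      using ab(2) by (intro ord_at_unit[OF P]) auto
    thus ?thesis
      using o restr_cubic_nonzero x_coord_minus_1
      by (simp add: tangent_function_def ord_at_divide[OF P] ord_at_power[OF P] restr_mem function_field_power)
  qed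
  have on: "(rt * zeta 4) ^ 4 + zeta 8 ^ 4 = 1" "zeta 8 ^ 4 + (rt * zeta 4) ^ 4 = 1"
    "inverse rt ^ 4 + inverse rt ^ 4 = 1"
    by (simp_all add: point_powers)
  note n = sixth_points_neq
  show ?thesis
    unfolding osculating_def
    using ge[OF on(1) n(3) ord_cubic_1] ge[OF on(2) n(4) ord_cubic_2] ge[OF on(3) n(5) ord_cubic_3]
      fermat_affine[OF on(1)] fermat_affine[OF on(2)] fermat_affine[OF on(3)] n cubic_B0
    by (simp add: proj_point_affine_eq eval_nat_numeral)
qed

section \<open>Evaluation of the pairings\<close>

lemma classes_eq:
  "e\<^sub>1 = jac_class (div_of [(0, zeta 4, 1)])" "e\<^sub>2 = jac_class (div_of [(0, -1, 1)])"
  "e\<^sub>3 = jac_class (div_of [(zeta 4, 0, 1)])" "e\<^sub>4 = jac_class (div_of [(-1, 0, 1)])"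
  "e\<^sub>5 = jac_class (div_of [(zeta 8 * zeta 4, 1, 0)])" "e\<^sub>6' = jac_class (div_of sixth_points)"
  by (simp_all add: e\<^sub>1_def e\<^sub>2_def e\<^sub>3_def e\<^sub>4_def e\<^sub>5_def e\<^sub>6'_def div_of_def ptA_def ptB_def ptC_def
      P\<^sub>1_def P\<^sub>2_def P\<^sub>3_def zeta_4_2 add.assoc)

lemma osculating_classes:
  "osculating [(0, zeta 4, 1)] (linear_form 0 1 (- zeta 4))" "osculating [(0, -1, 1)] (linear_form 0 1 1)"
  "osculating [(zeta 4, 0, 1)] (linear_form 1 0 (- zeta 4))" "osculating [(-1, 0, 1)] (linear_form 1 0 1)"
  "osculating [(zeta 8 * zeta 4, 1, 0)] (linear_form 1 (- (zeta 8 * zeta 4)) 0)"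
  using osculating_A[of "zeta 4"] osculating_A[of "-1"] osculating_B[of "zeta 4"] osculating_B[of "-1"]
    osculating_C[of "zeta 4"] zeta_4_neq by (simp_all add: zeta_4_4)

lemma weil_pairing_lines:
  assumes "osculating [p] (linear_form u v w)" "osculating [q] (linear_form u' v' w')" "pt p \<noteq> pt q"
    and "(u' * fst p + v' * fst (snd p) + w' * snd (snd p)) * (fst q - snd (snd q)) * (u + w) =
      zeta 4 ^ n * ((u * fst q + v * fst (snd q) + w * snd (snd q)) * (fst p - snd (snd p)) * (u' + w'))"
  shows "weil_pairing (jac_class (div_of [p])) (jac_class (div_of [q])) = of_nat n \<and>
    weil_pairing (jac_class (div_of [q])) (jac_class (div_of [p])) = of_nat (3 * n)"
  using weil_pairing_osculating[OF assms(1,2), of n] assms(3,4)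
  by (simp_all add: form_linear[unfolded One_nat_def])

lemma weil_pairing_line_cubic:
  assumes "osculating [p] (linear_form u v w)" "pt p \<notin> pt ` set sixth_points"
    and "eval_form 3 cubic p * ((rt * zeta 4 - 1) * ((zeta 8 - 1) * (inverse rt - 1))) * (u + w) ^ 3 =
      zeta 4 ^ n * (((u * (rt * zeta 4) + v * zeta 8 + w) * ((u * zeta 8 + v * (rt * zeta 4) + w) *
        (u * inverse rt + v * inverse rt + w))) * (fst p - snd (snd p)) ^ 3 * form 3 cubic 1 0 1)"
  shows "weil_pairing (jac_class (div_of [p])) (jac_class (div_of sixth_points)) = of_nat n \<and>
    weil_pairing (jac_class (div_of sixth_points)) (jac_class (div_of [p])) = of_nat (3 * n)"
proof -
  have d: "pt ` set [p] \<inter> pt ` set sixth_points = {}" using assms(2) by auto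
  have l: "length [p] = 1" "length sixth_points = 3" by simp_all
  have "(\<Prod>p\<leftarrow>[p]. eval_form 3 cubic p) * (\<Prod>q\<leftarrow>sixth_points. (fst q - snd (snd q)) ^ 1) *
      eval_form 1 (linear_form u v w) (1, 0, 1) ^ 3 =
    zeta 4 ^ n * ((\<Prod>q\<leftarrow>sixth_points. eval_form 1 (linear_form u v w) q) * (\<Prod>p\<leftarrow>[p]. (fst p - snd (snd p)) ^ 3) *
      eval_form 3 cubic (1, 0, 1) ^ 1)"
    using assms(3) by (simp only: form_linear list.map prod_list.Cons prod_list.Nil fst_conv snd_conv
        mult_1_right power_one_right mult_zero_right add_0_right)
  from weil_pairing_osculating[OF assms(1) osculating_cubic d, unfolded l, OF this]
  show ?thesis by blast
qed

lemmas distinct_points = proj_point_affine_eq proj_point_affine_neq_inf proj_point_affine_neq_inf[symmetric]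
  zeta_4_neq sixth_points_neq

lemma zeta_8_square: "zeta 8 ^ 2 - zeta 4 = 0"
  using coordinate_relations by Groebner_Basis.algebra

lemmas pairing_simps = fst_conv snd_conv mult_zero_left mult_zero_right mult_1_left mult_1_right
  add_0_left add_0_right diff_0 diff_0_right power_0 power_one_right power_one

lemma pairing_12: "weil_pairing e\<^sub>1 e\<^sub>2 = of_nat 1 \<and> weil_pairing e\<^sub>2 e\<^sub>1 = of_nat (3 * 1)"
  unfolding classes_eq
  by (rule weil_pairing_lines[OF osculating_classes(1,2)], simp add: distinct_points, unfold pairing_simps)
    (Groebner_Basis.algebra | insert coordinate_relations(2) zeta_8_square, Groebner_Basis.algebra)

lemma pairing_13: "weil_pairing e\<^sub>1 e\<^sub>3 = of_nat 3 \<and> weil_pairing e\<^sub>3 e\<^sub>1 = of_nat (3 * 3)"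
  unfolding classes_eq
  by (rule weil_pairing_lines[OF osculating_classes(1,3)], simp add: distinct_points, unfold pairing_simps)
    (Groebner_Basis.algebra | insert coordinate_relations(2) zeta_8_square, Groebner_Basis.algebra)

lemma pairing_14: "weil_pairing e\<^sub>1 e\<^sub>4 = of_nat 0 \<and> weil_pairing e\<^sub>4 e\<^sub>1 = of_nat (3 * 0)"
  unfolding classes_eq
  by (rule weil_pairing_lines[OF osculating_classes(1,4)], simp add: distinct_points, unfold pairing_simps)
    (Groebner_Basis.algebra | insert coordinate_relations(2) zeta_8_square, Groebner_Basis.algebra)

lemma pairing_15: "weil_pairing e\<^sub>1 e\<^sub>5 = of_nat 3 \<and> weil_pairing e\<^sub>5 e\<^sub>1 = of_nat (3 * 3)"
  unfolding classes_eq
  by (rule weil_pairing_lines[OF osculating_classes(1,5)], simp add: distinct_points, unfold pairing_simps)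
    (Groebner_Basis.algebra | insert coordinate_relations(2) zeta_8_square, Groebner_Basis.algebra)

lemma pairing_23: "weil_pairing e\<^sub>2 e\<^sub>3 = of_nat 3 \<and> weil_pairing e\<^sub>3 e\<^sub>2 = of_nat (3 * 3)"
  unfolding classes_eq
  by (rule weil_pairing_lines[OF osculating_classes(2,3)], simp add: distinct_points, unfold pairing_simps)
    (Groebner_Basis.algebra | insert coordinate_relations(2) zeta_8_square, Groebner_Basis.algebra)

lemma pairing_24: "weil_pairing e\<^sub>2 e\<^sub>4 = of_nat 0 \<and> weil_pairing e\<^sub>4 e\<^sub>2 = of_nat (3 * 0)"
  unfolding classes_eq
  by (rule weil_pairing_lines[OF osculating_classes(2,4)], simp add: distinct_points, unfold pairing_simps)
    (Groebner_Basis.algebra | insert coordinate_relations(2) zeta_8_square, Groebner_Basis.algebra)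

lemma pairing_25: "weil_pairing e\<^sub>2 e\<^sub>5 = of_nat 1 \<and> weil_pairing e\<^sub>5 e\<^sub>2 = of_nat (3 * 1)"
  unfolding classes_eq
  by (rule weil_pairing_lines[OF osculating_classes(2,5)], simp add: distinct_points, unfold pairing_simps)
    (Groebner_Basis.algebra | insert coordinate_relations(2) zeta_8_square, Groebner_Basis.algebra)

lemma pairing_34: "weil_pairing e\<^sub>3 e\<^sub>4 = of_nat 2 \<and> weil_pairing e\<^sub>4 e\<^sub>3 = of_nat (3 * 2)"
  unfolding classes_eq
  by (rule weil_pairing_lines[OF osculating_classes(3,4)], simp add: distinct_points, unfold pairing_simps)
    (Groebner_Basis.algebra | insert coordinate_relations(2) zeta_8_square, Groebner_Basis.algebra)

lemma pairing_35: "weil_pairing e\<^sub>3 e\<^sub>5 = of_nat 3 \<and> weil_pairing e\<^sub>5 e\<^sub>3 = of_nat (3 * 3)"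
  unfolding classes_eq
  by (rule weil_pairing_lines[OF osculating_classes(3,5)], simp add: distinct_points, unfold pairing_simps)
    (Groebner_Basis.algebra | insert coordinate_relations(2) zeta_8_square, Groebner_Basis.algebra)

lemma pairing_45: "weil_pairing e\<^sub>4 e\<^sub>5 = of_nat 0 \<and> weil_pairing e\<^sub>5 e\<^sub>4 = of_nat (3 * 0)"
  unfolding classes_eq
  by (rule weil_pairing_lines[OF osculating_classes(4,5)], simp add: distinct_points, unfold pairing_simps)
    (Groebner_Basis.algebra | insert coordinate_relations(2) zeta_8_square, Groebner_Basis.algebra)

lemma small_powers:
  "(0::qbar) ^ 2 = 0" "(0::qbar) ^ 3 = 0" "(-1::qbar) ^ 2 = 1" "(-1::qbar) ^ 3 = -1"
  "(1 + 1 :: qbar) ^ 3 = 8" "(-1 - 1 :: qbar) ^ 3 = -8"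
  by (simp_all add: power2_eq_square power3_eq_cube)

lemma pairing_16: "weil_pairing e\<^sub>1 e\<^sub>6' = of_nat 1 \<and> weil_pairing e\<^sub>6' e\<^sub>1 = of_nat (3 * 1)"
proof -
  obtain w where w: "inverse rt = w" and r: "rt = 2 * w ^ 3" "rt ^ 2 = 2 * w ^ 2" "rt ^ 3 = 2 * w"
    and z: "zeta 8 = (1 + zeta 4) * w ^ 2" and w4: "2 * w ^ 4 - 1 = 0"
    by (rule in_inverse_rt)
  show ?thesis
    unfolding classes_eq
    apply (rule weil_pairing_line_cubic[OF osculating_classes(1)], simp add: distinct_points)
    unfolding form_cubic cubic_value_def Let_def pairing_simps small_powers unfolding r(2,3) unfolding w z unfolding r(1)
    using w4 coordinate_relations(2) by Groebner_Basis.algebra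
qed

lemma pairing_26: "weil_pairing e\<^sub>2 e\<^sub>6' = of_nat 1 \<and> weil_pairing e\<^sub>6' e\<^sub>2 = of_nat (3 * 1)"
proof -
  obtain w where w: "inverse rt = w" and r: "rt = 2 * w ^ 3" "rt ^ 2 = 2 * w ^ 2" "rt ^ 3 = 2 * w"
    and z: "zeta 8 = (1 + zeta 4) * w ^ 2" and w4: "2 * w ^ 4 - 1 = 0"
    by (rule in_inverse_rt)
  show ?thesis
    unfolding classes_eq
    apply (rule weil_pairing_line_cubic[OF osculating_classes(2)], simp add: distinct_points)
    unfolding form_cubic cubic_value_def Let_def pairing_simps small_powers unfolding r(2,3) unfolding w z unfolding r(1)
    using w4 coordinate_relations(2) by Groebner_Basis.algebra
qed

lemma pairing_36: "weil_pairing e\<^sub>3 e\<^sub>6' = of_nat 0 \<and> weil_pairing e\<^sub>6' e\<^sub>3 = of_nat (3 * 0)"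
proof -
  obtain w where w: "inverse rt = w" and r: "rt = 2 * w ^ 3" "rt ^ 2 = 2 * w ^ 2" "rt ^ 3 = 2 * w"
    and z: "zeta 8 = (1 + zeta 4) * w ^ 2" and w4: "2 * w ^ 4 - 1 = 0"
    by (rule in_inverse_rt)
  show ?thesis
    unfolding classes_eq
    apply (rule weil_pairing_line_cubic[OF osculating_classes(3)], simp add: distinct_points)
    unfolding form_cubic cubic_value_def Let_def pairing_simps small_powers unfolding r(2,3) unfolding w z unfolding r(1)
    using w4 coordinate_relations(2) by Groebner_Basis.algebra
qed

lemma pairing_46: "weil_pairing e\<^sub>4 e\<^sub>6' = of_nat 1 \<and> weil_pairing e\<^sub>6' e\<^sub>4 = of_nat (3 * 1)"
proof -
  obtain w where w: "inverse rt = w" and r: "rt = 2 * w ^ 3" "rt ^ 2 = 2 * w ^ 2" "rt ^ 3 = 2 * w"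
    and z: "zeta 8 = (1 + zeta 4) * w ^ 2" and w4: "2 * w ^ 4 - 1 = 0"
    by (rule in_inverse_rt)
  show ?thesis
    unfolding classes_eq
    apply (rule weil_pairing_line_cubic[OF osculating_classes(4)], simp add: distinct_points)
    unfolding form_cubic cubic_value_def Let_def pairing_simps small_powers unfolding r(2,3) unfolding w z unfolding r(1)
    using w4 coordinate_relations(2) by Groebner_Basis.algebra
qed

lemma pairing_56: "weil_pairing e\<^sub>5 e\<^sub>6' = of_nat 1 \<and> weil_pairing e\<^sub>6' e\<^sub>5 = of_nat (3 * 1)"
proof -
  obtain w where w: "inverse rt = w" and r: "rt = 2 * w ^ 3" "rt ^ 2 = 2 * w ^ 2" "rt ^ 3 = 2 * w"
    and z: "zeta 8 = (1 + zeta 4) * w ^ 2" and w4: "2 * w ^ 4 - 1 = 0"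
    by (rule in_inverse_rt)
  show ?thesis
    unfolding classes_eq
    apply (rule weil_pairing_line_cubic[OF osculating_classes(5)], simp add: distinct_points)
    unfolding form_cubic cubic_value_def Let_def pairing_simps small_powers unfolding r(2,3) unfolding w z unfolding r(1)
    using w4 coordinate_relations(2) by Groebner_Basis.algebra
qed

lemma pairing_diagonal:
  "weil_pairing e\<^sub>1 e\<^sub>1 = 0" "weil_pairing e\<^sub>2 e\<^sub>2 = 0" "weil_pairing e\<^sub>3 e\<^sub>3 = 0"
  "weil_pairing e\<^sub>4 e\<^sub>4 = 0" "weil_pairing e\<^sub>5 e\<^sub>5 = 0" "weil_pairing e\<^sub>6' e\<^sub>6' = 0"
  unfolding classes_eq
  by - (rule weil_pairing_self, rule osculating_classes osculating_cubic)+

lemmas pairings = pairing_12 pairing_13 pairing_14 pairing_15 pairing_16 pairing_23 pairing_24 pairing_25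
  pairing_26 pairing_34 pairing_35 pairing_36 pairing_45 pairing_46 pairing_56 pairing_diagonal

text \<open>Torsion comes from the functions with divisor four times the representatives. The
  entries above the diagonal are the fifteen evaluations, those below follow by
  antisymmetry.\<close>

theorem theoremB1:
  shows "set torsion_basis \<subseteq> Jac_torsion 4 \<and>
    weil_matrix torsion_basis =
    mat_of_rows_list 6
      [[0, 1, 3, 0, 3, 1],
       [3, 0, 3, 0, 1, 1],
       [1, 1, 0, 2, 3, 0],
       [0, 0, 2, 0, 0, 1],
       [1, 3, 1, 0, 0, 1],
       [3, 3, 0, 3, 3, 0]]"
proof
  have "jac_class (div_of ps) \<in> Jac_torsion 4" if "osculating ps g" for ps g
    using that by (rule osculating_torsion)
  thus "set torsion_basis \<subseteq> Jac_torsion 4"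
    unfolding torsion_basis_def classes_eq using osculating_classes osculating_cubic by auto
next
  let ?M = "mat_of_rows_list 6
      [[0, 1, 3, 0, 3, 1],
       [3, 0, 3, 0, 1, 1],
       [1, 1, 0, 2, 3, 0],
       [0, 0, 2, 0, 0, 1],
       [1, 3, 1, 0, 0, 1],
       [3, 3, 0, 3, 3, 0]] :: 4 mat"
  have "weil_matrix torsion_basis $$ (i, j) = ?M $$ (i, j)" if "i < 6" "j < 6" for i j
  proof -
    have c: "k \<in> {0, 1, 2, 3, 4, 5}" if "k < 6" for k :: nat using that by auto
    show ?thesis
      using c[OF that(1)] c[OF that(2)]
      by (elim insertE emptyE; hypsubst; simp add: weil_matrix_def torsion_basis_def mat_of_rows_list_def pairings)
  qed
  thus "weil_matrix torsion_basis = ?M"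
    by (intro eq_matI) (simp_all add: weil_matrix_def torsion_basis_def mat_of_rows_list_def)
qed

end
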